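(* Let $d\in\{2,3\}$, let $\omega\subset\omega^*$ be concentric open cubes in $\mathbb{R}^d$ with side lengths $\sigma$ and $\sigma^*=(1+\rho)\sigma$, $\rho>0$, and let $A$ be a coefficient matrix on $\omega^*$ with bounds $\alpha,\beta$. Let $N\ge1$ and $n\ge1$ be integers, $m=N\times n$, and let $\omega_j$, $j=1,\ldots,N+1$, be the concentric cubes with side length $\sigma(1+\rho(N+1-j)/N)$, so that $\omega=\omega_{N+1}\subset\omega_N\subset\cdots\subset\omega_1=\omega^*$. Define $$\mathcal{T}(m,\omega,\omega^* )=\mathcal{F}_n(\omega,\omega_1)+\cdots+\mathcal{F}_n(\omega,\omega_N).$$ Then for every $u\in H_A^0(\omega^* )$ there exists $z_u\in\mathcal{T}(m,\omega,\omega^* )$ such that $$\|u-z_u\|_{\mathcal{E}(\omega)}\le\varsigma^N\|u\|_{\mathcal{E}(\omega^* )},\qquad \varsigma=2\frac{\gamma_d^{1/d}}{\sqrt\pi}\frac{1+\rho}{\rho}N(\beta/\alpha)^{1/2}C_n,$$ where $\gamma_d$ is the volume of the unit ball in $\mathbb{R}^d$ and $C_n$ is a number depending only on $n$ and $d$ with $C_n=n^{-1/d}(1+o(1))$ as $n\to\infty$.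
   Context: $A$ is a measurable symmetric matrix field with $\alpha|v|^2\le v^TA(x)v\le\beta|v|^2$, $0<\alpha\le\beta<\infty$. For an open $S$: $\|u\|_{\mathcal{E}(S)}=(\int_SA\nabla u\cdot\nabla u\,dx)^{1/2}$; $H_A(S)$ is the set of $v\in H^1(S)$ with $\int_SA\nabla v\cdot\nabla\varphi\,dx=0$ for all $\varphi\in C_0^\infty(S)$; $H_A^0(S)$ is the subspace of zero-average functions. For an open cube $Q^*$: let $v_1,\ldots,v_n$ be the first $n$ non-constant eigenfunctions of the Neumann problem $\int_{Q^*}A\nabla v_i\cdot\nabla w=\lambda_i\int_{Q^*}v_iw$ for all $w\in H^1(Q^* )$; let $h_i\in H_A(Q^* )$ with $h_i=v_i$ on $\partial Q^*$ and $w_i=h_i-\frac{1}{|Q^*|}\int_{Q^*}h_i$; $W_n(Q^* )=\mathrm{span}\{w_1,\dots,w_n\}$. For concentric cubes $Q\subset Q^*$, $\mathcal{F}_n(Q,Q^* )$ is the space of restrictions to $Q$ of elements of $W_n(Q^* )$. *)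

theory Defs
  imports "HOL-Analysis.Analysis" "HOL-Library.Landau_Symbols"
begin

definition cube :: "real^'d \<Rightarrow> real \<Rightarrow> (real^'d) set" where
  "cube c s = box (c - (s/2) *\<^sub>R One) (c + (s/2) *\<^sub>R One)"

definition sub_cube :: "real^'d \<Rightarrow> real \<Rightarrow> real \<Rightarrow> nat \<Rightarrow> nat \<Rightarrow> (real^'d) set" where
  "sub_cube c \<sigma> \<rho> N j = cube c (\<sigma> * (1 + \<rho> * real (N + 1 - j) / real N))"

definition pderiv_axis :: "'d::finite \<Rightarrow> (real^'d \<Rightarrow> real) \<Rightarrow> real^'d \<Rightarrow> real" where
  "pderiv_axis i f x = deriv (\<lambda>t. f (x + t *\<^sub>R axis i 1)) 0"

fun dpart :: "'d::finite list \<Rightarrow> (real^'d \<Rightarrow> real) \<Rightarrow> real^'d \<Rightarrow> real" where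
  "dpart [] f = f"
| "dpart (i # is) f = pderiv_axis i (dpart is f)"

definition smooth_fun :: "(real^'d \<Rightarrow> real) \<Rightarrow> bool" where
  "smooth_fun f \<longleftrightarrow> (\<forall>is. continuous_on UNIV (dpart is f) \<and>
      (\<forall>i x. (\<lambda>t. dpart is f (x + t *\<^sub>R axis i 1)) differentiable (at 0)))"

definition test_fun :: "(real^'d) set \<Rightarrow> (real^'d \<Rightarrow> real) \<Rightarrow> bool" where
  "test_fun S \<phi> \<longleftrightarrow> smooth_fun \<phi> \<and> compact (closure {x. \<phi> x \<noteq> 0}) \<and> closure {x. \<phi> x \<noteq> 0} \<subseteq> S"

definition cgrad :: "(real^'d \<Rightarrow> real) \<Rightarrow> real^'d \<Rightarrow> real^'d" where
  "cgrad f x = (\<chi> i. pderiv_axis i f x)"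

definition L2 :: "(real^'d) set \<Rightarrow> (real^'d \<Rightarrow> real) \<Rightarrow> bool" where
  "L2 S u \<longleftrightarrow> u \<in> borel_measurable (lebesgue_on S) \<and> integrable (lebesgue_on S) (\<lambda>x. (u x)\<^sup>2)"

definition weak_grad :: "(real^'d) set \<Rightarrow> (real^'d \<Rightarrow> real) \<Rightarrow> (real^'d \<Rightarrow> real^'d) \<Rightarrow> bool" where
  "weak_grad S u g \<longleftrightarrow> (\<forall>i. L2 S (\<lambda>x. g x $ i)) \<and>
     (\<forall>\<phi>. test_fun S \<phi> \<longrightarrow> (\<forall>i.
        integral\<^sup>L (lebesgue_on S) (\<lambda>x. u x * pderiv_axis i \<phi> x)
        = - integral\<^sup>L (lebesgue_on S) (\<lambda>x. g x $ i * \<phi> x)))"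

definition H1 :: "(real^'d) set \<Rightarrow> (real^'d \<Rightarrow> real) \<Rightarrow> bool" where
  "H1 S u \<longleftrightarrow> L2 S u \<and> (\<exists>g. weak_grad S u g)"

text \<open>The weak gradient (unique almost everywhere on S; any representative).\<close>
definition wgrad :: "(real^'d) set \<Rightarrow> (real^'d \<Rightarrow> real) \<Rightarrow> real^'d \<Rightarrow> real^'d" where
  "wgrad S u = (SOME g. weak_grad S u g)"

definition H1_0 :: "(real^'d) set \<Rightarrow> (real^'d \<Rightarrow> real) \<Rightarrow> bool" where
  "H1_0 S u \<longleftrightarrow> H1 S u \<and> (\<exists>\<phi>::nat \<Rightarrow> real^'d \<Rightarrow> real. (\<forall>k. test_fun S (\<phi> k)) \<and>
      ((\<lambda>k. integral\<^sup>L (lebesgue_on S) (\<lambda>x. (u x - \<phi> k x)\<^sup>2)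
          + integral\<^sup>L (lebesgue_on S) (\<lambda>x. (norm (wgrad S u x - cgrad (\<phi> k) x))\<^sup>2)) \<longlonglongrightarrow> 0))"

definition coeff_matrix :: "(real^'d) set \<Rightarrow> (real^'d \<Rightarrow> real^'d^'d) \<Rightarrow> real \<Rightarrow> real \<Rightarrow> bool" where
  "coeff_matrix S A \<alpha> \<beta> \<longleftrightarrow> 0 < \<alpha> \<and> \<alpha> \<le> \<beta> \<and>
     (\<forall>i k. (\<lambda>x. A x $ i $ k) \<in> borel_measurable (lebesgue_on S)) \<and>
     (\<forall>x\<in>S. transpose (A x) = A x \<and>
        (\<forall>v. \<alpha> * (norm v)\<^sup>2 \<le> v \<bullet> (A x *v v) \<and> v \<bullet> (A x *v v) \<le> \<beta> * (norm v)\<^sup>2))"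

definition energy_form :: "(real^'d) set \<Rightarrow> (real^'d \<Rightarrow> real^'d^'d) \<Rightarrow> (real^'d \<Rightarrow> real) \<Rightarrow> (real^'d \<Rightarrow> real) \<Rightarrow> real" where
  "energy_form S A u w = integral\<^sup>L (lebesgue_on S) (\<lambda>x. (A x *v wgrad S u x) \<bullet> wgrad S w x)"

definition energy_norm :: "(real^'d) set \<Rightarrow> (real^'d \<Rightarrow> real^'d^'d) \<Rightarrow> (real^'d \<Rightarrow> real) \<Rightarrow> real" where
  "energy_norm S A u = sqrt (energy_form S A u u)"

definition H_A :: "(real^'d) set \<Rightarrow> (real^'d \<Rightarrow> real^'d^'d) \<Rightarrow> (real^'d \<Rightarrow> real) \<Rightarrow> bool" where
  "H_A S A v \<longleftrightarrow> H1 S v \<and> (\<forall>\<phi>. test_fun S \<phi> \<longrightarrow>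
      integral\<^sup>L (lebesgue_on S) (\<lambda>x. (A x *v wgrad S v x) \<bullet> cgrad \<phi> x) = 0)"

definition H_A0 :: "(real^'d) set \<Rightarrow> (real^'d \<Rightarrow> real^'d^'d) \<Rightarrow> (real^'d \<Rightarrow> real) \<Rightarrow> bool" where
  "H_A0 S A v \<longleftrightarrow> H_A S A v \<and> integral\<^sup>L (lebesgue_on S) v = 0"

definition neumann_eig :: "(real^'d) set \<Rightarrow> (real^'d \<Rightarrow> real^'d^'d) \<Rightarrow> real \<Rightarrow> (real^'d \<Rightarrow> real) \<Rightarrow> bool" where
  "neumann_eig S A lam v \<longleftrightarrow> H1 S v \<and>
     (\<forall>w. H1 S w \<longrightarrow> energy_form S A v w = lam * integral\<^sup>L (lebesgue_on S) (\<lambda>x. v x * w x))"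

text \<open>v 0, ..., v (n-1) are the first n non-constant Neumann eigenfunctions
  (L2-orthonormal, positive eigenvalues in nondecreasing order, and every Neumann
  eigenfunction with positive eigenvalue below lam (n-1) lies in their span).\<close>
definition first_neumann_eigs :: "(real^'d) set \<Rightarrow> (real^'d \<Rightarrow> real^'d^'d) \<Rightarrow> nat \<Rightarrow>
    (nat \<Rightarrow> real^'d \<Rightarrow> real) \<Rightarrow> (nat \<Rightarrow> real) \<Rightarrow> bool" where
  "first_neumann_eigs S A n v lam \<longleftrightarrow>
     (\<forall>i<n. 0 < lam i \<and> neumann_eig S A (lam i) (v i)) \<and>
     (\<forall>i<n. \<forall>k<n. integral\<^sup>L (lebesgue_on S) (\<lambda>x. v i x * v k x) = (if i = k then 1 else 0)) \<and>
     (\<forall>i k. i \<le> k \<longrightarrow> k < n \<longrightarrow> lam i \<le> lam k) \<and>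
     (\<forall>\<mu> w. neumann_eig S A \<mu> w \<and> 0 < \<mu> \<and> \<mu> < lam (n - 1) \<longrightarrow>
        (\<exists>c. AE x in lebesgue_on S. w x = (\<Sum>i<n. c i * v i x)))"

definition harmonic_ext :: "(real^'d) set \<Rightarrow> (real^'d \<Rightarrow> real^'d^'d) \<Rightarrow> (real^'d \<Rightarrow> real) \<Rightarrow> (real^'d \<Rightarrow> real) \<Rightarrow> bool" where
  "harmonic_ext S A v h \<longleftrightarrow> H_A S A h \<and> H1_0 S (\<lambda>x. h x - v x)"

definition zero_mean :: "(real^'d) set \<Rightarrow> (real^'d \<Rightarrow> real) \<Rightarrow> real^'d \<Rightarrow> real" where
  "zero_mean S h x = h x - integral\<^sup>L (lebesgue_on S) h / measure lebesgue S"

end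

theory Submission
  imports Defs
begin

text \<open>
On one pair of consecutive cubes let \<open>z\<close> be the energy projection of \<open>u\<close> onto the span of the \<open>w\<^sub>i\<close>. Since
\<open>h\<^sub>i - v\<^sub>i \<in> H\<^sup>1\<^sub>0\<close> is energy-orthogonal to \<open>A\<close>-harmonic functions, \<open>u - z\<close> is energy-orthogonal to
the eigenfunctions \<open>v\<^sub>i\<close>, hence orthogonal to them in mean square, and the spectral gap bounds its mean
square by its energy. The Caccioppoli inequality on the next smaller cube turns this back into an energy
bound; iterating over the \<open>N\<close> cubes gives the product of the rates.

The analytic input is Fourier series on the cube: the products of cosines are complete, and the weak
gradient acts diagonally on cosine coefficients without any boundary condition. This yields compactness,
density of smooth functions in \<open>H\<^sup>1\<close>, and, with \<open>K\<^sup>d \<le> n\<close>, the bound \<open>\<alpha> (\<pi> K / s)\<^sup>2\<close> for the energy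
quotient on the complement of the first \<open>n\<close> eigenfunctions. That is weaker than Weyl's law, but the
constant \<open>2 \<gamma>\<^sub>d\<^sup>1\<^sup>/\<^sup>d / \<surd>\<pi>\<close> in the statement leaves enough room for \<open>C\<^sub>n = 1 / \<lfloor>n\<^sup>1\<^sup>/\<^sup>d\<rfloor>\<close> when \<open>d \<le> 3\<close>,
even with a product cutoff in the Caccioppoli inequality.
\<close>

subsection \<open>Square-integrable functions\<close>

text \<open>The hypothesis on the eigenfunctions speaks only of eigenvalues strictly below
  \<open>lam (n - 1)\<close>, so the bound on the complement needs the next eigenfunction as an
  actual object. It is built as a minimizer of the energy quotient. Against these n + 1 orthonormal
  eigenfunctions stand at most n cosine products with all frequencies below K, so some combination
  of the eigenfunctions is orthogonal to all those cosines.

  Boundary values never enter because integration by parts in direction i produces boundary terms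
  only on the two faces orthogonal to axis i, and a sine in the i-th variable vanishes on both.

  For d = 3 the room in the constant is small. If the cutoff has slope a / w across a layer of width
  w, a product of one-variable cutoffs costs sqrt d, and the stated rate requires a * sqrt d <= sqrt
  pi * gamma_d^(1/d), that is, a at most about 1.65. A one-variable step of slope 3/2, run over
  15/16 of the layer, gives a = 8/5. This explains the numerical constants in the cutoff
  lemmas.\<close>

definition sq_integrable :: "'a measure \<Rightarrow> ('a \<Rightarrow> real) \<Rightarrow> bool" where
  "sq_integrable M f \<longleftrightarrow> f \<in> borel_measurable M \<and> integrable M (\<lambda>x. (f x)\<^sup>2)"

lemma L2_eq: "L2 S u \<longleftrightarrow> sq_integrable (lebesgue_on S) u"
  by (simp add: L2_def sq_integrable_def)

lemma sq_integrable_measurable: "sq_integrable M f \<Longrightarrow> f \<in> borel_measurable M"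
  by (simp add: sq_integrable_def)

lemma sq_integrable_square: "sq_integrable M f \<Longrightarrow> integrable M (\<lambda>x. (f x)\<^sup>2)"
  by (simp add: sq_integrable_def)

lemma sq_integrable_prod:
  assumes "sq_integrable M f" "sq_integrable M g"
  shows "integrable M (\<lambda>x. f x * g x)"
proof (rule Bochner_Integration.integrable_bound)
  show "integrable M (\<lambda>x. (f x)\<^sup>2 + (g x)\<^sup>2)"
    using assms by (simp add: sq_integrable_def)
  show "(\<lambda>x. f x * g x) \<in> borel_measurable M"
    using assms by (intro borel_measurable_times) (auto simp: sq_integrable_def)
  have "\<bar>a * b\<bar> \<le> a\<^sup>2 + b\<^sup>2" for a b :: real
  proof -
    have "0 \<le> (\<bar>a\<bar> - \<bar>b\<bar>)\<^sup>2" by simp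
    moreover have "0 \<le> \<bar>a * b\<bar>" by simp
    moreover have "(\<bar>a\<bar> - \<bar>b\<bar>)\<^sup>2 = a\<^sup>2 + b\<^sup>2 - 2 * \<bar>a * b\<bar>"
      by (simp add: power2_diff abs_mult)
    ultimately show ?thesis by linarith
  qed
  then show "AE x in M. norm (f x * g x) \<le> norm ((f x)\<^sup>2 + (g x)\<^sup>2)"
    by simp
qed

lemma sq_integrable_bounded_mult:
  assumes "sq_integrable M f" "g \<in> borel_measurable M" "\<And>x. x \<in> space M \<Longrightarrow> \<bar>g x\<bar> \<le> B"
  shows "sq_integrable M (\<lambda>x. g x * f x)"
  unfolding sq_integrable_def
proof
  show m: "(\<lambda>x. g x * f x) \<in> borel_measurable M"
    using assms by (intro borel_measurable_times) (auto simp: sq_integrable_def)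
  show "integrable M (\<lambda>x. (g x * f x)\<^sup>2)"
  proof (rule Bochner_Integration.integrable_bound)
    show "integrable M (\<lambda>x. B\<^sup>2 * (f x)\<^sup>2)"
      using assms by (simp add: sq_integrable_def)
    show "(\<lambda>x. (g x * f x)\<^sup>2) \<in> borel_measurable M" using m by simp
    show "AE x in M. norm ((g x * f x)\<^sup>2) \<le> norm (B\<^sup>2 * (f x)\<^sup>2)"
    proof (rule AE_I2)
      fix x assume "x \<in> space M"
      then have "(g x)\<^sup>2 \<le> B\<^sup>2"
        using assms(3)[of x] by (simp add: abs_le_square_iff[symmetric])
      then show "norm ((g x * f x)\<^sup>2) \<le> norm (B\<^sup>2 * (f x)\<^sup>2)"
        by (simp add: power_mult_distrib mult_right_mono)
    qed
  qed
qed

lemma sq_integrable_zero [simp]: "sq_integrable M (\<lambda>x. 0)"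
  by (simp add: sq_integrable_def)

lemma sq_integrable_cmult: "sq_integrable M f \<Longrightarrow> sq_integrable M (\<lambda>x. c * f x)"
  by (auto simp: sq_integrable_def power_mult_distrib intro: borel_measurable_times)

lemma sq_integrable_add:
  assumes "sq_integrable M f" "sq_integrable M g"
  shows "sq_integrable M (\<lambda>x. f x + g x)"
  using assms sq_integrable_prod[OF assms]
  by (auto simp: sq_integrable_def power2_sum mult.assoc intro: borel_measurable_add)

lemma sq_integrable_diff:
  assumes "sq_integrable M f" "sq_integrable M g"
  shows "sq_integrable M (\<lambda>x. f x - g x)"
  using sq_integrable_add[OF assms(1) sq_integrable_cmult[OF assms(2), of "-1"]] by simp

lemma sq_integrable_sum:
  "(\<And>i. i \<in> I \<Longrightarrow> sq_integrable M (f i)) \<Longrightarrow> sq_integrable M (\<lambda>x. \<Sum>i\<in>I. f i x)"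
  by (induction I rule: infinite_finite_induct) (auto intro: sq_integrable_add)

lemma (in finite_measure) sq_integrable_bounded:
  assumes "g \<in> borel_measurable M" "\<And>x. x \<in> space M \<Longrightarrow> \<bar>g x\<bar> \<le> B"
  shows "sq_integrable M g"
  using sq_integrable_bounded_mult[of M "\<lambda>_. 1" g B] assms by (simp add: sq_integrable_def)

lemma (in finite_measure) sq_integrable_integrable: "sq_integrable M f \<Longrightarrow> integrable M f"
  using sq_integrable_prod[of M f "\<lambda>_. 1"] by (simp add: sq_integrable_def)

lemma sq_integral_nonneg: "0 \<le> (\<integral>x. (f x)\<^sup>2 \<partial>M)" for f :: "'a \<Rightarrow> real"
  by (intro Bochner_Integration.integral_nonneg) simp

section \<open>Cauchy-Schwarz and convergence in mean square\<close>

lemma Cauchy_Schwarz_integral: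
  assumes f: "sq_integrable M f" and g: "sq_integrable M g"
  shows "(\<integral>x. f x * g x \<partial>M)\<^sup>2 \<le> (\<integral>x. (f x)\<^sup>2 \<partial>M) * (\<integral>x. (g x)\<^sup>2 \<partial>M)"
proof -
  define a b c where "a = (\<integral>x. (f x)\<^sup>2 \<partial>M)" "b = (\<integral>x. f x * g x \<partial>M)" "c = (\<integral>x. (g x)\<^sup>2 \<partial>M)"
  note abc = this
  have q: "0 \<le> s\<^sup>2 * a + 2 * s * t * b + t\<^sup>2 * c" for s t
  proof -
    have "0 \<le> (\<integral>x. (s * f x + t * g x)\<^sup>2 \<partial>M)" by (rule sq_integral_nonneg)
    also have "\<dots> = (\<integral>x. s\<^sup>2 * (f x)\<^sup>2 + 2 * s * t * (f x * g x) + t\<^sup>2 * (g x)\<^sup>2 \<partial>M)"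
      by (intro Bochner_Integration.integral_cong) (auto simp: power2_eq_square algebra_simps)
    also have "\<dots> = s\<^sup>2 * a + 2 * s * t * b + t\<^sup>2 * c"
      using f g sq_integrable_prod[OF f g] unfolding abc by (simp add: sq_integrable_def)
    finally show ?thesis .
  qed
  have a: "0 \<le> a" and c: "0 \<le> c" unfolding abc by (auto intro: sq_integral_nonneg)
  show ?thesis
  proof (cases "a = 0")
    case True
    have "b = 0"
    proof (rule ccontr)
      assume b: "b \<noteq> 0"
      \<comment> \<open>With \<open>a = 0\<close> and \<open>t = 1\<close> the quadratic form is
        \<open>2 * s * b + c\<close>; this value of \<open>s\<close> makes it -1.\<close>
      show False using q[of "- (c + 1) / (2 * b)" 1] True b by (simp add: field_simps)
    qed
    then show ?thesis using a c True unfolding abc by simp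
  next
    case False
    have "0 \<le> b\<^sup>2 * a - 2 * b * a * b + a\<^sup>2 * c" using q[of "-b" a] by simp
    then have "0 \<le> a * (a * c - b\<^sup>2)" by (simp add: power2_eq_square algebra_simps)
    then have "b\<^sup>2 \<le> a * c" using False a by (simp add: zero_le_mult_iff)
    then show ?thesis unfolding abc .
  qed
qed

lemma sq_integral_triangle:
  assumes f: "sq_integrable M f" and g: "sq_integrable M g" and h: "sq_integrable M h"
  shows "(\<integral>x. (f x - h x)\<^sup>2 \<partial>M) \<le> 2 * (\<integral>x. (f x - g x)\<^sup>2 \<partial>M) + 2 * (\<integral>x. (g x - h x)\<^sup>2 \<partial>M)"
proof -
  have i: "integrable M (\<lambda>x. (f x - g x)\<^sup>2)" "integrable M (\<lambda>x. (g x - h x)\<^sup>2)" "integrable M (\<lambda>x. (f x - h x)\<^sup>2)"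
    using f g h by (auto intro: sq_integrable_square sq_integrable_diff)
  have *: "(a - c)\<^sup>2 \<le> 2 * (a - b)\<^sup>2 + 2 * (b - c)\<^sup>2" for a b c :: real
    using zero_le_power2[of "(a - b) - (b - c)"] by (simp add: power2_eq_square algebra_simps)
  have "(\<integral>x. (f x - h x)\<^sup>2 \<partial>M) \<le> (\<integral>x. 2 * (f x - g x)\<^sup>2 + 2 * (g x - h x)\<^sup>2 \<partial>M)"
    using i * by (intro integral_mono) auto
  then show ?thesis using i by simp
qed

text \<open>Square integrability is part of the notion because the integral of a non-integrable
  square is 0 by convention, so the limit condition alone could hold for trivial reasons.\<close>

definition l2_lim :: "'a measure \<Rightarrow> (nat \<Rightarrow> 'a \<Rightarrow> real) \<Rightarrow> ('a \<Rightarrow> real) \<Rightarrow> bool" where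
  "l2_lim M F f \<longleftrightarrow> (\<forall>n. sq_integrable M (F n)) \<and> sq_integrable M f \<and>
     (\<lambda>n. \<integral>x. (f x - F n x)\<^sup>2 \<partial>M) \<longlonglongrightarrow> 0"

lemma l2_lim_sq_integrable: "l2_lim M F f \<Longrightarrow> sq_integrable M (F n)" "l2_lim M F f \<Longrightarrow> sq_integrable M f"
  by (auto simp: l2_lim_def)

lemma l2_lim_inner_right:
  assumes F: "l2_lim M F f" and g: "sq_integrable M g"
  shows "(\<lambda>n. \<integral>x. g x * F n x \<partial>M) \<longlonglongrightarrow> (\<integral>x. g x * f x \<partial>M)"
proof -
  have s: "sq_integrable M (F n)" "sq_integrable M f" for n using F by (auto simp: l2_lim_def)
  have d: "(\<integral>x. g x * (f x - F n x) \<partial>M) = (\<integral>x. g x * f x \<partial>M) - (\<integral>x. g x * F n x \<partial>M)" for n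
    using sq_integrable_prod[OF g s(1), of n] sq_integrable_prod[OF g s(2)] by (simp add: right_diff_distrib)
  have "(\<lambda>n. (\<integral>x. g x * (f x - F n x) \<partial>M)\<^sup>2) \<longlonglongrightarrow> 0"
  proof (rule tendsto_sandwich[OF _ _ tendsto_const])
    show "\<forall>\<^sub>F n in sequentially. (\<integral>x. g x * (f x - F n x) \<partial>M)\<^sup>2
        \<le> (\<integral>x. (g x)\<^sup>2 \<partial>M) * (\<integral>x. (f x - F n x)\<^sup>2 \<partial>M)"
      using g s by (auto intro!: always_eventually Cauchy_Schwarz_integral sq_integrable_diff)
    show "(\<lambda>n. (\<integral>x. (g x)\<^sup>2 \<partial>M) * (\<integral>x. (f x - F n x)\<^sup>2 \<partial>M)) \<longlonglongrightarrow> 0"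
      using F by (auto simp: l2_lim_def intro: tendsto_mult_right_zero)
  qed auto
  then have "(\<lambda>n. \<integral>x. g x * (f x - F n x) \<partial>M) \<longlonglongrightarrow> 0"
    by (simp add: tendsto_null_power)
  then have "(\<lambda>n. (\<integral>x. g x * f x \<partial>M) - (\<integral>x. g x * F n x \<partial>M)) \<longlonglongrightarrow> 0" using d by simp
  from tendsto_diff[OF tendsto_const[of "\<integral>x. g x * f x \<partial>M"] this] show ?thesis by simp
qed

lemma l2_lim_add:
  assumes "l2_lim M F f" "l2_lim M G g"
  shows "l2_lim M (\<lambda>n x. F n x + G n x) (\<lambda>x. f x + g x)"
  unfolding l2_lim_def
proof (intro conjI allI)
  have s: "sq_integrable M (F n)" "sq_integrable M f" "sq_integrable M (G n)" "sq_integrable M g" for n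
    using assms by (auto simp: l2_lim_def)
  show "sq_integrable M (\<lambda>x. F n x + G n x)" "sq_integrable M (\<lambda>x. f x + g x)" for n
    using s by (auto intro: sq_integrable_add)
  show "(\<lambda>n. \<integral>x. (f x + g x - (F n x + G n x))\<^sup>2 \<partial>M) \<longlonglongrightarrow> 0"
  proof (rule tendsto_sandwich[OF _ _ tendsto_const])
    show "\<forall>\<^sub>F n in sequentially. (\<integral>x. (f x + g x - (F n x + G n x))\<^sup>2 \<partial>M)
        \<le> 2 * (\<integral>x. (f x - F n x)\<^sup>2 \<partial>M) + 2 * (\<integral>x. (g x - G n x)\<^sup>2 \<partial>M)"
    proof (intro always_eventually allI)
      fix n
      show "(\<integral>x. (f x + g x - (F n x + G n x))\<^sup>2 \<partial>M)
        \<le> 2 * (\<integral>x. (f x - F n x)\<^sup>2 \<partial>M) + 2 * (\<integral>x. (g x - G n x)\<^sup>2 \<partial>M)"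
        using sq_integral_triangle[of M "\<lambda>x. f x + g x" "\<lambda>x. F n x + g x" "\<lambda>x. F n x + G n x"]
          sq_integrable_add[OF s(2,4)] sq_integrable_add[OF s(1,4)] sq_integrable_add[OF s(1,3)]
        by (simp add: algebra_simps)
    qed
    show "(\<lambda>n. 2 * (\<integral>x. (f x - F n x)\<^sup>2 \<partial>M) + 2 * (\<integral>x. (g x - G n x)\<^sup>2 \<partial>M)) \<longlonglongrightarrow> 0"
      using assms by (auto simp: l2_lim_def intro!: tendsto_add_zero tendsto_mult_right_zero)
  qed (auto intro: sq_integral_nonneg)
qed

lemma l2_lim_bounded_mult:
  assumes F: "l2_lim M F f" and g: "g \<in> borel_measurable M" and B: "\<And>x. x \<in> space M \<Longrightarrow> \<bar>g x\<bar> \<le> B"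
  shows "l2_lim M (\<lambda>n x. g x * F n x) (\<lambda>x. g x * f x)"
  unfolding l2_lim_def
proof (intro conjI allI)
  have s: "sq_integrable M (F n)" "sq_integrable M f" for n
    using assms by (auto simp: l2_lim_def)
  show s': "sq_integrable M (\<lambda>x. g x * F n x)" "sq_integrable M (\<lambda>x. g x * f x)" for n
    using s g B by (auto intro: sq_integrable_bounded_mult)
  show "(\<lambda>n. \<integral>x. (g x * f x - g x * F n x)\<^sup>2 \<partial>M) \<longlonglongrightarrow> 0"
  proof (rule tendsto_sandwich[OF _ _ tendsto_const])
    show "\<forall>\<^sub>F n in sequentially. (\<integral>x. (g x * f x - g x * F n x)\<^sup>2 \<partial>M) \<le> B\<^sup>2 * (\<integral>x. (f x - F n x)\<^sup>2 \<partial>M)"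
    proof (intro always_eventually allI)
      fix n
      have "(\<integral>x. (g x * f x - g x * F n x)\<^sup>2 \<partial>M) \<le> (\<integral>x. B\<^sup>2 * (f x - F n x)\<^sup>2 \<partial>M)"
      proof (rule integral_mono)
        show "integrable M (\<lambda>x. (g x * f x - g x * F n x)\<^sup>2)"
          using s' by (intro sq_integrable_square sq_integrable_diff)
        show "integrable M (\<lambda>x. B\<^sup>2 * (f x - F n x)\<^sup>2)"
          using s by (intro integrable_mult_right sq_integrable_square sq_integrable_diff)
        fix x assume "x \<in> space M"
        then have "(g x)\<^sup>2 \<le> B\<^sup>2"
          using B[of x] by (simp add: abs_le_square_iff[symmetric])
        then show "(g x * f x - g x * F n x)\<^sup>2 \<le> B\<^sup>2 * (f x - F n x)\<^sup>2"
          by (simp add: right_diff_distrib[symmetric] power_mult_distrib mult_right_mono)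
      qed
      then show "(\<integral>x. (g x * f x - g x * F n x)\<^sup>2 \<partial>M) \<le> B\<^sup>2 * (\<integral>x. (f x - F n x)\<^sup>2 \<partial>M)" by simp
    qed
    show "(\<lambda>n. B\<^sup>2 * (\<integral>x. (f x - F n x)\<^sup>2 \<partial>M)) \<longlonglongrightarrow> 0"
      using F by (auto simp: l2_lim_def intro!: tendsto_mult_right_zero)
  qed (auto intro: sq_integral_nonneg)
qed

lemma l2_lim_square:
  assumes F: "l2_lim M F f"
  shows "(\<lambda>n. \<integral>x. (F n x)\<^sup>2 \<partial>M) \<longlonglongrightarrow> (\<integral>x. (f x)\<^sup>2 \<partial>M)"
proof -
  have s: "sq_integrable M (F n)" "sq_integrable M f" for n
    using assms by (auto simp: l2_lim_def)
  have "(\<integral>x. (F n x)\<^sup>2 \<partial>M) = (\<integral>x. (f x - F n x)\<^sup>2 \<partial>M) + 2 * (\<integral>x. f x * F n x \<partial>M) - (\<integral>x. (f x)\<^sup>2 \<partial>M)" for n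
  proof -
    have "(\<integral>x. (F n x)\<^sup>2 \<partial>M) = (\<integral>x. (f x - F n x)\<^sup>2 + 2 * (f x * F n x) - (f x)\<^sup>2 \<partial>M)"
      by (intro Bochner_Integration.integral_cong) (auto simp: power2_eq_square algebra_simps)
    then show ?thesis
      using sq_integrable_square[OF sq_integrable_diff[OF s(2) s(1)], of n]
        sq_integrable_square[OF s(2)] sq_integrable_prod[OF s(2) s(1), of n] by simp
  qed
  moreover have "(\<lambda>n. (\<integral>x. (f x - F n x)\<^sup>2 \<partial>M) + 2 * (\<integral>x. f x * F n x \<partial>M) - (\<integral>x. (f x)\<^sup>2 \<partial>M))
      \<longlonglongrightarrow> 0 + 2 * (\<integral>x. f x * f x \<partial>M) - (\<integral>x. (f x)\<^sup>2 \<partial>M)"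
    using F by (intro tendsto_intros l2_lim_inner_right s) (auto simp: l2_lim_def)
  ultimately show ?thesis by (simp add: power2_eq_square)
qed

text \<open>A subsequence with \<open>\<parallel>f\<^sub>k\<^sub>+\<^sub>1 - f\<^sub>k\<parallel> \<le> 2\<^sup>-\<^sup>k\<close> converges almost everywhere, and Fatou's lemma
  identifies its pointwise limit as the limit in mean square.\<close>

lemma (in finite_measure) Riesz_Fischer:
  fixes F :: "nat \<Rightarrow> 'a \<Rightarrow> real"
  assumes F: "\<And>n. sq_integrable M (F n)"
    and Cau: "\<And>e. e > 0 \<Longrightarrow> \<exists>N. \<forall>m\<ge>N. \<forall>n\<ge>N. (\<integral>x. (F m x - F n x)\<^sup>2 \<partial>M) < e"
  obtains f where "l2_lim M F f"
proof -
  have [measurable]: "F n \<in> borel_measurable M" for n using F by (simp add: sq_integrable_def)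
  have "\<forall>k. \<exists>N. \<forall>m\<ge>N. \<forall>n\<ge>N. (\<integral>x. (F m x - F n x)\<^sup>2 \<partial>M) < (1/4)^k"
    using Cau by simp
  then obtain N where N: "\<And>k m n. m \<ge> N k \<Longrightarrow> n \<ge> N k \<Longrightarrow> (\<integral>x. (F m x - F n x)\<^sup>2 \<partial>M) < (1/4)^k"
    by metis
  \<comment> \<open>The sum of the thresholds dominates each of them, so \<open>r k\<close> and
    \<open>r (Suc k)\<close> both lie beyond \<open>N k\<close>. The extra \<open>k\<close> makes
    \<open>r\<close> tend to infinity, as the Fatou step requires.\<close>
  define r where "r k = (\<Sum>i\<le>k. N i) + k" for k
  have rN: "N k \<le> r k" "N k \<le> r (Suc k)" for k
    unfolding r_def using member_le_sum[of k "{..k}" N] by (auto intro: trans_le_add1)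
  have rk: "k \<le> r k" for k by (simp add: r_def)
  define D where "D k x = \<bar>F (r (Suc k)) x - F (r k) x\<bar>" for k x
  have [measurable]: "D k \<in> borel_measurable M" for k unfolding D_def by measurable
  have Dsq: "sq_integrable M (D k)" for k
    using sq_integrable_diff[OF F F, of "r (Suc k)" "r k"] by (simp add: D_def sq_integrable_def)
  \<comment> \<open>Cauchy-Schwarz against the constant 1 turns the mean-square bound
    \<open>(1/4)^k\<close> into a summable bound on the integral of \<open>D k\<close>; this is
    where finiteness of the measure enters.\<close>
  have Dint: "(\<integral>x. D k x \<partial>M) \<le> sqrt (measure M (space M)) * (1/2)^k" for k
  proof -
    have "(\<integral>x. D k x * 1 \<partial>M)\<^sup>2 \<le> (\<integral>x. (D k x)\<^sup>2 \<partial>M) * (\<integral>x. 1\<^sup>2 \<partial>M)"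
      by (intro Cauchy_Schwarz_integral Dsq) (simp add: sq_integrable_def)
    also have "\<dots> \<le> (1/4)^k * measure M (space M)"
      using N[OF rN(2) rN(1), of k] by (intro mult_mono) (auto simp: D_def)
    finally have "(\<integral>x. D k x \<partial>M)\<^sup>2 \<le> (sqrt (measure M (space M)) * (1/2)^k)\<^sup>2"
      by (simp add: power_mult_distrib power2_eq_square[of "(1/2::real)^k"] power_mult_distrib[symmetric] mult.commute)
    then show ?thesis by (rule power2_le_imp_le) simp
  qed
  have "(\<integral>\<^sup>+x. (\<Sum>k. ennreal (D k x)) \<partial>M) = (\<Sum>k. \<integral>\<^sup>+x. ennreal (D k x) \<partial>M)"
    by (rule nn_integral_suminf) measurable
  also have "\<dots> = (\<Sum>k. ennreal (\<integral>x. D k x \<partial>M))"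
    by (intro suminf_cong nn_integral_eq_integral sq_integrable_integrable Dsq) (simp add: D_def)
  also have "\<dots> \<le> (\<Sum>k. ennreal (sqrt (measure M (space M)) * (1/2)^k))"
    using Dint by (intro suminf_le) (auto intro: ennreal_leI)
  also have "\<dots> < \<infinity>"
    by (subst suminf_ennreal2) (auto intro!: summable_mult summable_geometric)
  finally have "AE x in M. (\<Sum>k. ennreal (D k x)) \<noteq> \<infinity>"
    by (intro nn_integral_PInf_AE) auto
  then have conv: "AE x in M. convergent (\<lambda>k. F (r k) x)"
  proof eventually_elim
    fix x assume "(\<Sum>k. ennreal (D k x)) \<noteq> \<infinity>"
    then have "summable (\<lambda>k. D k x)"
      by (intro summable_suminf_not_top) (auto simp: D_def)
    then have "summable (\<lambda>k. F (r (Suc k)) x - F (r k) x)"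
      unfolding D_def by (rule summable_rabs_cancel)
    then show "convergent (\<lambda>k. F (r k) x)"
      by (simp add: summable_iff_convergent sum_lessThan_telescope[of "\<lambda>k. F (r k) x"] convergent_diff_const_right_iff)
  qed
  define f where "f x = lim (\<lambda>k. F (r k) x)" for x
  have fm [measurable]: "f \<in> borel_measurable M" unfolding f_def by measurable
  have lim: "AE x in M. (\<lambda>k. F (r k) x) \<longlonglongrightarrow> f x"
    using conv by eventually_elim (simp add: f_def convergent_LIMSEQ_iff)
  have bound: "(\<integral>\<^sup>+x. ennreal ((f x - F n x)\<^sup>2) \<partial>M) \<le> ennreal ((1/4)^k)" if "n \<ge> N k" for n k
  proof -
    have "(\<integral>\<^sup>+x. ennreal ((f x - F n x)\<^sup>2) \<partial>M) = (\<integral>\<^sup>+x. liminf (\<lambda>j. ennreal ((F (r j) x - F n x)\<^sup>2)) \<partial>M)"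
    proof (rule nn_integral_cong_AE)
      show "AE x in M. ennreal ((f x - F n x)\<^sup>2) = liminf (\<lambda>j. ennreal ((F (r j) x - F n x)\<^sup>2))"
        using lim
      proof eventually_elim
        fix x assume "(\<lambda>k. F (r k) x) \<longlonglongrightarrow> f x"
        then have "(\<lambda>j. ennreal ((F (r j) x - F n x)\<^sup>2)) \<longlonglongrightarrow> ennreal ((f x - F n x)\<^sup>2)"
          by (intro tendsto_intros)
        then show "ennreal ((f x - F n x)\<^sup>2) = liminf (\<lambda>j. ennreal ((F (r j) x - F n x)\<^sup>2))"
          by (rule lim_imp_Liminf[OF trivial_limit_sequentially, symmetric])
      qed
    qed
    also have "\<dots> \<le> liminf (\<lambda>j. \<integral>\<^sup>+x. ennreal ((F (r j) x - F n x)\<^sup>2) \<partial>M)"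
      by (rule nn_integral_liminf) measurable
    also have "\<dots> \<le> liminf (\<lambda>j. ennreal ((1/4)^k))"
    proof (rule Liminf_mono, rule eventually_sequentiallyI[of "N k"])
      fix j assume "N k \<le> j"
      then have "(\<integral>x. (F (r j) x - F n x)\<^sup>2 \<partial>M) \<le> (1/4)^k"
        using N[of k "r j" n] that rk[of j] by simp
      then show "(\<integral>\<^sup>+x. ennreal ((F (r j) x - F n x)\<^sup>2) \<partial>M) \<le> ennreal ((1/4)^k)"
        using sq_integrable_square[OF sq_integrable_diff[OF F F, of "r j" n]]
        by (subst nn_integral_eq_integral) (auto intro: ennreal_leI)
    qed
    finally show ?thesis by (simp add: Liminf_const)
  qed
  have sqd: "sq_integrable M (\<lambda>x. f x - F n x)" if "n \<ge> N 0" for n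
    unfolding sq_integrable_def
  proof
    show "integrable M (\<lambda>x. (f x - F n x)\<^sup>2)"
      using bound[OF that] by (intro integrableI_bounded) (auto simp: less_top[symmetric] top_unique)
  qed measurable
  have fs: "sq_integrable M f"
    using sq_integrable_add[OF sqd[of "N 0"] F[of "N 0"]] by simp
  have small: "(\<integral>x. (f x - F n x)\<^sup>2 \<partial>M) \<le> (1/4)^k" if "n \<ge> N k" for n k
    using bound[OF that] sq_integrable_square[OF sq_integrable_diff[OF fs F, of n]]
    by (subst (asm) nn_integral_eq_integral) auto
  have "(\<lambda>n. \<integral>x. (f x - F n x)\<^sup>2 \<partial>M) \<longlonglongrightarrow> 0"
  proof (rule LIMSEQ_I)
    fix e :: real assume "0 < e"
    then obtain k where k: "(1/4)^k < e" using real_arch_pow_inv[of e "1/4"] by auto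
    show "\<exists>no. \<forall>n\<ge>no. norm ((\<integral>x. (f x - F n x)\<^sup>2 \<partial>M) - 0) < e"
      using small k sq_integral_nonneg by (intro exI[of _ "N k"]) (auto simp: abs_of_nonneg intro: le_less_trans)
  qed
  then show ?thesis using that F fs by (simp add: l2_lim_def)
qed

text \<open>Null vectors are allowed in the system, since a sine product with a zero frequency
  vanishes identically. For such a vector the coefficient and the norm are both 0, and the
  convention x / 0 = 0 deletes its term.\<close>

lemma Bessel_identity:
  assumes f: "sq_integrable M f" and e: "\<And>k. sq_integrable M (e k)"
    and orth: "\<And>k l. k \<noteq> l \<Longrightarrow> (\<integral>x. e k x * e l x \<partial>M) = 0" and B: "finite B"
  defines "c \<equiv> \<lambda>k. (\<integral>x. f x * e k x \<partial>M)" and "N \<equiv> \<lambda>k. (\<integral>x. (e k x)\<^sup>2 \<partial>M)"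
  shows "(\<integral>x. (f x - (\<Sum>k\<in>B. c k / N k * e k x))\<^sup>2 \<partial>M) = (\<integral>x. (f x)\<^sup>2 \<partial>M) - (\<Sum>k\<in>B. (c k)\<^sup>2 / N k)"
    and "l \<in> B \<Longrightarrow> (\<integral>x. (f x - (\<Sum>k\<in>B. c k / N k * e k x)) * e l x \<partial>M) = 0"
    and "N l = 0 \<Longrightarrow> c l = 0"
proof -
  have zero: "c k = 0" if "N k = 0" for k
    using Cauchy_Schwarz_integral[OF f e, of k] that unfolding c_def N_def by simp
  then show "N l = 0 \<Longrightarrow> c l = 0" .
  have i1: "integrable M (\<lambda>x. f x * e k x)" for k by (rule sq_integrable_prod[OF f e])
  have i2: "integrable M (\<lambda>x. e k x * e l x)" for k l by (rule sq_integrable_prod[OF e e])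
  let ?P = "\<lambda>x. \<Sum>k\<in>B. c k / N k * e k x"
  have sP: "sq_integrable M ?P" by (intro sq_integrable_sum sq_integrable_cmult e)
  have Pl: "(\<integral>x. ?P x * e l x \<partial>M) = c l" if "l \<in> B" for l
  proof -
    have "(\<integral>x. ?P x * e l x \<partial>M) = (\<integral>x. (\<Sum>k\<in>B. c k / N k * (e k x * e l x)) \<partial>M)"
      by (simp add: sum_distrib_right mult.assoc)
    also have "\<dots> = (\<Sum>k\<in>B. c k / N k * (\<integral>x. e k x * e l x \<partial>M))"
      using i2 by (subst Bochner_Integration.integral_sum) auto
    also have "\<dots> = (\<Sum>k\<in>B. if k = l then c l else 0)"
      using orth zero by (intro sum.cong) (auto simp: N_def power2_eq_square)
    finally show ?thesis using that B by simp
  qed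
  show orth': "(\<integral>x. (f x - ?P x) * e l x \<partial>M) = 0" if "l \<in> B" for l
    using Pl[OF that] i1[of l] sq_integrable_prod[OF sP e, of l]
    by (simp add: left_diff_distrib c_def)
  have sfP: "sq_integrable M (\<lambda>x. f x - ?P x)" by (intro sq_integrable_diff f sP)
  have "(\<integral>x. (f x - ?P x) * ?P x \<partial>M) = (\<integral>x. (\<Sum>k\<in>B. c k / N k * ((f x - ?P x) * e k x)) \<partial>M)"
    by (intro Bochner_Integration.integral_cong refl, simp only: sum_distrib_left)
      (auto intro!: sum.cong simp: mult_ac)
  also have "\<dots> = (\<Sum>k\<in>B. c k / N k * (\<integral>x. (f x - ?P x) * e k x \<partial>M))"
    using sq_integrable_prod[OF sfP e] by (subst Bochner_Integration.integral_sum) auto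
  also have "\<dots> = 0" using orth' by simp
  finally have z: "(\<integral>x. (f x - ?P x) * ?P x \<partial>M) = 0" .
  have "(\<integral>x. (f x - ?P x)\<^sup>2 \<partial>M) = (\<integral>x. (f x)\<^sup>2 - f x * ?P x - (f x - ?P x) * ?P x \<partial>M)"
    by (intro Bochner_Integration.integral_cong refl) (simp add: power2_eq_square algebra_simps)
  also have "\<dots> = (\<integral>x. (f x)\<^sup>2 \<partial>M) - (\<integral>x. f x * ?P x \<partial>M)"
    using z sq_integrable_square[OF f] sq_integrable_prod[OF f sP] sq_integrable_prod[OF sfP sP] by simp
  also have "(\<integral>x. f x * ?P x \<partial>M) = (\<integral>x. (\<Sum>k\<in>B. c k / N k * (f x * e k x)) \<partial>M)"
    by (intro Bochner_Integration.integral_cong refl) (simp add: sum_distrib_left algebra_simps)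
  also have "\<dots> = (\<Sum>k\<in>B. (c k)\<^sup>2 / N k)"
    using i1 by (subst Bochner_Integration.integral_sum) (auto simp: c_def power2_eq_square)
  finally show "(\<integral>x. (f x - ?P x)\<^sup>2 \<partial>M) = (\<integral>x. (f x)\<^sup>2 \<partial>M) - (\<Sum>k\<in>B. (c k)\<^sup>2 / N k)" .
qed

text \<open>Bessel's bound makes the partial sums Cauchy in mean square. The difference between
  \<open>f\<close> and their limit is orthogonal to the whole system, so a trivial annihilator
  forces it to vanish almost everywhere.\<close>

lemma (in finite_measure) complete_orthogonal_expansion:
  assumes f: "sq_integrable M f" and e: "\<And>k. sq_integrable M (e k)"
    and orth: "\<And>k l. k \<noteq> l \<Longrightarrow> (\<integral>x. e k x * e l x \<partial>M) = 0"
    and compl: "\<And>g. sq_integrable M g \<Longrightarrow> (\<And>k. (\<integral>x. g x * e k x \<partial>M) = 0) \<Longrightarrow> AE x in M. g x = 0"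
    and B: "\<And>n. finite (B n)" "incseq B" "(\<Union>n. B n) = UNIV"
  shows "l2_lim M (\<lambda>n x. \<Sum>k\<in>B n. (\<integral>x. f x * e k x \<partial>M) / (\<integral>x. (e k x)\<^sup>2 \<partial>M) * e k x) f"
proof -
  define c where "c = (\<lambda>k. (\<integral>x. f x * e k x \<partial>M))"
  define N where "N = (\<lambda>k. (\<integral>x. (e k x)\<^sup>2 \<partial>M))"
  define P where "P = (\<lambda>n x. \<Sum>k\<in>B n. c k / N k * e k x)"
  have Nn: "0 \<le> N k" for k unfolding N_def by (rule sq_integral_nonneg)
  have sP: "sq_integrable M (P n)" for n
    unfolding P_def by (intro sq_integrable_sum sq_integrable_cmult e)
  have bes1: "(\<integral>x. (h x - (\<Sum>k\<in>B n. (\<integral>x. h x * e k x \<partial>M) / N k * e k x))\<^sup>2 \<partial>M)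
      = (\<integral>x. (h x)\<^sup>2 \<partial>M) - (\<Sum>k\<in>B n. (\<integral>x. h x * e k x \<partial>M)\<^sup>2 / N k)" if "sq_integrable M h" for h n
    unfolding N_def by (rule Bessel_identity(1)[OF that e _ B(1)]) (rule orth)
  have bes2: "(\<integral>x. (f x - P n x) * e l x \<partial>M) = 0" if "l \<in> B n" for n l
    unfolding P_def c_def N_def by (rule Bessel_identity(2)[OF f e _ B(1) that]) (rule orth)
  define S where "S n = (\<Sum>k\<in>B n. (c k)\<^sup>2 / N k)" for n
  have SfP: "(\<integral>x. (f x - P n x)\<^sup>2 \<partial>M) = (\<integral>x. (f x)\<^sup>2 \<partial>M) - S n" for n
    using bes1[OF f, of n] unfolding P_def S_def c_def by simp
  have "S n \<le> (\<integral>x. (f x)\<^sup>2 \<partial>M)" for n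
    using SfP[of n] sq_integral_nonneg[of M "\<lambda>x. f x - P n x"] by simp
  moreover have "incseq S"
    unfolding S_def using B Nn by (intro monoI sum_mono2) (auto simp: incseq_def)
  ultimately have "convergent S"
    by (intro Bseq_monoseq_convergent monoI1 BseqI'[of _ "\<integral>x. (f x)\<^sup>2 \<partial>M"])
      (auto simp: incseq_def S_def Nn sum_nonneg abs_of_nonneg)
  then have Cau: "Cauchy S" by (simp add: Cauchy_convergent_iff)
  have diff: "(\<integral>x. (P m x - P n x)\<^sup>2 \<partial>M) = S m - S n" if "n \<le> m" for m n
  proof -
    have sub: "B n \<subseteq> B m" using B(2) that by (auto simp: incseq_def)
    have pc: "(\<integral>x. P m x * e k x \<partial>M) = c k" if "k \<in> B m" for k
      using bes2[OF that] sq_integrable_prod[OF f e, of k] sq_integrable_prod[OF sP e, of m k]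
      by (simp add: left_diff_distrib c_def)
    \<comment> \<open>For \<open>n \<le> m\<close> the shorter sum is the Bessel sum of the longer
      one, so the Bessel identity applied to \<open>P m\<close> computes their distance.\<close>
    have n: "P n = (\<lambda>x. \<Sum>k\<in>B n. (\<integral>x. P m x * e k x \<partial>M) / N k * e k x)"
      unfolding P_def[of] using pc sub by (fastforce simp: P_def intro!: sum.cong)
    have "(\<integral>x. (P m x - P n x)\<^sup>2 \<partial>M) = (\<integral>x. (P m x)\<^sup>2 \<partial>M) - (\<Sum>k\<in>B n. (\<integral>x. P m x * e k x \<partial>M)\<^sup>2 / N k)"
      using bes1[OF sP, of m n] n by metis
    also have "(\<Sum>k\<in>B n. (\<integral>x. P m x * e k x \<partial>M)\<^sup>2 / N k) = S n"
      unfolding S_def using pc sub by (intro sum.cong) auto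
    also have "(\<integral>x. (P m x)\<^sup>2 \<partial>M) = (\<integral>x. (\<Sum>k\<in>B m. c k / N k * (P m x * e k x)) \<partial>M)"
      by (intro Bochner_Integration.integral_cong refl)
        (simp add: P_def power2_eq_square sum_distrib_left algebra_simps)
    also have "\<dots> = S m"
      using sq_integrable_prod[OF sP e] pc unfolding S_def
      by (subst Bochner_Integration.integral_sum) (auto simp: power2_eq_square intro!: sum.cong)
    finally show ?thesis .
  qed
  have "\<exists>N. \<forall>m\<ge>N. \<forall>n\<ge>N. (\<integral>x. (P m x - P n x)\<^sup>2 \<partial>M) < e" if "e > 0" for e
  proof -
    obtain K where K: "\<And>m n. m \<ge> K \<Longrightarrow> n \<ge> K \<Longrightarrow> norm (S m - S n) < e"
      using CauchyD[OF Cau \<open>e > 0\<close>] by blast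
    have "(\<integral>x. (P m x - P n x)\<^sup>2 \<partial>M) < e" if "m \<ge> K" "n \<ge> K" for m n
    proof (cases "n \<le> m")
      case True
      then show ?thesis using diff[OF True] K[OF that] by auto
    next
      case False
      then have "(\<integral>x. (P m x - P n x)\<^sup>2 \<partial>M) = S n - S m"
        using diff[of m n] by (simp add: power2_commute)
      then show ?thesis using K[OF that] by auto
    qed
    then show ?thesis by blast
  qed
  from Riesz_Fischer[OF sP this] obtain g where g: "l2_lim M P g" by metis
  have sg: "sq_integrable M g" using g by (simp add: l2_lim_def)
  have "AE x in M. f x - g x = 0"
  proof (rule compl)
    show "sq_integrable M (\<lambda>x. f x - g x)" using f sg by (rule sq_integrable_diff)
    fix k
    from B(3) obtain n0 where n0: "k \<in> B n0" by blast
    have "(\<lambda>n. \<integral>x. e k x * P n x \<partial>M) \<longlonglongrightarrow> (\<integral>x. e k x * g x \<partial>M)"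
      by (rule l2_lim_inner_right[OF g e])
    moreover have "(\<lambda>n. \<integral>x. e k x * P n x \<partial>M) \<longlonglongrightarrow> c k"
    proof (rule tendsto_eventually, rule eventually_sequentiallyI[of n0])
      fix n assume "n0 \<le> n"
      then have "k \<in> B n" using n0 B(2) by (auto simp: incseq_def)
      then show "(\<integral>x. e k x * P n x \<partial>M) = c k"
        using bes2[of k n] sq_integrable_prod[OF f e, of k] sq_integrable_prod[OF sP e, of n k]
        by (simp add: left_diff_distrib mult.commute[of "e k _"] c_def)
    qed
    ultimately have "c k = (\<integral>x. e k x * g x \<partial>M)" using LIMSEQ_unique by blast
    then show "(\<integral>x. (f x - g x) * e k x \<partial>M) = 0"
      using sq_integrable_prod[OF f e, of k] sq_integrable_prod[OF sg e, of k]
      by (simp add: left_diff_distrib c_def mult.commute[of "e k _"])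
  qed
  then have "(\<integral>x. (f x - P n x)\<^sup>2 \<partial>M) = (\<integral>x. (g x - P n x)\<^sup>2 \<partial>M)" for n
    using f sg sP[of n]
    by (intro integral_cong_AE) (auto simp: sq_integrable_def intro!: borel_measurable_power borel_measurable_diff)
  then have "l2_lim M P f" using g f sP by (simp add: l2_lim_def)
  then show ?thesis unfolding P_def c_def N_def .
qed

subsection \<open>Smooth functions and cutoffs\<close>

text \<open>A witness sequence of successive derivatives stands in for iterated
  \<open>deriv\<close>, so nothing has to be computed by recursion on the order.\<close>

definition smooth1 :: "(real \<Rightarrow> real) \<Rightarrow> bool" where
  "smooth1 g \<longleftrightarrow> (\<exists>D. D 0 = g \<and> (\<forall>n t. (D n has_real_derivative D (Suc n) t) (at t)))"

text \<open>Iterating a choice of derivative never leaves a class that is closed under one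
  differentiation. Smoothness thus reduces to a first-order check, with no formula for higher
  derivatives.\<close>

lemma smooth1_coinduct:
  assumes "f \<in> C" and C: "\<And>f. f \<in> C \<Longrightarrow> \<exists>f'\<in>C. \<forall>t. (f has_real_derivative f' t) (at t)"
  shows "smooth1 f"
proof -
  obtain d where d: "\<And>f. f \<in> C \<Longrightarrow> d f \<in> C" "\<And>f t. f \<in> C \<Longrightarrow> (f has_real_derivative d f t) (at t)"
    using C by metis
  have "(d ^^ n) f \<in> C" for n by (induction n) (auto simp: d assms(1))
  then show ?thesis unfolding smooth1_def
    by (intro exI[of _ "\<lambda>n. (d ^^ n) f"]) (auto intro: d(2))
qed

lemma smooth1_deriv:
  assumes "smooth1 g"
  obtains g' where "smooth1 g'" "\<And>t. (g has_real_derivative g' t) (at t)"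
proof -
  from assms obtain D where D: "D 0 = g" "\<And>n t. (D n has_real_derivative D (Suc n) t) (at t)"
    unfolding smooth1_def by blast
  then have "smooth1 (D (Suc 0))" unfolding smooth1_def by (intro exI[of _ "\<lambda>n. D (Suc n)"]) simp
  with D that show ?thesis by metis
qed

lemma smooth1_antideriv:
  assumes "\<And>t. (G has_real_derivative g t) (at t)" "smooth1 g"
  shows "smooth1 G"
proof (rule smooth1_coinduct[where C="insert G {f. smooth1 f}"])
  show "\<exists>f'\<in>insert G {f. smooth1 f}. \<forall>t. (f has_real_derivative f' t) (at t)" if f: "f \<in> insert G {f. smooth1 f}" for f
  proof (cases "f = G")
    case False
    then have "smooth1 f" using f by simp
    from smooth1_deriv[OF this] obtain f' where "smooth1 f'" "\<And>t. (f has_real_derivative f' t) (at t)" by blast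
    then show ?thesis by (intro bexI[of _ f']) auto
  qed (use assms in \<open>intro bexI[of _ g]; auto\<close>)
qed simp

lemma smooth1_continuous: "smooth1 g \<Longrightarrow> continuous_on UNIV g"
  by (erule smooth1_deriv) (auto intro!: continuous_at_imp_continuous_on intro: DERIV_isCont)

lemma smooth1_affine:
  assumes "smooth1 g" shows "smooth1 (\<lambda>t. c * g (p + q * t))"
proof (rule smooth1_coinduct[where C="{\<lambda>t. c * g (p + q * t) | c g. smooth1 g}"])
  fix f assume "f \<in> {\<lambda>t. c * g (p + q * t) | c g. smooth1 g}"
  then obtain c g where f: "f = (\<lambda>t. c * g (p + q * t))" and g: "smooth1 g" by blast
  obtain g' where g': "smooth1 g'" "\<And>t. (g has_real_derivative g' t) (at t)" using smooth1_deriv[OF g] by blast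
  have "(f has_real_derivative (c * q) * g' (p + q * t)) (at t)" for t
  proof -
    have "((\<lambda>t. g (p + q * t)) has_real_derivative g' (p + q * t) * q) (at t)"
      by (rule DERIV_chain2[OF g'(2)]) (auto intro!: derivative_eq_intros)
    from DERIV_cmult[OF this, of c] show ?thesis unfolding f by (simp add: mult_ac)
  qed
  then show "\<exists>f'\<in>{\<lambda>t. c * g (p + q * t) | c g. smooth1 g}. \<forall>t. (f has_real_derivative f' t) (at t)"
    using g'(1) by (intro bexI[of _ "\<lambda>t. (c * q) * g' (p + q * t)"]) auto
qed (use assms in auto)

text \<open>A class closed under differentiation: one derivative of a product is again a sum of
  products, so coinduction replaces the Leibniz formula.\<close>

inductive_set smooth1_algebra :: "(real \<Rightarrow> real) set" where
  "smooth1 f \<Longrightarrow> f \<in> smooth1_algebra"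
| "f \<in> smooth1_algebra \<Longrightarrow> g \<in> smooth1_algebra \<Longrightarrow> (\<lambda>t. f t + g t) \<in> smooth1_algebra"
| "f \<in> smooth1_algebra \<Longrightarrow> g \<in> smooth1_algebra \<Longrightarrow> (\<lambda>t. f t * g t) \<in> smooth1_algebra"

lemma smooth1_algebraD: "f \<in> smooth1_algebra \<Longrightarrow> smooth1 f"
proof (rule smooth1_coinduct)
  show "\<exists>f'\<in>smooth1_algebra. \<forall>t. (f has_real_derivative f' t) (at t)" if "f \<in> smooth1_algebra" for f
    using that
  proof (induction rule: smooth1_algebra.induct)
    case (1 f)
    then show ?case using smooth1_deriv smooth1_algebra.intros(1) by metis
  next
    case (2 f g)
    then obtain f' g' where "f' \<in> smooth1_algebra" "\<And>t. (f has_real_derivative f' t) (at t)"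
      "g' \<in> smooth1_algebra" "\<And>t. (g has_real_derivative g' t) (at t)" by blast
    then show ?case
      by (intro bexI[of _ "\<lambda>t. f' t + g' t"]) (auto intro: smooth1_algebra.intros DERIV_add)
  next
    case (3 f g)
    then obtain f' g' where "f' \<in> smooth1_algebra" "\<And>t. (f has_real_derivative f' t) (at t)"
      "g' \<in> smooth1_algebra" "\<And>t. (g has_real_derivative g' t) (at t)" by blast
    then show ?case using 3(1,2)
      by (intro bexI[of _ "\<lambda>t. f' t * g t + g' t * f t"]) (auto intro: smooth1_algebra.intros DERIV_mult)
  qed
qed

lemma smooth1_mult: "smooth1 f \<Longrightarrow> smooth1 g \<Longrightarrow> smooth1 (\<lambda>t. f t * g t)"
  by (rule smooth1_algebraD, rule smooth1_algebra.intros(3)) (auto intro: smooth1_algebra.intros(1))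

text \<open>Differentiation multiplies the amplitude by \<open>w\<close> and adds pi / 2 to the
  phase, so for fixed \<open>w\<close> the family is closed; the sine is one of its members.\<close>

lemma smooth1_cos_shift: "smooth1 (\<lambda>t. A * cos (w * t + p))"
proof (rule smooth1_coinduct[where C="{\<lambda>t. A * cos (w * t + p) | A p. True}"])
  fix f assume "f \<in> {\<lambda>t. A * cos (w * t + p) | A p. True}"
  then obtain A p where f: "f = (\<lambda>t. A * cos (w * t + p))" by blast
  have "(f has_real_derivative (A * w) * cos (w * t + (p + pi / 2))) (at t)" for t
    unfolding f by (auto intro!: derivative_eq_intros simp: cos_add sin_add algebra_simps)
  then show "\<exists>f'\<in>{\<lambda>t. A * cos (w * t + p) | A p. True}. \<forall>t. (f has_real_derivative f' t) (at t)"
    by (intro bexI[of _ "\<lambda>t. (A * w) * cos (w * t + (p + pi / 2))"]) auto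
qed auto

lemma smooth1_cos: "smooth1 cos" using smooth1_cos_shift[of 1 1 0] by simp

lemma smooth1_sin: "smooth1 sin"
  using smooth1_cos_shift[of 1 1 "- (pi / 2)"] by (simp add: cos_diff)

text \<open>\<open>exp_inv 0\<close> is the classical flat function. The factors
  \<open>inverse t ^ n\<close> are included because each derivative is a combination of two
  functions of the same family, which makes their span closed under differentiation.\<close>

definition exp_inv :: "nat \<Rightarrow> real \<Rightarrow> real" where
  "exp_inv n t = (if t > 0 then inverse t ^ n * exp (- inverse t) else 0)"

lemma exp_inv_tendsto: "(exp_inv n \<longlongrightarrow> 0) (at_right 0)"
proof -
  have "((\<lambda>x. x ^ n / exp x) \<longlongrightarrow> (0::real)) at_top" by (rule tendsto_power_div_exp_0)
  from filterlim_compose[OF this filterlim_inverse_at_top_right]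
  have "((\<lambda>t. inverse t ^ n / exp (inverse t)) \<longlongrightarrow> (0::real)) (at_right 0)" .
  then show ?thesis
    by (rule Lim_transform_eventually)
      (auto simp: exp_inv_def exp_minus divide_inverse eventually_at_right_less eventually_at_filter)
qed

lemma exp_inv_deriv: "(exp_inv n has_real_derivative exp_inv (n + 2) t - n * exp_inv (n + 1) t) (at t)"
proof -
  consider "t > 0" | "t < 0" | "t = 0" by linarith
  then show ?thesis
  proof cases
    case 1
    have "((\<lambda>t. inverse t ^ n * exp (- inverse t)) has_real_derivative exp_inv (n + 2) t - n * exp_inv (n + 1) t) (at t)"
    proof -
      have "((\<lambda>t. inverse t ^ n * exp (- inverse t)) has_real_derivative
          inverse t ^ n * (exp (- inverse t) * (inverse t * inverse t)) +
          real n * inverse t ^ (n - 1) * (- (inverse t * inverse t)) * exp (- inverse t)) (at t)"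
        using 1 by (auto intro!: derivative_eq_intros)
      moreover have "inverse t ^ n * (exp (- inverse t) * (inverse t * inverse t)) +
          real n * inverse t ^ (n - 1) * (- (inverse t * inverse t)) * exp (- inverse t)
          = exp_inv (n + 2) t - n * exp_inv (n + 1) t"
        using 1 by (cases n) (auto simp: exp_inv_def power2_eq_square algebra_simps)
      ultimately show ?thesis by simp
    qed
    then show ?thesis
      by (rule has_field_derivative_transform_within_open[where S="{0<..}"]) (auto simp: 1 exp_inv_def)
  next
    case 2
    have "((\<lambda>t. 0) has_real_derivative exp_inv (n + 2) t - n * exp_inv (n + 1) t) (at t)"
      using 2 by (simp add: exp_inv_def)
    then show ?thesis
      by (rule has_field_derivative_transform_within_open[where S="{..<0}"]) (auto simp: 2 exp_inv_def)
  next
    case 3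
    have "((\<lambda>h. exp_inv n h / h) \<longlongrightarrow> 0) (at_left 0)"
      by (rule Lim_transform_eventually[OF tendsto_const]) (auto simp: exp_inv_def eventually_at_filter)
    \<comment> \<open>For \<open>h > 0\<close> the quotient \<open>exp_inv n h / h\<close> equals
      \<open>exp_inv (Suc n) h\<close>, so the limit at 0 is already known with the index raised by
      one.\<close>
    moreover have "((\<lambda>h. exp_inv n h / h) \<longlongrightarrow> 0) (at_right 0)"
      by (rule Lim_transform_eventually[OF exp_inv_tendsto[of "Suc n"]])
        (auto simp: exp_inv_def eventually_at_filter divide_inverse)
    ultimately have "((\<lambda>h. exp_inv n h / h) \<longlongrightarrow> 0) (at 0)" by (rule filterlim_split_at)
    then show ?thesis by (simp add: 3 DERIV_def exp_inv_def)
  qed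
qed

inductive_set exp_inv_span :: "(real \<Rightarrow> real) set" where
  "(\<lambda>t. c * exp_inv n t) \<in> exp_inv_span"
| "f \<in> exp_inv_span \<Longrightarrow> g \<in> exp_inv_span \<Longrightarrow> (\<lambda>t. f t + g t) \<in> exp_inv_span"

lemma smooth1_exp_inv: "smooth1 (exp_inv n)"
proof (rule smooth1_coinduct[where C=exp_inv_span])
  show "exp_inv n \<in> exp_inv_span" using exp_inv_span.intros(1)[of 1 n] by simp
  show "\<exists>f'\<in>exp_inv_span. \<forall>t. (f has_real_derivative f' t) (at t)" if "f \<in> exp_inv_span" for f
    using that
  proof (induction rule: exp_inv_span.induct)
    case (1 c n)
    have "((\<lambda>t. c * exp_inv n t) has_real_derivative c * exp_inv (n + 2) t + (- c * n) * exp_inv (n + 1) t) (at t)" for t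
      using DERIV_cmult[OF exp_inv_deriv[of n t], of c] by (simp add: algebra_simps)
    then show ?case
      by (intro bexI[OF _ exp_inv_span.intros(2)[OF exp_inv_span.intros(1)[of c "n + 2"]
        exp_inv_span.intros(1)[of "- c * n" "n + 1"]]] allI)
  next
    case (2 f g)
    then obtain f' g' where "f' \<in> exp_inv_span" "\<And>t. (f has_real_derivative f' t) (at t)"
      "g' \<in> exp_inv_span" "\<And>t. (g has_real_derivative g' t) (at t)" by blast
    then show ?case
      by (intro bexI[of _ "\<lambda>t. f' t + g' t"]) (auto intro: exp_inv_span.intros DERIV_add)
  qed
qed

section \<open>One-variable steps and cutoffs with a controlled slope\<close>

lemma continuous_antiderivative:
  fixes f :: "real \<Rightarrow> real"
  assumes "continuous_on UNIV f"
  obtains G where "\<And>t. (G has_real_derivative f t) (at t)" "G 0 = 0"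
proof
  fix t :: real
  let ?G = "\<lambda>u. LBINT y=0..u. f y"
  show "(?G has_real_derivative f t) (at t)"
  proof -
    have "(?G has_vector_derivative f t) (at t within {- \<bar>t\<bar> - 1..\<bar>t\<bar> + 1})"
      using interval_integral_FTC2[of "- \<bar>t\<bar> - 1" 0 "\<bar>t\<bar> + 1" f t] continuous_on_subset[OF assms]
      unfolding zero_ereal_def by simp
    then have "(?G has_vector_derivative f t) (at t)"
      by (subst (asm) at_within_interior) (auto simp: interior_atLeastAtMost_real)
    then show ?thesis by (simp add: has_real_derivative_iff_has_vector_derivative)
  qed
  show "(LBINT y=0..(0::real). f y) = 0" by (simp add: zero_ereal_def[symmetric])
qed

text \<open>The normalized antiderivative of a bump. It serves twice: first for the exponential
  bump, where nothing is known about the slope, and then for a plateau assembled from the resulting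
  step, where the integral and hence the slope can be estimated.\<close>

lemma smooth_step_from_bump:
  assumes b: "smooth1 b" and b0: "\<And>t. 0 \<le> b t" and bs: "\<And>t. t \<le> 0 \<or> 1 \<le> t \<Longrightarrow> b t = 0"
    and pos: "0 < b t0"
  obtains G where "smooth1 (\<lambda>t. G t / G 1)" "\<And>t. (G has_real_derivative b t) (at t)" "\<And>t. t \<le> 0 \<Longrightarrow> G t = 0"
    "\<And>t. 1 \<le> t \<Longrightarrow> G t = G 1" "0 < G 1" "\<And>s t. s \<le> t \<Longrightarrow> G s \<le> G t"
proof -
  obtain G where G: "\<And>t. (G has_real_derivative b t) (at t)" "G 0 = 0"
    using continuous_antiderivative[OF smooth1_continuous[OF b]] by blast
  have mono: "G s \<le> G t" if "s \<le> t" for s t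
    using DERIV_nonneg_imp_nondecreasing[OF that] G b0 by metis
  have cont: "continuous_on S G" for S
    by (meson G(1) DERIV_isCont continuous_at_imp_continuous_on)
  have neg: "G t = 0" if "t \<le> 0" for t
  proof (cases "t = 0")
    case False
    have "G 0 = G t"
    proof (rule DERIV_isconst_end[OF _ cont])
      show "t < 0" using that False by simp
      show "(G has_real_derivative 0) (at x)" if "t < x" "x < 0" for x
        using G(1)[of x] bs[of x] that by simp
    qed
    then show ?thesis using G(2) by simp
  qed (use G(2) in simp)
  have ge1: "G t = G 1" if "1 \<le> t" for t
  proof (cases "t = 1")
    case False
    show ?thesis
    proof (rule DERIV_isconst_end[OF _ cont])
      show "1 < t" using that False by simp
      show "(G has_real_derivative 0) (at x)" if "1 < x" "x < t" for x
        using G(1)[of x] bs[of x] that by simp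
    qed
  qed simp
  have "G 1 \<noteq> 0"
  proof
    assume "G 1 = 0"
    have z: "G t = 0" for t
      using mono[of 0 t] mono[of t 1] neg[of t] ge1[of t] G(2) \<open>G 1 = 0\<close> by linarith
    then have "G = (\<lambda>t. 0)" by (intro ext)
    then have "((\<lambda>t. 0) has_real_derivative b t0) (at t0)" using G(1)[of t0] by simp
    then have "b t0 = 0" by (metis DERIV_const DERIV_unique)
    then show False using pos by simp
  qed
  then have "0 < G 1" using mono[of 0 1] G(2) by simp
  moreover have "smooth1 (\<lambda>t. G t / G 1)"
    using smooth1_affine[OF smooth1_antideriv[OF G(1) b], of "1 / G 1" 0 1] by simp
  ultimately show ?thesis using that G(1) neg ge1 mono by blast
qed

text \<open>The slope bound comes from integrating a bump that equals 1 on \<open>[1/8, 7/8]\<close>.\<close>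

lemma smooth_step:
  obtains \<theta> \<theta>' :: "real \<Rightarrow> real" where "smooth1 \<theta>" "\<And>t. (\<theta> has_real_derivative \<theta>' t) (at t)"
    "\<And>t. 0 \<le> \<theta> t" "\<And>t. \<theta> t \<le> 1" "\<And>t. t \<le> 0 \<Longrightarrow> \<theta> t = 0" "\<And>t. 1 \<le> t \<Longrightarrow> \<theta> t = 1"
    "\<And>t. 0 \<le> \<theta>' t" "\<And>t. \<theta>' t \<le> 3/2" "\<And>t. t \<le> 0 \<or> 1 \<le> t \<Longrightarrow> \<theta>' t = 0"
proof -
  let ?b = "\<lambda>t. exp_inv 0 t * exp_inv 0 (1 - t)"
  have "smooth1 ?b"
    using smooth1_mult[OF smooth1_exp_inv[of 0] smooth1_affine[OF smooth1_exp_inv[of 0], of 1 1 "-1"]] by simp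
  moreover have "0 \<le> ?b t" for t by (simp add: exp_inv_def)
  moreover have "?b t = 0" if "t \<le> 0 \<or> 1 \<le> t" for t using that by (auto simp: exp_inv_def)
  moreover have "0 < ?b (1/2)" by (simp add: exp_inv_def)
  ultimately obtain G where G0: "smooth1 (\<lambda>t. G t / G 1)" "\<And>t. (G has_real_derivative ?b t) (at t)" "\<And>t. t \<le> 0 \<Longrightarrow> G t = 0"
    "\<And>t. 1 \<le> t \<Longrightarrow> G t = G 1" "0 < G 1" "\<And>s t. s \<le> t \<Longrightarrow> G s \<le> G t"
    by (rule smooth_step_from_bump) (assumption, rule that)
  note G = G0(1,3-6)
  define h where "h t = G t / G 1" for t :: real
  have h: "smooth1 h" "0 \<le> h t" "h t \<le> 1" "t \<le> 0 \<Longrightarrow> h t = 0" "1 \<le> t \<Longrightarrow> h t = 1" for t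
  proof -
    show "smooth1 h" using G(1) by (simp add: h_def[abs_def])
    show "0 \<le> h t" using G(5)[of 0 t] G(2)[of t] G(2)[of 0] G(4) by (cases "t \<le> 0") (auto simp: h_def)
    show "h t \<le> 1" using G(5)[of t 1] G(3)[of t] G(4) by (cases "t \<le> 1") (auto simp: h_def)
    show "t \<le> 0 \<Longrightarrow> h t = 0" "1 \<le> t \<Longrightarrow> h t = 1"
      using G(2)[of t] G(3)[of t] G(4) by (simp_all add: h_def)
  qed
  \<comment> \<open>Second pass: the first step compressed by 8, and its mirror image, give a bump
    whose ramps occupy only \<open>[0, 1/8]\<close> and \<open>[7/8, 1]\<close>.\<close>
  let ?c = "\<lambda>t. h (8 * t) * h (8 * (1 - t))"
  have c1: "?c t = 1" if "1/8 \<le> t" "t \<le> 7/8" for t using that h(5)[of "8 * t"] h(5)[of "8 * (1 - t)"] by auto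
  have "smooth1 ?c"
    using smooth1_mult[OF smooth1_affine[OF h(1), of 1 0 8] smooth1_affine[OF h(1), of 1 8 "-8"]]
    by (simp add: algebra_simps)
  moreover have c0: "0 \<le> ?c t" for t using h by (auto intro: mult_nonneg_nonneg)
  moreover have cs: "?c t = 0" if "t \<le> 0 \<or> 1 \<le> t" for t using that h(4)[of "8 * t"] h(4)[of "8 * (1 - t)"] by auto
  moreover have "0 < ?c (1/2)" using c1[of "1/2"] by simp
  ultimately obtain H where H: "smooth1 (\<lambda>t. H t / H 1)" "\<And>t. (H has_real_derivative ?c t) (at t)" "\<And>t. t \<le> 0 \<Longrightarrow> H t = 0"
    "\<And>t. 1 \<le> t \<Longrightarrow> H t = H 1" "0 < H 1" "\<And>s t. s \<le> t \<Longrightarrow> H s \<le> H t"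
    by (rule smooth_step_from_bump) (assumption, rule that)
  have c2: "?c t \<le> 1" for t using h by (intro mult_le_one) auto
  \<comment> \<open>The mean value theorem evaluates the increase over the plateau exactly as 3/4.
    The total increase \<open>H 1\<close> is at least that, and since the bump is at most 1, the
    normalized slope is at most 4/3.\<close>
  have "\<exists>z>1/8. z < 7/8 \<and> H (7/8) - H (1/8) = (7/8 - 1/8) * ?c z"
    using MVT2[of "1/8" "7/8" H ?c] H(2) by simp
  then have "H (7/8) - H (1/8) = 3/4" using c1 by fastforce
  then have H1: "3/4 \<le> H 1" using H(6)[of "7/8" 1] H(6)[of 0 "1/8"] H(3)[of 0] by simp
  show ?thesis
  proof (rule that[of "\<lambda>t. H t / H 1" "\<lambda>t. ?c t / H 1"])
    show "((\<lambda>t. H t / H 1) has_real_derivative ?c t / H 1) (at t)" for t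
      by (intro DERIV_cdivide H(2))
    show "0 \<le> H t / H 1" for t using H(6)[of 0 t] H(3)[of t] H(3)[of 0] H(5) by (cases "t \<le> 0") auto
    show "H t / H 1 \<le> 1" for t using H(6)[of t 1] H(4)[of t] H(5) by (cases "t \<le> 1") auto
    show "?c t / H 1 \<le> 3/2" for t
    proof -
      have "?c t / H 1 \<le> 1 / (3/4)" using c0[of t] c2[of t] H1 by (intro frac_le) auto
      then show ?thesis by simp
    qed
    show "0 \<le> ?c t / H 1" for t using c0[of t] H(5) by (intro divide_nonneg_pos) auto
    show "?c t / H 1 = 0" if "t \<le> 0 \<or> 1 \<le> t" for t using cs[OF that] by simp
    show "H t / H 1 = 0" if "t \<le> 0" for t using H(3)[OF that] by simp
    show "H t / H 1 = 1" if "1 \<le> t" for t using H(4)[OF that] H(5) by simp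
  qed (rule H(1))
qed

lemma smooth_cutoff:
  fixes p q w :: real
  assumes w: "0 < w" and pq: "p + w \<le> q - w"
  obtains \<kappa> \<kappa>' where "smooth1 \<kappa>" "\<And>t. (\<kappa> has_real_derivative \<kappa>' t) (at t)"
    "\<And>t. 0 \<le> \<kappa> t" "\<And>t. \<kappa> t \<le> 1" "\<And>t. t \<le> p \<or> q \<le> t \<Longrightarrow> \<kappa> t = 0"
    "\<And>t. p + w \<le> t \<Longrightarrow> t \<le> q - w \<Longrightarrow> \<kappa> t = 1" "\<And>t. \<bar>\<kappa>' t\<bar> \<le> 3 / 2 / w"
    "\<And>t. p + w \<le> t \<Longrightarrow> t \<le> q - w \<Longrightarrow> \<kappa>' t = 0" "\<And>t. t \<le> p \<or> q \<le> t \<Longrightarrow> \<kappa>' t = 0"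
proof -
  obtain \<theta> \<theta>' :: "real \<Rightarrow> real" where th: "smooth1 \<theta>" "\<And>t. (\<theta> has_real_derivative \<theta>' t) (at t)"
    "\<And>t. 0 \<le> \<theta> t" "\<And>t. \<theta> t \<le> 1" "\<And>t. t \<le> 0 \<Longrightarrow> \<theta> t = 0" "\<And>t. 1 \<le> t \<Longrightarrow> \<theta> t = 1"
    "\<And>t. 0 \<le> \<theta>' t" "\<And>t. \<theta>' t \<le> 3/2" "\<And>t. t \<le> 0 \<or> 1 \<le> t \<Longrightarrow> \<theta>' t = 0"
    using smooth_step by blast
  define u v where "u t = (t - p) / w" and "v t = (q - t) / w" for t
  have uv: "t \<le> p \<Longrightarrow> u t \<le> 0" "q \<le> t \<Longrightarrow> v t \<le> 0" "p + w \<le> t \<Longrightarrow> 1 \<le> u t" "t \<le> q - w \<Longrightarrow> 1 \<le> v t" for t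
    using w by (auto simp: u_def v_def field_simps)
  show ?thesis
  proof (rule that[of "\<lambda>t. \<theta> (u t) * \<theta> (v t)" "\<lambda>t. \<theta>' (u t) / w * \<theta> (v t) - \<theta>' (v t) / w * \<theta> (u t)"])
    have "smooth1 (\<lambda>t. \<theta> (u t))" "smooth1 (\<lambda>t. \<theta> (v t))"
      using smooth1_affine[OF th(1), of 1 "- p / w" "1 / w"] smooth1_affine[OF th(1), of 1 "q / w" "- 1 / w"]
      by (simp_all add: u_def v_def diff_divide_distrib)
    then show "smooth1 (\<lambda>t. \<theta> (u t) * \<theta> (v t))" by (rule smooth1_mult)
    have du: "((\<lambda>t. \<theta> (u t)) has_real_derivative \<theta>' (u t) * (1 / w)) (at t)" for t
      by (rule DERIV_chain2[OF th(2)]) (use w in \<open>auto simp: u_def intro!: derivative_eq_intros\<close>)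
    have dv: "((\<lambda>t. \<theta> (v t)) has_real_derivative \<theta>' (v t) * (- 1 / w)) (at t)" for t
      by (rule DERIV_chain2[OF th(2)]) (use w in \<open>auto simp: v_def intro!: derivative_eq_intros\<close>)
    show "((\<lambda>t. \<theta> (u t) * \<theta> (v t)) has_real_derivative \<theta>' (u t) / w * \<theta> (v t) - \<theta>' (v t) / w * \<theta> (u t)) (at t)" for t
      using DERIV_mult[OF du dv, of t] by simp
    \<comment> \<open>The two products are nonnegative and enter with opposite signs, so their
      difference is bounded by the larger one and not by their sum. The slope stays at 3/2 /
      \<open>w\<close> instead of doubling.\<close>
    show "\<bar>\<theta>' (u t) / w * \<theta> (v t) - \<theta>' (v t) / w * \<theta> (u t)\<bar> \<le> 3 / 2 / w" for t
    proof -
      have *: "\<theta>' r / w * \<theta> s \<le> 3 / 2 / w * 1" for r s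
        using w th(3,4,7,8) by (intro mult_mono divide_right_mono) (auto intro: less_imp_le)
      have **: "0 \<le> \<theta>' r / w * \<theta> s" for r s
        using w th(3,7) by simp
      show ?thesis
        using *[of "u t" "v t"] *[of "v t" "u t"] **[of "u t" "v t"] **[of "v t" "u t"] by linarith
    qed
  qed (use th uv in \<open>auto intro: mult_le_one\<close>)
qed

section \<open>Smooth functions of several variables\<close>

lemma smooth_fun_coinduct:
  fixes f :: "real^'d::finite \<Rightarrow> real"
  assumes "f \<in> C"
    and "\<And>f. f \<in> C \<Longrightarrow> continuous_on UNIV f"
    and "\<And>f i x. f \<in> C \<Longrightarrow> (\<lambda>t. f (x + t *\<^sub>R axis i 1)) differentiable (at 0)"
    and "\<And>f i. f \<in> C \<Longrightarrow> pderiv_axis i f \<in> C"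
  shows "smooth_fun f"
proof -
  have "dpart is f \<in> C" for "is" by (induction "is") (auto simp: assms)
  then show ?thesis unfolding smooth_fun_def using assms by blast
qed

lemma smooth_fun_continuous: "smooth_fun f \<Longrightarrow> continuous_on S f"
  unfolding smooth_fun_def by (metis continuous_on_subset dpart.simps(1) subset_UNIV)

lemma smooth_fun_pderiv: "smooth_fun f \<Longrightarrow> smooth_fun (pderiv_axis i f)"
proof -
  have "dpart is (pderiv_axis i f) = dpart (is @ [i]) f" for "is" by (induction "is") auto
  then show "smooth_fun f \<Longrightarrow> smooth_fun (pderiv_axis i f)" unfolding smooth_fun_def by simp
qed

lemma pderiv_axis_eqI:
  "((\<lambda>t. f (x + t *\<^sub>R axis i 1)) has_real_derivative D) (at 0) \<Longrightarrow> pderiv_axis i f x = D"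
  unfolding pderiv_axis_def by (rule DERIV_imp_deriv)

lemma smooth_fun_has_pderiv:
  assumes "smooth_fun f"
  shows "((\<lambda>t. f (x + t *\<^sub>R axis i 1)) has_real_derivative pderiv_axis i f x) (at 0)"
proof -
  have "(\<lambda>t. f (x + t *\<^sub>R axis i 1)) differentiable (at 0)"
    using assms unfolding smooth_fun_def by (metis dpart.simps(1))
  then show ?thesis unfolding pderiv_axis_def
    by (metis DERIV_imp_deriv real_differentiable_def)
qed

lemma smooth_fun_has_pderiv_at:
  assumes "smooth_fun f"
  shows "((\<lambda>t. f (x + t *\<^sub>R axis i 1)) has_real_derivative pderiv_axis i f (x + t *\<^sub>R axis i 1)) (at t)"
  using smooth_fun_has_pderiv[OF assms, of "x + t *\<^sub>R axis i 1" i]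
    DERIV_shift[of "\<lambda>t. f (x + t *\<^sub>R axis i 1)" _ 0 t]
  by (simp add: scaleR_add_left add.assoc add.commute[of _ t] add.left_commute)

inductive_set smooth_algebra :: "(real^'d::finite \<Rightarrow> real) set" where
  "smooth_fun f \<Longrightarrow> f \<in> smooth_algebra"
| "f \<in> smooth_algebra \<Longrightarrow> g \<in> smooth_algebra \<Longrightarrow> (\<lambda>t. f t + g t) \<in> smooth_algebra"
| "f \<in> smooth_algebra \<Longrightarrow> g \<in> smooth_algebra \<Longrightarrow> (\<lambda>t. f t * g t) \<in> smooth_algebra"

lemma smooth_algebra_pderiv:
  fixes f :: "real^'d::finite \<Rightarrow> real"
  shows "f \<in> smooth_algebra \<Longrightarrow> pderiv_axis i f \<in> smooth_algebra \<and>
    (\<forall>x. ((\<lambda>t. f (x + t *\<^sub>R axis i 1)) has_real_derivative pderiv_axis i f x) (at 0))"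
proof (induction rule: smooth_algebra.induct)
  case (1 f)
  then show ?case using smooth_fun_has_pderiv smooth_fun_pderiv smooth_algebra.intros(1) by metis
next
  case (2 f g)
  have d: "((\<lambda>t. f (x + t *\<^sub>R axis i 1) + g (x + t *\<^sub>R axis i 1)) has_real_derivative
      pderiv_axis i f x + pderiv_axis i g x) (at 0)" for x
    using 2 by (intro DERIV_add) auto
  then have "pderiv_axis i (\<lambda>t. f t + g t) = (\<lambda>x. pderiv_axis i f x + pderiv_axis i g x)"
    by (intro ext pderiv_axis_eqI)
  then show ?case using d 2 by (auto intro: smooth_algebra.intros)
next
  case (3 f g)
  have d: "((\<lambda>t. f (x + t *\<^sub>R axis i 1) * g (x + t *\<^sub>R axis i 1)) has_real_derivative
      pderiv_axis i f x * g x + pderiv_axis i g x * f x) (at 0)" for x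
    using DERIV_mult[of "\<lambda>t. f (x + t *\<^sub>R axis i 1)" _ 0 UNIV "\<lambda>t. g (x + t *\<^sub>R axis i 1)"] 3 by simp
  then have "pderiv_axis i (\<lambda>t. f t * g t) = (\<lambda>x. pderiv_axis i f x * g x + pderiv_axis i g x * f x)"
    by (intro ext pderiv_axis_eqI)
  then show ?case using d 3 by (auto intro: smooth_algebra.intros)
qed

lemma smooth_algebraD: "f \<in> smooth_algebra \<Longrightarrow> smooth_fun f"
proof (rule smooth_fun_coinduct[where C=smooth_algebra])
  show "continuous_on UNIV f" if "f \<in> smooth_algebra" for f :: "real^'d::finite \<Rightarrow> real"
    using that by induction (auto intro: smooth_fun_continuous continuous_intros)
  show "(\<lambda>t. f (x + t *\<^sub>R axis i 1)) differentiable (at 0)" if "f \<in> smooth_algebra" for f :: "real^'d::finite \<Rightarrow> real" and i x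
    using smooth_algebra_pderiv[OF that, of i] real_differentiable_def by blast
qed (auto simp: smooth_algebra_pderiv)

lemma smooth_fun_add: "smooth_fun f \<Longrightarrow> smooth_fun g \<Longrightarrow> smooth_fun (\<lambda>x. f x + g x)"
  by (rule smooth_algebraD, rule smooth_algebra.intros(2)) (auto intro: smooth_algebra.intros(1))

lemma smooth_fun_mult: "smooth_fun f \<Longrightarrow> smooth_fun g \<Longrightarrow> smooth_fun (\<lambda>x. f x * g x)"
  by (rule smooth_algebraD, rule smooth_algebra.intros(3)) (auto intro: smooth_algebra.intros(1))

lemma pderiv_add:
  assumes "smooth_fun f" "smooth_fun g"
  shows "pderiv_axis i (\<lambda>x. f x + g x) x = pderiv_axis i f x + pderiv_axis i g x"
  using DERIV_add[OF smooth_fun_has_pderiv[OF assms(1)] smooth_fun_has_pderiv[OF assms(2)]]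
  by (intro pderiv_axis_eqI)

lemma pderiv_mult:
  assumes "smooth_fun f" "smooth_fun g"
  shows "pderiv_axis i (\<lambda>x. f x * g x) x = pderiv_axis i f x * g x + f x * pderiv_axis i g x"
  using DERIV_mult[OF smooth_fun_has_pderiv[OF assms(1)] smooth_fun_has_pderiv[OF assms(2)], of x i x i]
  by (intro pderiv_axis_eqI) (simp add: algebra_simps)

lemma pderiv_coord:
  assumes "\<And>t. (g has_real_derivative g' t) (at t)"
  shows "((\<lambda>t. g ((x + t *\<^sub>R axis i 1) $ j)) has_real_derivative (if i = j then g' (x $ j) else 0)) (at 0)"
    and "pderiv_axis i (\<lambda>x. g (x $ j)) x = (if i = j then g' (x $ j) else 0)"
proof -
  show "((\<lambda>t. g ((x + t *\<^sub>R axis i 1) $ j)) has_real_derivative (if i = j then g' (x $ j) else 0)) (at 0)"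
  proof (cases "i = j")
    case True
    have "((\<lambda>t. g (x $ j + t)) has_real_derivative g' (x $ j + 0) * 1) (at 0)"
      by (rule DERIV_chain2[OF assms]) (auto intro!: derivative_eq_intros)
    then show ?thesis using True by (simp add: axis_def)
  qed (simp add: axis_def)
  then show "pderiv_axis i (\<lambda>x. g (x $ j)) x = (if i = j then g' (x $ j) else 0)" by (rule pderiv_axis_eqI)
qed

lemma smooth_fun_const: "smooth_fun (\<lambda>x. c)"
proof (rule smooth_fun_coinduct[where C="range (\<lambda>c x. c)"])
  show "pderiv_axis i f \<in> range (\<lambda>c x. c)" if "f \<in> range (\<lambda>c x. c)" for f :: "real^'d::finite \<Rightarrow> real" and i
    using that by (auto intro!: image_eqI[of _ _ 0] simp: pderiv_axis_def)
qed auto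

lemma smooth_fun_coord:
  fixes j :: "'d::finite"
  assumes "smooth1 g" shows "smooth_fun (\<lambda>x::real^'d. g (x $ j))"
proof (rule smooth_fun_coinduct[where C="{\<lambda>x::real^'d. g (x $ j) | g. smooth1 g}"])
  fix f :: "real^'d \<Rightarrow> real" assume "f \<in> {\<lambda>x. g (x $ j) | g. smooth1 g}"
  then obtain g where f: "f = (\<lambda>x. g (x $ j))" and g: "smooth1 g" by blast
  obtain g' where g': "smooth1 g'" "\<And>t. (g has_real_derivative g' t) (at t)" using smooth1_deriv[OF g] by blast
  show "continuous_on UNIV f" unfolding f
    by (rule continuous_on_compose2[OF smooth1_continuous[OF g]]) (auto intro: continuous_intros)
  show "(\<lambda>t. f (x + t *\<^sub>R axis i 1)) differentiable (at 0)" for x i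
    unfolding f using pderiv_coord(1)[OF g'(2)] real_differentiable_def by blast
  have z: "smooth1 (\<lambda>t. 0)" using smooth1_affine[OF g, of 0] by simp
  show "pderiv_axis i f \<in> {\<lambda>x. g (x $ j) | g. smooth1 g}" for i
    using pderiv_coord(2)[OF g'(2), of i j] g'(1) z unfolding f
    by (cases "i = j") (auto simp: fun_eq_iff)
qed (use assms in auto)

lemma smooth_fun_sum: "(\<And>i. i \<in> I \<Longrightarrow> smooth_fun (f i)) \<Longrightarrow> smooth_fun (\<lambda>x. \<Sum>i\<in>I. f i x)"
  by (induction I rule: infinite_finite_induct) (auto intro: smooth_fun_add smooth_fun_const)

lemma smooth_fun_prod: "(\<And>i. i \<in> I \<Longrightarrow> smooth_fun (f i)) \<Longrightarrow> smooth_fun (\<lambda>x. \<Prod>i\<in>I. f i x)"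
  by (induction I rule: infinite_finite_induct) (auto intro: smooth_fun_mult smooth_fun_const)

lemma pderiv_const: "pderiv_axis i (\<lambda>x. c) x = 0"
  by (simp add: pderiv_axis_def)

lemma pderiv_cmult: "smooth_fun f \<Longrightarrow> pderiv_axis i (\<lambda>x. c * f x) x = c * pderiv_axis i f x"
  by (simp add: pderiv_mult[OF smooth_fun_const] pderiv_const)

lemma pderiv_sum:
  assumes "\<And>k. k \<in> I \<Longrightarrow> smooth_fun (f k)"
  shows "pderiv_axis i (\<lambda>x. \<Sum>k\<in>I. f k x) x = (\<Sum>k\<in>I. pderiv_axis i (f k) x)"
  using assms
  by (induction I rule: infinite_finite_induct) (auto simp: pderiv_const pderiv_add smooth_fun_sum)

lemma pderiv_prod:
  fixes g :: "'d::finite \<Rightarrow> real \<Rightarrow> real"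
  assumes "\<And>j. smooth1 (g j)" "\<And>t. (g i has_real_derivative g' t) (at t)"
  shows "pderiv_axis i (\<lambda>x. \<Prod>j\<in>UNIV. g j (x $ j)) x = g' (x $ i) * (\<Prod>j\<in>UNIV - {i}. g j (x $ j))"
proof -
  have "((\<lambda>t. \<Prod>j\<in>UNIV - {i}. g j ((x + t *\<^sub>R axis i 1) $ j)) has_real_derivative 0) (at 0)"
    by (simp add: axis_def)
  from DERIV_mult[OF pderiv_coord(1)[OF assms(2), of x i i] this]
  have "((\<lambda>t. \<Prod>j\<in>UNIV. g j ((x + t *\<^sub>R axis i 1) $ j)) has_real_derivative
      g' (x $ i) * (\<Prod>j\<in>UNIV - {i}. g j (x $ j))) (at 0)"
    by (simp add: prod.remove[of UNIV i])
  then show ?thesis by (rule pderiv_axis_eqI)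
qed

section \<open>Supports and test functions\<close>

lemma pderiv_outside_support:
  assumes "x \<notin> closure {x. \<phi> x \<noteq> 0}"
  shows "pderiv_axis i \<phi> x = 0"
proof (rule pderiv_axis_eqI)
  have "open (- closure {x. \<phi> x \<noteq> 0})" by (rule open_Compl) simp
  then have o: "open ((\<lambda>t. x + t *\<^sub>R axis i 1) -` (- closure {x. \<phi> x \<noteq> 0}))"
    by (intro open_vimage) (auto intro!: continuous_intros)
  have "((\<lambda>t. 0) has_real_derivative 0) (at 0)" by simp
  then show "((\<lambda>t. \<phi> (x + t *\<^sub>R axis i 1)) has_real_derivative 0) (at 0)"
  proof (rule has_field_derivative_transform_within_open[OF _ o])
    show "0 \<in> (\<lambda>t. x + t *\<^sub>R axis i 1) -` (- closure {x. \<phi> x \<noteq> 0})" using assms by simp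
    show "0 = \<phi> (x + t *\<^sub>R axis i 1)" if "t \<in> (\<lambda>t. x + t *\<^sub>R axis i 1) -` (- closure {x. \<phi> x \<noteq> 0})" for t
    proof -
      have "x + t *\<^sub>R axis i 1 \<notin> closure {x. \<phi> x \<noteq> 0}" using that by simp
      then have "x + t *\<^sub>R axis i 1 \<notin> {x. \<phi> x \<noteq> 0}"
        using closure_subset[of "{x. \<phi> x \<noteq> 0}"] by blast
      then show ?thesis by simp
    qed
  qed
qed

lemma continuous_compact_support_bounded:
  fixes f :: "'a::t2_space \<Rightarrow> real"
  assumes "continuous_on UNIV f" "compact K" "\<And>x. x \<notin> K \<Longrightarrow> f x = 0"
  obtains B where "\<And>x. \<bar>f x\<bar> \<le> B"
proof -
  have "compact (f ` K)" using assms by (intro compact_continuous_image) (auto intro: continuous_on_subset)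
  then have "bounded (f ` K)" by (rule compact_imp_bounded)
  then obtain B where "\<And>x. x \<in> K \<Longrightarrow> \<bar>f x\<bar> \<le> B" unfolding bounded_iff by auto
  then show ?thesis using that[of "max B 0"] assms(3) by (metis abs_zero max.coboundedI1 max.cobounded2)
qed

lemma test_fun_props:
  assumes "test_fun S \<phi>"
  shows "smooth_fun \<phi>" "continuous_on T \<phi>" "continuous_on T (pderiv_axis i \<phi>)"
    "x \<notin> S \<Longrightarrow> \<phi> x = 0" "x \<notin> S \<Longrightarrow> pderiv_axis i \<phi> x = 0" "\<exists>B. \<forall>x. \<bar>\<phi> x\<bar> \<le> B" "\<exists>B. \<forall>x. \<bar>pderiv_axis i \<phi> x\<bar> \<le> B"
proof -
  let ?K = "closure {x. \<phi> x \<noteq> 0}"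
  show s: "smooth_fun \<phi>" and c: "continuous_on T \<phi>" "continuous_on T (pderiv_axis i \<phi>)" for T
    using assms by (auto simp: test_fun_def intro: smooth_fun_continuous smooth_fun_pderiv)
  have K: "compact ?K" "?K \<subseteq> S" using assms by (auto simp: test_fun_def)
  have o: "\<And>x. x \<notin> ?K \<Longrightarrow> \<phi> x = 0"
    using closure_subset[of "{x. \<phi> x \<noteq> 0}"] by blast
  have p: "\<And>x. x \<notin> ?K \<Longrightarrow> pderiv_axis i \<phi> x = 0" by (rule pderiv_outside_support)
  show "x \<notin> S \<Longrightarrow> \<phi> x = 0" "x \<notin> S \<Longrightarrow> pderiv_axis i \<phi> x = 0" using o p K(2) by blast+
  show "\<exists>B. \<forall>x. \<bar>\<phi> x\<bar> \<le> B" "\<exists>B. \<forall>x. \<bar>pderiv_axis i \<phi> x\<bar> \<le> B"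
  proof -
    obtain B where "\<And>x. \<bar>\<phi> x\<bar> \<le> B" by (rule continuous_compact_support_bounded[OF c(1) K(1) o]) (assumption, rule that)
    then show "\<exists>B. \<forall>x. \<bar>\<phi> x\<bar> \<le> B" by (intro exI allI)
    obtain B where "\<And>x. \<bar>pderiv_axis i \<phi> x\<bar> \<le> B" by (rule continuous_compact_support_bounded[OF c(2) K(1) p]) (assumption, rule that)
    then show "\<exists>B. \<forall>x. \<bar>pderiv_axis i \<phi> x\<bar> \<le> B" by (intro exI allI)
  qed
qed

lemma test_fun_mult:
  assumes "test_fun S \<phi>" "smooth_fun \<psi>"
  shows "test_fun S (\<lambda>x. \<psi> x * \<phi> x)"
proof -
  have sub: "closure {x. \<psi> x * \<phi> x \<noteq> 0} \<subseteq> closure {x. \<phi> x \<noteq> 0}" by (rule closure_mono) auto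
  moreover have "compact (closure {x. \<psi> x * \<phi> x \<noteq> 0})"
    using assms compact_Int_closed[of "closure {x. \<phi> x \<noteq> 0}" "closure {x. \<psi> x * \<phi> x \<noteq> 0}"] sub
    by (simp add: test_fun_def Int_absorb1)
  ultimately show ?thesis
    using assms unfolding test_fun_def by (auto intro: smooth_fun_mult)
qed

lemma test_fun_subset: "test_fun S \<phi> \<Longrightarrow> S \<subseteq> T \<Longrightarrow> test_fun T \<phi>"
  by (auto simp: test_fun_def)

subsection \<open>Trigonometric systems on a cube\<close>

lemma sum_Basis_nth [simp]: "(\<Sum>x\<in>Basis. (x :: real^'d::finite) $ i) = 1"
proof -
  have "(\<Sum>x\<in>Basis. (x :: real^'d) $ i) = (\<Sum>x\<in>Basis. (x :: real^'d) \<bullet> axis i 1)" by (simp add: inner_axis)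
  also have "\<dots> = 1" by (simp add: inner_Basis)
  finally show ?thesis .
qed

lemma mem_cube: "x \<in> cube c s \<longleftrightarrow> (\<forall>i. c $ i - s / 2 < x $ i \<and> x $ i < c $ i + s / 2)"
proof -
  have "x \<in> cube c s \<longleftrightarrow> (\<forall>b\<in>Basis. (c - (s/2) *\<^sub>R One) \<bullet> b < x \<bullet> b \<and> x \<bullet> b < (c + (s/2) *\<^sub>R One) \<bullet> b)"
    by (auto simp: cube_def mem_box)
  also have "\<dots> \<longleftrightarrow> (\<forall>i. (c - (s/2) *\<^sub>R One) $ i < x $ i \<and> x $ i < (c + (s/2) *\<^sub>R One) $ i)"
    by (auto simp: Basis_vec_def inner_axis)
  finally show ?thesis by simp
qed

lemma bounded_cube: "bounded (cube c s)" by (simp add: cube_def bounded_box)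

lemma cube_lmeasurable: "cube c s \<in> lmeasurable" by (simp add: cube_def)

lemma cube_sets [simp, measurable]: "cube c s \<in> sets lebesgue" "cube c s \<in> sets borel"
  by (simp_all add: cube_def)

lemma finite_measure_cube: "finite_measure (lebesgue_on (cube c s))"
  by (intro finite_measure_lebesgue_on cube_lmeasurable)

lemma cube_mono: "s \<le> t \<Longrightarrow> cube c s \<subseteq> cube c t"
  by (auto simp: mem_cube subset_eq) (smt (verit) field_sum_of_halves)+

lemma continuous_measurable_cube: "continuous_on UNIV f \<Longrightarrow> f \<in> borel_measurable (lebesgue_on (cube c s))"
  by (rule continuous_imp_measurable_on_sets_lebesgue[OF continuous_on_subset[of UNIV]]) simp_all

text \<open>Fubini for a product integrand, through the description of \<open>lborel\<close> as an
  image of the product measure over \<open>Basis\<close>; the axis vectors translate basis vectors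
  into coordinates. The closed intervals on the right suit the fundamental theorem of calculus and
  differ from the open ones by null sets.\<close>

lemma integral_cube_prod:
  fixes c :: "real^'d::finite" and f :: "'d \<Rightarrow> real \<Rightarrow> real"
  assumes f: "\<And>i. continuous_on UNIV (f i)"
  shows "(\<integral>x. (\<Prod>i\<in>UNIV. f i (x $ i)) \<partial>lebesgue_on (cube c s))
    = (\<Prod>i\<in>UNIV. \<integral>t. f i t * indicator {c $ i - s / 2..c $ i + s / 2} t \<partial>lborel)"
proof -
  interpret product_sigma_finite "\<lambda>_. lborel :: real measure" by standard
  define g where "g i t = f i t * indicator {c $ i - s / 2<..<c $ i + s / 2} t" for i t
  define g' where "g' i t = f i t * indicator {c $ i - s / 2..c $ i + s / 2} t" for i t
  have fm [measurable]: "f i \<in> borel_measurable borel" for i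
    using f by (rule borel_measurable_continuous_onI)
  have gm [measurable]: "g i \<in> borel_measurable borel" "g' i \<in> borel_measurable borel" for i
    unfolding g_def[abs_def] g'_def[abs_def] by measurable
  have gg': "AE t in lborel. g i t = g' i t" for i
    using AE_lborel_singleton[of "c $ i - s / 2"] AE_lborel_singleton[of "c $ i + s / 2"]
    by eventually_elim (auto simp: g_def g'_def indicator_def)
  have g'i: "integrable lborel (g' i)" for i
  proof -
    have "integrable lborel (\<lambda>t. indicator {c $ i - s / 2..c $ i + s / 2} t *\<^sub>R f i t)"
      by (rule borel_integrable_compact[OF compact_Icc continuous_on_subset[OF f subset_UNIV]])
    then show ?thesis by (simp add: g'_def[abs_def] mult.commute)
  qed
  then have gi: "integrable lborel (g i)" for i
    using integrable_cong_AE[of "g i" lborel "g' i"] gg' by simp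
  define ax where "ax i = (axis i 1 :: real^'d)" for i
  have inj: "inj ax" by (auto simp: inj_def ax_def axis_eq_axis)
  have Bas: "(Basis :: (real^'d) set) = range ax" by (auto simp: Basis_vec_def ax_def)
  have comp: "(\<Sum>b\<in>Basis. h b *\<^sub>R b) $ i = h (ax i)" for h :: "real^'d \<Rightarrow> real" and i
  proof -
    have "(\<Sum>b\<in>Basis. h b *\<^sub>R b) $ i = (\<Sum>b\<in>Basis. h b *\<^sub>R b) \<bullet> ax i" by (simp add: inner_axis ax_def)
    also have "\<dots> = h (ax i)" by (rule inner_sum_left_Basis) (simp add: ax_def)
    finally show ?thesis .
  qed
  have m: "(\<lambda>x. \<Prod>i\<in>UNIV. g i (x $ i)) \<in> borel_measurable (borel :: (real^'d) measure)" by measurable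
  have m2: "(\<lambda>h. \<Sum>b\<in>Basis. h b *\<^sub>R b) \<in> measurable (\<Pi>\<^sub>M b\<in>Basis. lborel) (borel :: (real^'d) measure)"
    by measurable
  have ind: "indicator (cube c s) x *\<^sub>R (\<Prod>i\<in>UNIV. f i (x $ i)) = (\<Prod>i\<in>UNIV. g i (x $ i))" for x
  proof (cases "x \<in> cube c s")
    case True
    then show ?thesis by (simp add: g_def mem_cube)
  next
    case False
    then obtain i where "\<not> (c $ i - s / 2 < x $ i \<and> x $ i < c $ i + s / 2)" by (auto simp: mem_cube)
    then have "g i (x $ i) = 0" by (auto simp: g_def)
    then have "(\<Prod>i\<in>UNIV. g i (x $ i)) = 0" by (intro prod_zero) auto
    then show ?thesis using False by simp
  qed
  have "(\<integral>x. (\<Prod>i\<in>UNIV. f i (x $ i)) \<partial>lebesgue_on (cube c s)) = (\<integral>x. (\<Prod>i\<in>UNIV. g i (x $ i)) \<partial>lebesgue)"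
    by (subst integral_restrict_space) (simp, simp only: ind)
  also have "\<dots> = (\<integral>x. (\<Prod>i\<in>UNIV. g i (x $ i)) \<partial>lborel)"
    using m by (intro integral_completion) simp
  also have "\<dots> = (\<integral>h. (\<Prod>i\<in>UNIV. g i (h (ax i))) \<partial>(\<Pi>\<^sub>M b\<in>Basis. lborel))"
    by (subst lborel_eq, subst integral_distr[OF m2 m]) (simp only: comp)
  also have "\<dots> = (\<integral>h. (\<Prod>b\<in>Basis. g (inv ax b) (h b)) \<partial>(\<Pi>\<^sub>M b\<in>Basis. lborel))"
    unfolding Bas using inj by (simp add: prod.reindex)
  also have "\<dots> = (\<Prod>b\<in>Basis. \<integral>t. g (inv ax b) t \<partial>lborel)"
    using gi by (intro product_integral_prod) auto
  also have "\<dots> = (\<Prod>i\<in>UNIV. \<integral>t. g i t \<partial>lborel)"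
    unfolding Bas using inj by (simp add: prod.reindex)
  also have "\<dots> = (\<Prod>i\<in>UNIV. \<integral>t. g' i t \<partial>lborel)"
    using gg' by (intro prod.cong refl integral_cong_AE) auto
  finally show ?thesis by (simp add: g'_def[abs_def])
qed

definition trig :: "bool \<Rightarrow> nat \<Rightarrow> real \<Rightarrow> real" where
  "trig b k t = (if b then cos (real k * t) else sin (real k * t))"

text \<open>Sends the i-th side onto (0, pi), a half period, so that cosines alone and sines alone
  are each orthogonal and complete there.\<close>

definition cube_angle :: "real^'d \<Rightarrow> real \<Rightarrow> 'd \<Rightarrow> real \<Rightarrow> real" where
  "cube_angle c s i t = pi * (t - (c $ i - s / 2)) / s"

text \<open>The type \<open>\<tau>\<close> is chosen per coordinate because the derivative in
  direction i turns only the i-th cosine into a sine, so gradients live in mixed systems.\<close>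

definition trig_prod :: "real^'d::finite \<Rightarrow> real \<Rightarrow> ('d \<Rightarrow> bool) \<Rightarrow> ('d \<Rightarrow> nat) \<Rightarrow> real^'d \<Rightarrow> real" where
  "trig_prod c s \<tau> k x = (\<Prod>i\<in>UNIV. trig (\<tau> i) (k i) (cube_angle c s i (x $ i)))"

text \<open>The squared norm of one factor over a side; the value 0 belongs to the sine of frequency
  0.\<close>

definition trig_norm :: "real \<Rightarrow> bool \<Rightarrow> nat \<Rightarrow> real" where
  "trig_norm s b k = (if k = 0 then (if b then s else 0) else s / 2)"

lemma trig_le_1: "\<bar>trig b k t\<bar> \<le> 1" by (simp add: trig_def)

lemma trig_prod_le_1: "\<bar>trig_prod c s \<tau> k x\<bar> \<le> 1"
  unfolding trig_prod_def abs_prod by (intro prod_le_1) (auto simp: trig_le_1)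

lemma smooth1_trig_angle: "smooth1 (\<lambda>t. trig b k (cube_angle c s i t))"
proof -
  have "trig b k (cube_angle c s i t) = 1 * (if b then cos else sin)
      (real k * pi * (- (c $ i - s / 2)) / s + (real k * pi / s) * t)" for t
    by (simp add: trig_def cube_angle_def add_divide_distrib diff_divide_distrib algebra_simps)
  moreover have "smooth1 (if b then cos else sin)" by (simp add: smooth1_cos smooth1_sin)
  ultimately show ?thesis by (simp only: smooth1_affine)
qed

lemma smooth_fun_trig_prod: "smooth_fun (trig_prod c s \<tau> k)"
  unfolding trig_prod_def[abs_def] by (intro smooth_fun_prod smooth_fun_coord smooth1_trig_angle)

lemma trig_prod_measurable: "trig_prod c s \<tau> k \<in> borel_measurable (lebesgue_on (cube c' s'))"
  by (intro continuous_measurable_cube smooth_fun_continuous smooth_fun_trig_prod)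

lemma trig_prod_sq_integrable: "sq_integrable (lebesgue_on (cube c' s')) (trig_prod c s \<tau> k)"
  by (rule finite_measure.sq_integrable_bounded[OF finite_measure_cube trig_prod_measurable trig_prod_le_1])

section \<open>Orthogonality and completeness of the trigonometric products\<close>

lemma integral_cos_angle:
  fixes m :: int
  assumes s: "0 < s"
  shows "has_bochner_integral lborel (\<lambda>t. cos (m * (pi * (t - a) / s)) * indicator {a..a + s} t) (if m = 0 then s else 0)"
proof (cases "m = 0")
  case True
  show ?thesis
    using has_bochner_integral_FTC_Icc_real[of a "a + s" "\<lambda>t. t" "\<lambda>t. 1"] s True by simp
next
  case False
  let ?F = "\<lambda>t. sin (m * (pi * (t - a) / s)) * (s / (m * pi))"
  have "has_bochner_integral lborel (\<lambda>t. cos (m * (pi * (t - a) / s)) * indicator {a..a + s} t) (?F (a + s) - ?F a)"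
  proof (rule has_bochner_integral_FTC_Icc_real)
    show "(?F has_real_derivative cos (m * (pi * (t - a) / s))) (at t)" for t
      using s False by (auto intro!: derivative_eq_intros simp: field_simps)
  qed (use s in \<open>auto intro!: continuous_intros\<close>)
  moreover have "?F (a + s) - ?F a = 0"
    using s sin_times_pi_eq_0[of "of_int m"] by simp
  ultimately have "has_bochner_integral lborel (\<lambda>t. cos (m * (pi * (t - a) / s)) * indicator {a..a + s} t) 0"
    by (simp only:)
  then show ?thesis using False by simp
qed

lemma trig_mult:
  "trig b k t * trig b l t = (if b then (cos (real_of_int (int k - int l) * t) + cos (real_of_int (int k + int l) * t)) / 2
     else (cos (real_of_int (int k - int l) * t) - cos (real_of_int (int k + int l) * t)) / 2)"
  by (simp add: trig_def cos_times_cos sin_times_sin left_diff_distrib distrib_right)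

lemma integral_trig_mult:
  fixes c :: "real^'d::finite"
  assumes s: "0 < s"
  shows "(\<integral>t. trig b k (cube_angle c s i t) * trig b l (cube_angle c s i t) * indicator {c $ i - s / 2..c $ i + s / 2} t \<partial>lborel)
    = (if k = l then trig_norm s b k else 0)"
proof -
  define a where "a = c $ i - s / 2"
  have as: "c $ i + s / 2 = a + s" by (simp add: a_def)
  have I: "has_bochner_integral lborel (\<lambda>t. cos (real_of_int m * cube_angle c s i t) * indicator {a..a + s} t)
      (if m = 0 then s else 0)" for m
    using integral_cos_angle[OF s, of m a] by (simp add: cube_angle_def a_def)
  let ?I = "\<lambda>m t. cos (real_of_int m * cube_angle c s i t) * indicator {a..a + s} t"
  have e: "trig b k (cube_angle c s i t) * trig b l (cube_angle c s i t) * indicator {a..a + s} t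
     = (if b then (?I (int k - int l) t + ?I (int k + int l) t) / 2 else (?I (int k - int l) t - ?I (int k + int l) t) / 2)" for t
    unfolding trig_mult by (simp add: field_simps)
  show ?thesis
  proof (cases b)
    case True
    have "has_bochner_integral lborel (\<lambda>t. (?I (int k - int l) t + ?I (int k + int l) t) / 2)
       (((if int k - int l = 0 then s else 0) + (if int k + int l = 0 then s else 0)) / 2)"
      by (intro has_bochner_integral_divide_zero has_bochner_integral_add I)
    then show ?thesis using True unfolding a_def[symmetric] as e
      by (auto simp: has_bochner_integral_iff trig_norm_def)
  next
    case False
    have "has_bochner_integral lborel (\<lambda>t. (?I (int k - int l) t - ?I (int k + int l) t) / 2)
       (((if int k - int l = 0 then s else 0) - (if int k + int l = 0 then s else 0)) / 2)"
      by (intro has_bochner_integral_divide_zero has_bochner_integral_diff I)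
    then show ?thesis using False unfolding a_def[symmetric] as e
      by (auto simp: has_bochner_integral_iff trig_norm_def)
  qed
qed

lemma trig_prod_inner:
  assumes s: "0 < s"
  shows "(\<integral>x. trig_prod c s \<tau> k x * trig_prod c s \<tau> l x \<partial>lebesgue_on (cube c s))
    = (if k = l then \<Prod>i\<in>UNIV. trig_norm s (\<tau> i) (k i) else 0)"
proof -
  have "(\<integral>x. trig_prod c s \<tau> k x * trig_prod c s \<tau> l x \<partial>lebesgue_on (cube c s))
    = (\<integral>x. (\<Prod>i\<in>UNIV. trig (\<tau> i) (k i) (cube_angle c s i (x $ i)) * trig (\<tau> i) (l i) (cube_angle c s i (x $ i)))
        \<partial>lebesgue_on (cube c s))"
    by (simp add: trig_prod_def prod.distrib)
  also have "\<dots> = (\<Prod>i\<in>UNIV. if k i = l i then trig_norm s (\<tau> i) (k i) else 0)"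
    by (subst integral_cube_prod)
      (auto simp: integral_trig_mult[OF s] intro!: smooth1_continuous smooth1_mult smooth1_trig_angle)
  also have "\<dots> = (if k = l then \<Prod>i\<in>UNIV. trig_norm s (\<tau> i) (k i) else 0)"
    by (auto simp: fun_eq_iff intro: prod_zero)
  finally show ?thesis .
qed

text \<open>The cosine product of frequency 0 is the constant 1, so its squared norm is the
  volume.\<close>

lemma measure_cube_pos:
  assumes s: "0 < s"
  shows "0 < measure (lebesgue_on (cube c s)) (cube c s)"
proof -
  interpret finite_measure "lebesgue_on (cube c s)" by (rule finite_measure_cube)
  have "measure (lebesgue_on (cube c s)) (cube c s)
    = (\<integral>x. trig_prod c s (\<lambda>_. True) (\<lambda>_. 0) x * trig_prod c s (\<lambda>_. True) (\<lambda>_. 0) x \<partial>lebesgue_on (cube c s))"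
    by (simp add: trig_prod_def trig_def)
  also have "\<dots> > 0" using s by (subst trig_prod_inner[OF s]) (simp add: trig_norm_def)
  finally show ?thesis .
qed

text \<open>The addition formulas move the i-th frequency up and down by one and preserve the type,
  so the linear span of a fixed type is stable under multiplication by these cosines.\<close>

lemma cos_angle_mult_trig_prod:
  "\<exists>a b k1 k2. \<forall>x. cos (cube_angle c s i (x $ i)) * trig_prod c s \<tau> k x
     = a * trig_prod c s \<tau> k1 x + b * trig_prod c s \<tau> k2 x"
proof -
  let ?rest = "\<lambda>k x. \<Prod>j\<in>UNIV - {i}. trig (\<tau> j) (k j) (cube_angle c s j (x $ j))"
  have split: "trig_prod c s \<tau> k x = trig (\<tau> i) (k i) (cube_angle c s i (x $ i)) * ?rest k x" for k x
    unfolding trig_prod_def by (simp add: prod.remove[of UNIV i])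
  have rest: "?rest (k(i := m)) x = ?rest k x" for m x by (intro prod.cong) auto
  have t: "\<exists>a b m1 m2. \<forall>t. cos t * trig (\<tau> i) (k i) t = a * trig (\<tau> i) m1 t + b * trig (\<tau> i) m2 t"
  proof (cases "k i")
    case 0
    \<comment> \<open>Frequency 0 cannot be lowered: the product is the cosine of frequency 1 in the
      cosine case, and 0, the sine of frequency 0, in the sine case.\<close>
    show ?thesis
      by (rule exI[of _ "1"], rule exI[of _ 0], rule exI[of _ "if \<tau> i then 1 else 0"], rule exI[of _ 0])
        (simp add: 0 trig_def)
  next
    case (Suc m)
    have "cos t * trig (\<tau> i) (k i) t = 1/2 * trig (\<tau> i) m t + 1/2 * trig (\<tau> i) (Suc (Suc m)) t" for t
    proof -
      define u where "u = real (Suc m) * t"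
      have m: "real m * t = u - t" "real (Suc (Suc m)) * t = u + t" by (simp_all add: u_def algebra_simps)
      show ?thesis
        by (cases "\<tau> i", simp_all only: trig_def if_True if_False Suc u_def[symmetric] m)
          (simp_all add: cos_add cos_diff sin_add sin_diff, simp_all add: field_simps)
    qed
    then show ?thesis by blast
  qed
  then obtain a b m1 m2 where "\<And>t. cos t * trig (\<tau> i) (k i) t = a * trig (\<tau> i) m1 t + b * trig (\<tau> i) m2 t" by blast
  then have "cos (cube_angle c s i (x $ i)) * trig_prod c s \<tau> k x
     = a * trig_prod c s \<tau> (k(i := m1)) x + b * trig_prod c s \<tau> (k(i := m2)) x" for x
    unfolding split rest fun_upd_same by (simp add: mult.assoc[symmetric] distrib_right[symmetric])
  then show ?thesis by blast
qed

text \<open>Multiplication by a polynomial in the \<open>cos \<theta>\<^sub>i\<close> maps the span of a system into itself, so the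
  annihilator of the system is invariant under it.\<close>

lemma annihilator_times_polynomial:
  fixes c :: "real^'d::finite" and s :: real
  assumes "real_polynomial_function p"
  defines "M \<equiv> lebesgue_on (cube c s)" and "y \<equiv> \<lambda>x. \<chi> i. cos (cube_angle c s i (x $ i))"
  shows "sq_integrable M f \<Longrightarrow> (\<And>k. (\<integral>x. f x * trig_prod c s \<tau> k x \<partial>M) = 0) \<Longrightarrow>
    sq_integrable M (\<lambda>x. p (y x) * f x) \<and> (\<forall>k. (\<integral>x. p (y x) * f x * trig_prod c s \<tau> k x \<partial>M) = 0)"
  using assms(1)
proof (induction p arbitrary: f rule: real_polynomial_function.induct)
  case (const a)
  then show ?case by (auto intro: sq_integrable_cmult simp: mult.assoc)
next
  case (linear p)
  have ang: "(\<lambda>x. cos (cube_angle c s i (x $ i))) \<in> borel_measurable M" for i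
  proof -
    have "(\<lambda>x. trig True 1 (cube_angle c s i (x $ i))) \<in> borel_measurable M"
      unfolding M_def
      by (intro continuous_measurable_cube smooth_fun_continuous smooth_fun_coord smooth1_trig_angle)
    then show ?thesis by (simp add: trig_def)
  qed
  have cs: "sq_integrable M (\<lambda>x. cos (cube_angle c s i (x $ i)) * f x)" for i
    by (rule sq_integrable_bounded_mult[OF linear(2) ang, where B=1]) simp
  have c0: "(\<integral>x. cos (cube_angle c s i (x $ i)) * f x * trig_prod c s \<tau> k x \<partial>M) = 0" for i k
  proof -
    obtain a b k1 k2 where e: "\<And>x. cos (cube_angle c s i (x $ i)) * trig_prod c s \<tau> k x
       = a * trig_prod c s \<tau> k1 x + b * trig_prod c s \<tau> k2 x" using cos_angle_mult_trig_prod by metis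
    have "(\<integral>x. cos (cube_angle c s i (x $ i)) * f x * trig_prod c s \<tau> k x \<partial>M)
      = (\<integral>x. a * (f x * trig_prod c s \<tau> k1 x) + b * (f x * trig_prod c s \<tau> k2 x) \<partial>M)"
    proof (intro Bochner_Integration.integral_cong refl)
      fix x
      have "cos (cube_angle c s i (x $ i)) * f x * trig_prod c s \<tau> k x
        = f x * (cos (cube_angle c s i (x $ i)) * trig_prod c s \<tau> k x)" by simp
      then show "cos (cube_angle c s i (x $ i)) * f x * trig_prod c s \<tau> k x
        = a * (f x * trig_prod c s \<tau> k1 x) + b * (f x * trig_prod c s \<tau> k2 x)"
        unfolding e by (simp add: algebra_simps)
    qed
    also have "\<dots> = 0"
      using linear(3) sq_integrable_prod[OF linear(2) trig_prod_sq_integrable[of c s c s, folded M_def]] by simp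
    finally show ?thesis .
  qed
  have py: "p (y x) = (\<Sum>i\<in>UNIV. p (axis i 1) * cos (cube_angle c s i (x $ i)))" for x
  proof -
    interpret bounded_linear p by fact
    have "p (y x) = p (\<Sum>i\<in>UNIV. (y x $ i) *\<^sub>R axis i 1)"
      by (subst (1) basis_expansion[symmetric]) (simp add: scalar_mult_eq_scaleR)
    then show ?thesis by (simp add: sum scale y_def mult.commute)
  qed
  have ex: "p (y x) * f x = (\<Sum>i\<in>UNIV. p (axis i 1) * (cos (cube_angle c s i (x $ i)) * f x))" for x
    by (simp add: py sum_distrib_right mult.assoc)
  show ?case
  proof (intro conjI allI)
    show "sq_integrable M (\<lambda>x. p (y x) * f x)" unfolding ex by (intro sq_integrable_sum sq_integrable_cmult cs)
    fix k
    have "(\<integral>x. p (y x) * f x * trig_prod c s \<tau> k x \<partial>M)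
      = (\<integral>x. (\<Sum>i\<in>UNIV. p (axis i 1) * (cos (cube_angle c s i (x $ i)) * f x * trig_prod c s \<tau> k x)) \<partial>M)"
      unfolding ex by (simp add: sum_distrib_right mult.assoc)
    also have "\<dots> = 0"
      using c0 sq_integrable_prod[OF cs trig_prod_sq_integrable[of c s c s, folded M_def]]
      by (subst Bochner_Integration.integral_sum) auto
    finally show "(\<integral>x. p (y x) * f x * trig_prod c s \<tau> k x \<partial>M) = 0" .
  qed
next
  case (add p q)
  have P: "sq_integrable M (\<lambda>x. p (y x) * f x)" "\<And>k. (\<integral>x. p (y x) * f x * trig_prod c s \<tau> k x \<partial>M) = 0"
    using add.IH(1)[OF add.prems] by auto
  have Q: "sq_integrable M (\<lambda>x. q (y x) * f x)" "\<And>k. (\<integral>x. q (y x) * f x * trig_prod c s \<tau> k x \<partial>M) = 0"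
    using add.IH(2)[OF add.prems] by auto
  show ?case
    using sq_integrable_add[OF P(1) Q(1)] P(2) Q(2)
      sq_integrable_prod[OF P(1) trig_prod_sq_integrable[of c s c s, folded M_def]]
      sq_integrable_prod[OF Q(1) trig_prod_sq_integrable[of c s c s, folded M_def]]
    by (simp add: distrib_right)
next
  case (mult p q)
  have Q: "sq_integrable M (\<lambda>x. q (y x) * f x)" "\<And>k. (\<integral>x. q (y x) * f x * trig_prod c s \<tau> k x \<partial>M) = 0"
    using mult.IH(2)[OF mult.prems] by auto
  show ?case using mult.IH(1)[OF Q] by (simp add: mult.assoc)
qed

text \<open>The ideal test function is the sign of \<open>F\<close>, which would give the integral
  of |F|. It is an almost everywhere limit of continuous functions, and dominated convergence
  transfers the orthogonality.\<close>

lemma AE_zero_if_orthogonal_to_continuous: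
  assumes S: "S \<in> lmeasurable" and F: "integrable (lebesgue_on S) F"
    and orth: "\<And>G. continuous_on UNIV G \<Longrightarrow> (\<And>x. \<bar>G x\<bar> \<le> 1) \<Longrightarrow> (\<integral>x. F x * G x \<partial>lebesgue_on S) = 0"
  shows "AE x in lebesgue_on S. F x = (0::real)"
proof -
  let ?M = "lebesgue_on S"
  have Ss: "S \<in> sets lebesgue" using S by (rule fmeasurableD)
  have Fm [measurable]: "F \<in> borel_measurable ?M" using F by simp
  have "(\<lambda>x. sgn (F x)) \<in> borel_measurable ?M" by measurable
  then have "(\<lambda>x. sgn (F x)) measurable_on S" using measurable_on_iff_borel_measurable[OF Ss] by blast
  then obtain N g where N: "negligible N" and g: "\<And>n. continuous_on UNIV (g n)"
    and lim: "\<And>x. x \<notin> N \<Longrightarrow> (\<lambda>n. g n x) \<longlonglongrightarrow> (if x \<in> S then sgn (F x) else 0)"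
    unfolding measurable_on_def by blast
  \<comment> \<open>Clipping to [-1, 1] supplies both the bound demanded of test functions and the
    domination by |F|, without changing the limit.\<close>
  define h where "h n x = max (-1) (min 1 (g n x))" for n x
  have hc: "continuous_on UNIV (h n)" for n unfolding h_def by (intro continuous_intros g)
  have h1: "\<bar>h n x\<bar> \<le> 1" for n x by (auto simp: h_def)
  have hm: "h n \<in> borel_measurable ?M" for n
    using continuous_imp_measurable_on_sets_lebesgue[OF continuous_on_subset[OF hc] Ss] by blast
  have AEN: "AE x in ?M. x \<notin> N"
  proof -
    have "AE x in lebesgue. x \<notin> N" using N by (intro AE_not_in) (simp add: negligible_iff_null_sets)
    then show ?thesis using Ss by (subst AE_restrict_space_iff) (auto elim: eventually_mono)
  qed
  have "(\<lambda>n. \<integral>x. F x * h n x \<partial>?M) \<longlonglongrightarrow> (\<integral>x. \<bar>F x\<bar> \<partial>?M)"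
  proof (rule integral_dominated_convergence)
    show "integrable ?M (\<lambda>x. \<bar>F x\<bar>)" using F by simp
    show "AE x in ?M. (\<lambda>n. F x * h n x) \<longlonglongrightarrow> \<bar>F x\<bar>"
      using AEN AE_space
    proof eventually_elim
      fix x assume x: "x \<notin> N" "x \<in> space ?M"
      then have "(\<lambda>n. g n x) \<longlonglongrightarrow> sgn (F x)" using lim[of x] by simp
      then have "(\<lambda>n. F x * h n x) \<longlonglongrightarrow> F x * max (-1) (min 1 (sgn (F x)))"
        unfolding h_def by (intro tendsto_intros)
      moreover have "F x * max (-1) (min 1 (sgn (F x))) = \<bar>F x\<bar>" by (simp add: sgn_real_def)
      ultimately show "(\<lambda>n. F x * h n x) \<longlonglongrightarrow> \<bar>F x\<bar>" by simp
    qed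
    show "AE x in ?M. norm (F x * h n x) \<le> \<bar>F x\<bar>" for n
      using h1[of n] by (intro AE_I2) (simp add: abs_mult mult_left_le)
    show "(\<lambda>x. F x * h n x) \<in> borel_measurable ?M" for n using hm Fm by (rule borel_measurable_times[rotated])
  qed simp
  then have "(\<integral>x. \<bar>F x\<bar> \<partial>?M) = 0"
    using orth[OF hc h1] by (simp add: LIMSEQ_const_iff)
  then show ?thesis using integral_nonneg_eq_0_iff_AE[of ?M "\<lambda>x. \<bar>F x\<bar>"] F by simp
qed

lemma angle_in_interior:
  assumes "0 < s" "x \<in> cube c s"
  shows "0 < cube_angle c s i (x $ i)" "cube_angle c s i (x $ i) < pi"
proof -
  have "c $ i - s / 2 < x $ i" "x $ i < c $ i + s / 2" using assms(2) by (auto simp: mem_cube)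
  then have u: "0 < (x $ i - (c $ i - s / 2)) / s" "(x $ i - (c $ i - s / 2)) / s < 1"
    using assms(1) by (auto simp: field_simps)
  have "cube_angle c s i (x $ i) = pi * ((x $ i - (c $ i - s / 2)) / s)" by (simp add: cube_angle_def)
  then show "0 < cube_angle c s i (x $ i)" "cube_angle c s i (x $ i) < pi"
    using mult_pos_pos[OF pi_gt_zero u(1)] mult_strict_left_mono[OF u(2) pi_gt_zero] by simp_all
qed

text \<open>The cosines of the angles are injective coordinates on the open cube, with arccos as
  inverse, so every continuous function on the cube is a continuous function of them and is
  approximated by polynomials (Stone-Weierstrass). Since \<open>f\<close> times any such polynomial
  still annihilates the system, \<open>f * W\<close> is orthogonal to all polynomials, where
  \<open>W\<close> is a member of the system that is positive on the cube.\<close>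

lemma trig_prod_complete:
  fixes c :: "real^'d::finite"
  assumes s: "0 < s" and f: "sq_integrable (lebesgue_on (cube c s)) f"
    and orth: "\<And>k. (\<integral>x. f x * trig_prod c s \<tau> k x \<partial>lebesgue_on (cube c s)) = 0"
  shows "AE x in lebesgue_on (cube c s). f x = 0"
proof -
  let ?M = "lebesgue_on (cube c s)"
  interpret finite_measure ?M by (rule finite_measure_cube)
  define y where "y = (\<lambda>x::real^'d. \<chi> i. cos (cube_angle c s i (x $ i)))"
  \<comment> \<open>The lowest nonvanishing member: the constant in cosine coordinates and the first
    sine, positive on (0, pi), in sine coordinates.\<close>
  define W where "W = trig_prod c s \<tau> (\<lambda>i. if \<tau> i then 0 else 1)"
  have W: "0 < W x" if "x \<in> cube c s" for x
    unfolding W_def trig_prod_def using angle_in_interior[OF s that]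
    by (intro prod_pos) (auto simp: trig_def sin_gt_zero)
  have fW: "integrable ?M (\<lambda>x. f x * W x)"
    unfolding W_def by (intro sq_integrable_prod f trig_prod_sq_integrable)
  have poly: "integrable ?M (\<lambda>x. f x * W x * p (y x))" "(\<integral>x. f x * W x * p (y x) \<partial>?M) = 0"
    if "real_polynomial_function p" for p
  proof -
    have A: "sq_integrable ?M (\<lambda>x. p (y x) * f x)" "\<And>k. (\<integral>x. p (y x) * f x * trig_prod c s \<tau> k x \<partial>?M) = 0"
      using annihilator_times_polynomial[OF that f orth] unfolding y_def by (rule conjunct1, rule spec[OF conjunct2])
    have e: "(\<lambda>x. f x * W x * p (y x)) = (\<lambda>x. p (y x) * f x * W x)" by (simp add: fun_eq_iff)
    show "integrable ?M (\<lambda>x. f x * W x * p (y x))"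
      unfolding e unfolding W_def by (rule sq_integrable_prod[OF A(1) trig_prod_sq_integrable])
    show "(\<integral>x. f x * W x * p (y x) \<partial>?M) = 0"
      unfolding e unfolding W_def by (rule A(2))
  qed
  have "AE x in ?M. f x * W x = 0"
  proof (rule AE_zero_if_orthogonal_to_continuous[OF cube_lmeasurable fW])
    fix G :: "real^'d \<Rightarrow> real" assume G: "continuous_on UNIV G" and G1: "\<And>x. \<bar>G x\<bar> \<le> 1"
    \<comment> \<open>\<open>G\<close> expressed in the variables \<open>y\<close>; it is continuous
      on the whole closed box because arccos is continuous on [-1, 1].\<close>
    define H where "H = (\<lambda>z::real^'d. G (\<chi> i. c $ i - s / 2 + s / pi * arccos (z $ i)))"
    have cb: "z \<in> cbox (- One) One \<longleftrightarrow> (\<forall>i. -1 \<le> z $ i \<and> z $ i \<le> 1)" for z :: "real^'d"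
      by (simp add: mem_box_cart)
    have Hc: "continuous_on (cbox (- One) One) H"
      unfolding H_def
      by (rule continuous_on_compose2[OF G]) (auto intro!: continuous_intros simp: cb)
    have HG: "H (y x) = G x" if "x \<in> cube c s" for x
    proof -
      have "(\<chi> i. c $ i - s / 2 + s / pi * arccos (y x $ i)) = x"
        using angle_in_interior[OF s that] s
        by (simp add: vec_eq_iff y_def arccos_cos less_imp_le) (simp add: cube_angle_def)
      then show ?thesis by (simp add: H_def)
    qed
    have Gm: "G \<in> borel_measurable ?M" using G by (rule continuous_measurable_cube)
    have fWG: "integrable ?M (\<lambda>x. f x * W x * G x)"
      using fW by (rule Bochner_Integration.integrable_bound)
        (use fW Gm G1 in \<open>auto simp: abs_mult intro!: mult_left_le borel_measurable_times\<close>)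
    define I where "I = (\<integral>x. \<bar>f x * W x\<bar> \<partial>?M)"
    have I: "0 \<le> I" unfolding I_def by (intro Bochner_Integration.integral_nonneg) simp
    have le: "\<bar>\<integral>x. f x * W x * G x \<partial>?M\<bar> \<le> e * I" if e: "0 < e" for e
    proof -
      obtain p where p: "real_polynomial_function p" "\<And>z. z \<in> cbox (- One) One \<Longrightarrow> \<bar>H z - p z\<bar> < e"
        using Stone_Weierstrass_real_polynomial_function[OF compact_cbox Hc e] by blast
      have "(\<integral>x. f x * W x * G x \<partial>?M) = (\<integral>x. f x * W x * G x - f x * W x * p (y x) \<partial>?M)"
        using fWG poly[OF p(1)] by simp
      also have "\<bar>\<dots>\<bar> \<le> (\<integral>x. \<bar>f x * W x * G x - f x * W x * p (y x)\<bar> \<partial>?M)"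
        by (rule integral_abs_bound)
      also have "\<dots> \<le> (\<integral>x. e * \<bar>f x * W x\<bar> \<partial>?M)"
      proof (rule integral_mono)
        show "integrable ?M (\<lambda>x. \<bar>f x * W x * G x - f x * W x * p (y x)\<bar>)"
          using fWG poly[OF p(1)] by simp
        show "integrable ?M (\<lambda>x. e * \<bar>f x * W x\<bar>)" using fW by simp
        fix x assume "x \<in> space ?M"
        then have x: "x \<in> cube c s" by simp
        have "y x \<in> cbox (- One) One" by (simp add: cb y_def)
        then have "\<bar>G x - p (y x)\<bar> \<le> e" using p(2)[of "y x"] HG[OF x] by simp
        then have "\<bar>f x * W x\<bar> * \<bar>G x - p (y x)\<bar> \<le> \<bar>f x * W x\<bar> * e" by (intro mult_left_mono) auto
        moreover have "f x * W x * G x - f x * W x * p (y x) = f x * W x * (G x - p (y x))"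
          by (simp only: right_diff_distrib)
        ultimately show "\<bar>f x * W x * G x - f x * W x * p (y x)\<bar> \<le> e * \<bar>f x * W x\<bar>"
          by (simp only: abs_mult mult.commute)
      qed
      finally show ?thesis by (simp add: I_def)
    qed
    show "(\<integral>x. f x * W x * G x \<partial>?M) = 0"
    proof (rule ccontr)
      assume "(\<integral>x. f x * W x * G x \<partial>?M) \<noteq> 0"
      define r where "r = \<bar>\<integral>x. f x * W x * G x \<partial>?M\<bar>"
      have pos: "0 < r" using \<open>(\<integral>x. f x * W x * G x \<partial>?M) \<noteq> 0\<close> by (simp add: r_def)
      have "0 < I * r + r * 2" using pos I by (intro add_nonneg_pos) auto
      then have "r / (2 * (I + 1)) * I < r" using pos I by (simp add: field_simps)
      moreover have "r \<le> r / (2 * (I + 1)) * I" using pos I le[of "r / (2 * (I + 1))"] by (simp add: r_def)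
      ultimately show False by simp
    qed
  qed
  then show ?thesis
    using AE_space by eventually_elim (use W in fastforce)
qed

section \<open>Trigonometric coefficients, Bessel and Parseval\<close>

definition freq_box :: "nat \<Rightarrow> ('d::finite \<Rightarrow> nat) set" where
  "freq_box n = {k. \<forall>i. k i < n}"

lemma freq_box_PiE: "freq_box n = PiE UNIV (\<lambda>_. {..<n})"
  by (auto simp: freq_box_def PiE_def)

lemma finite_freq_box: "finite (freq_box n)"
  unfolding freq_box_PiE by (intro finite_PiE) auto

lemma card_freq_box: "card (freq_box n :: ('d::finite \<Rightarrow> nat) set) = n ^ CARD('d)"
  unfolding freq_box_PiE by (subst card_PiE) auto

lemma incseq_freq_box: "incseq freq_box"
  by (auto simp: incseq_def freq_box_def intro: less_le_trans)

lemma UN_freq_box: "(\<Union>n. freq_box n) = (UNIV :: ('d::finite \<Rightarrow> nat) set)"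
proof -
  have "k i < Suc (\<Sum>i\<in>UNIV. k i)" for k :: "'d \<Rightarrow> nat" and i
    by (simp add: less_Suc_eq_le member_le_sum)
  then show ?thesis by (auto simp: freq_box_def)
qed

definition trig_coeff :: "real^'d::finite \<Rightarrow> real \<Rightarrow> ('d \<Rightarrow> bool) \<Rightarrow> (real^'d \<Rightarrow> real) \<Rightarrow> ('d \<Rightarrow> nat) \<Rightarrow> real" where
  "trig_coeff c s \<tau> f k = (\<integral>x. f x * trig_prod c s \<tau> k x \<partial>lebesgue_on (cube c s))"

definition trig_prod_norm :: "real \<Rightarrow> ('d::finite \<Rightarrow> bool) \<Rightarrow> ('d \<Rightarrow> nat) \<Rightarrow> real" where
  "trig_prod_norm s \<tau> k = (\<Prod>i\<in>UNIV. trig_norm s (\<tau> i) (k i))"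

definition trig_sum :: "real^'d::finite \<Rightarrow> real \<Rightarrow> ('d \<Rightarrow> bool) \<Rightarrow> (real^'d \<Rightarrow> real) \<Rightarrow> nat \<Rightarrow> real^'d \<Rightarrow> real" where
  "trig_sum c s \<tau> f n x = (\<Sum>k\<in>freq_box n. trig_coeff c s \<tau> f k / trig_prod_norm s \<tau> k * trig_prod c s \<tau> k x)"

lemma trig_prod_norm_eq:
  "0 < s \<Longrightarrow> (\<integral>x. (trig_prod c s \<tau> k x)\<^sup>2 \<partial>lebesgue_on (cube c s)) = trig_prod_norm s \<tau> k"
  using trig_prod_inner[of s c \<tau> k k] by (simp add: power2_eq_square trig_prod_norm_def)

lemma trig_sum_converges:
  assumes s: "0 < s" and f: "sq_integrable (lebesgue_on (cube c s)) f"
  shows "l2_lim (lebesgue_on (cube c s)) (trig_sum c s \<tau> f) f"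
proof -
  interpret finite_measure "lebesgue_on (cube c s)" by (rule finite_measure_cube)
  have "l2_lim (lebesgue_on (cube c s)) (\<lambda>n x. \<Sum>k\<in>freq_box n.
      (\<integral>x. f x * trig_prod c s \<tau> k x \<partial>lebesgue_on (cube c s)) /
      (\<integral>x. (trig_prod c s \<tau> k x)\<^sup>2 \<partial>lebesgue_on (cube c s)) * trig_prod c s \<tau> k x) f"
    by (rule complete_orthogonal_expansion[OF f])
      (auto simp: trig_prod_sq_integrable trig_prod_inner[OF s] finite_freq_box incseq_freq_box UN_freq_box
        intro: trig_prod_complete[OF s])
  then show ?thesis
    unfolding trig_prod_norm_eq[OF s] trig_sum_def[abs_def] trig_coeff_def .
qed

lemma trig_Bessel:
  assumes s: "0 < s" and f: "sq_integrable (lebesgue_on (cube c s)) f" and B: "finite B"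
  shows "(\<Sum>k\<in>B. (trig_coeff c s \<tau> f k)\<^sup>2 / trig_prod_norm s \<tau> k) \<le> (\<integral>x. (f x)\<^sup>2 \<partial>lebesgue_on (cube c s))"
proof -
  have "(\<integral>x. (f x - (\<Sum>k\<in>B. trig_coeff c s \<tau> f k / trig_prod_norm s \<tau> k * trig_prod c s \<tau> k x))\<^sup>2 \<partial>lebesgue_on (cube c s))
     = (\<integral>x. (f x)\<^sup>2 \<partial>lebesgue_on (cube c s)) - (\<Sum>k\<in>B. (trig_coeff c s \<tau> f k)\<^sup>2 / trig_prod_norm s \<tau> k)"
    unfolding trig_coeff_def trig_prod_norm_eq[OF s, of c, symmetric]
    by (rule Bessel_identity(1)[OF f trig_prod_sq_integrable _ B]) (simp add: trig_prod_inner[OF s])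
  then show ?thesis
    using sq_integral_nonneg[of "lebesgue_on (cube c s)"
      "\<lambda>x. f x - (\<Sum>k\<in>B. trig_coeff c s \<tau> f k / trig_prod_norm s \<tau> k * trig_prod c s \<tau> k x)"] by simp
qed

lemma trig_Parseval:
  assumes s: "0 < s" and f: "sq_integrable (lebesgue_on (cube c s)) f"
  shows "(\<lambda>n. \<Sum>k\<in>freq_box n. (trig_coeff c s \<tau> f k)\<^sup>2 / trig_prod_norm s \<tau> k)
    \<longlonglongrightarrow> (\<integral>x. (f x)\<^sup>2 \<partial>lebesgue_on (cube c s))"
proof -
  let ?M = "lebesgue_on (cube c s)"
  have "(\<integral>x. (f x - trig_sum c s \<tau> f n x)\<^sup>2 \<partial>?M)
     = (\<integral>x. (f x)\<^sup>2 \<partial>?M) - (\<Sum>k\<in>freq_box n. (trig_coeff c s \<tau> f k)\<^sup>2 / trig_prod_norm s \<tau> k)" for n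
    unfolding trig_sum_def trig_coeff_def trig_prod_norm_eq[OF s, of c, symmetric]
    by (rule Bessel_identity(1)[OF f trig_prod_sq_integrable _ finite_freq_box]) (simp add: trig_prod_inner[OF s])
  then have "(\<lambda>n. (\<integral>x. (f x)\<^sup>2 \<partial>?M) - (\<Sum>k\<in>freq_box n. (trig_coeff c s \<tau> f k)\<^sup>2 / trig_prod_norm s \<tau> k)) \<longlonglongrightarrow> 0"
    using trig_sum_converges[OF s f, of \<tau>] by (simp add: l2_lim_def)
  from tendsto_diff[OF tendsto_const[of "\<integral>x. (f x)\<^sup>2 \<partial>?M"] this] show ?thesis by simp
qed

subsection \<open>Weak gradients on a cube\<close>

lemma test_fun_tensor:
  fixes c :: "real^'d::finite"
  assumes g: "\<And>i. smooth1 (g i)" and z: "\<And>i t. t \<le> p i \<or> q i \<le> t \<Longrightarrow> g i t = 0"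
    and p: "\<And>i. c $ i - s / 2 < p i" and q: "\<And>i. q i < c $ i + s / 2"
  shows "test_fun (cube c s) (\<lambda>x. \<Prod>i\<in>UNIV. g i (x $ i))"
proof -
  have sub: "{x. (\<Prod>i\<in>UNIV. g i (x $ i)) \<noteq> 0} \<subseteq> cbox (\<chi> i. p i) (\<chi> i. q i)"
    using z by (auto simp: mem_box_cart) (meson linear)+
  then have cl: "closure {x. (\<Prod>i\<in>UNIV. g i (x $ i)) \<noteq> 0} \<subseteq> cbox (\<chi> i. p i) (\<chi> i. q i)"
    by (rule closure_minimal) (rule closed_cbox)
  have "cbox (\<chi> i. p i) (\<chi> i. q i) \<subseteq> cube c s"
    using less_le_trans[OF p] le_less_trans[OF _ q] by (auto simp: mem_cube mem_box_cart)
  then show ?thesis unfolding test_fun_def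
    using cl g by (auto intro!: smooth_fun_prod smooth_fun_coord
        intro: bounded_subset[OF bounded_cbox] simp: compact_eq_bounded_closed)
qed

text \<open>The condition on the i-th derivative involves the i-th coordinate only: that derivative
  lives near the two faces orthogonal to axis i and ignores the other faces. Hence a factor
  vanishing on those two faces suffices to absorb it.\<close>

definition cutoff_sequence :: "real^'d::finite \<Rightarrow> real \<Rightarrow> (nat \<Rightarrow> real^'d \<Rightarrow> real) \<Rightarrow> (nat \<Rightarrow> real) \<Rightarrow> bool" where
  "cutoff_sequence c s X w \<longleftrightarrow> (\<forall>n. test_fun (cube c s) (X n)) \<and> (\<forall>n x. 0 \<le> X n x \<and> X n x \<le> 1) \<and>
    w \<longlonglongrightarrow> 0 \<and> (\<forall>n. 0 < w n) \<and>
    (\<forall>n x. (\<forall>i. c $ i - s / 2 + w n \<le> x $ i \<and> x $ i \<le> c $ i + s / 2 - w n) \<longrightarrow> X n x = 1) \<and>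
    (\<forall>n x i. c $ i - s / 2 + w n \<le> x $ i \<longrightarrow> x $ i \<le> c $ i + s / 2 - w n \<longrightarrow> pderiv_axis i (X n) x = 0) \<and>
    (\<forall>n x i. \<bar>pderiv_axis i (X n) x\<bar> \<le> 3 / w n)"

lemma cutoff_sequenceD:
  assumes "cutoff_sequence c s X w"
  shows "test_fun (cube c s) (X n)" "0 \<le> X n x" "X n x \<le> 1" "w \<longlonglongrightarrow> 0" "0 < w n"
    "(\<And>i. c $ i - s / 2 + w n \<le> x $ i \<and> x $ i \<le> c $ i + s / 2 - w n) \<Longrightarrow> X n x = 1"
    "c $ i - s / 2 + w n \<le> x $ i \<Longrightarrow> x $ i \<le> c $ i + s / 2 - w n \<Longrightarrow> pderiv_axis i (X n) x = 0"
    "\<bar>pderiv_axis i (X n) x\<bar> \<le> 3 / w n"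
  using assms unfolding cutoff_sequence_def by simp_all

lemma cutoff_sequence_exists:
  fixes c :: "real^'d::finite"
  assumes s: "0 < s"
  obtains X w where "cutoff_sequence c s X w"
proof -
  \<comment> \<open>The factor 4 guarantees that opposite boundary layers stay disjoint for every
    \<open>n\<close>.\<close>
  define w where "w n = s / (4 * (real n + 1))" for n
  have w0: "0 < w n" for n using s by (simp add: w_def)
  have w4: "4 * w n \<le> s" for n using s by (simp add: w_def field_simps)
  have wlim: "w \<longlonglongrightarrow> 0"
  proof -
    have "(\<lambda>n. s / 4 * inverse (real (Suc n))) \<longlonglongrightarrow> s / 4 * 0"
      by (intro tendsto_mult tendsto_const LIMSEQ_inverse_real_of_nat)
    moreover have "(\<lambda>n. s / 4 * inverse (real (Suc n))) = w" by (auto simp: w_def field_simps)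
    ultimately show ?thesis by (simp only: mult_zero_right)
  qed
  \<comment> \<open>The outer half of the layer of width \<open>w n\<close> is reserved for compact
    support and the ramp uses the inner half, whence the slope 3/2 / (w/2) = 3/w.\<close>
  define C where "C n i h h' \<longleftrightarrow> smooth1 h \<and> (\<forall>t. (h has_real_derivative h' t) (at t)) \<and> (\<forall>t. 0 \<le> h t \<and> h t \<le> 1)
      \<and> (\<forall>t. t \<le> c $ i - s / 2 + w n / 2 \<or> c $ i + s / 2 - w n / 2 \<le> t \<longrightarrow> h t = 0)
      \<and> (\<forall>t. c $ i - s / 2 + w n \<le> t \<and> t \<le> c $ i + s / 2 - w n \<longrightarrow> h t = 1 \<and> h' t = 0)
      \<and> (\<forall>t. \<bar>h' t\<bar> \<le> 3 / w n)" for n i h h'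
  have "\<exists>h h'. C n i h h'" for n i
  proof -
    have le: "c $ i - s / 2 + w n / 2 + w n / 2 \<le> c $ i + s / 2 - w n / 2 - w n / 2" and pos: "0 < w n / 2"
      using w4[of n] w0[of n] by simp_all
    obtain h h' where h: "smooth1 h" "\<And>t. (h has_real_derivative h' t) (at t)"
      "\<And>t. 0 \<le> h t" "\<And>t. h t \<le> 1" "\<And>t. t \<le> c $ i - s / 2 + w n / 2 \<or> c $ i + s / 2 - w n / 2 \<le> t \<Longrightarrow> h t = 0"
      "\<And>t. c $ i - s / 2 + w n / 2 + w n / 2 \<le> t \<Longrightarrow> t \<le> c $ i + s / 2 - w n / 2 - w n / 2 \<Longrightarrow> h t = 1"
      "\<And>t. \<bar>h' t\<bar> \<le> 3 / 2 / (w n / 2)"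
      "\<And>t. c $ i - s / 2 + w n / 2 + w n / 2 \<le> t \<Longrightarrow> t \<le> c $ i + s / 2 - w n / 2 - w n / 2 \<Longrightarrow> h' t = 0"
      "\<And>t. t \<le> c $ i - s / 2 + w n / 2 \<or> c $ i + s / 2 - w n / 2 \<le> t \<Longrightarrow> h' t = 0"
      by (rule smooth_cutoff[OF pos le]) (rule that)
    have "h t = 1 \<and> h' t = 0" if "c $ i - s / 2 + w n \<le> t \<and> t \<le> c $ i + s / 2 - w n" for t
      using that h(6)[of t] h(8)[of t] by simp
    moreover have "\<bar>h' t\<bar> \<le> 3 / w n" for t using h(7)[of t] by simp
    ultimately show ?thesis using h(1-5) unfolding C_def by blast
  qed
  then obtain h h' where "\<And>n i. C n i (h n i) (h' n i)" by metis
  then have h: "\<And>n i. smooth1 (h n i)" "\<And>n i t. (h n i has_real_derivative h' n i t) (at t)"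
      "\<And>n i t. 0 \<le> h n i t \<and> h n i t \<le> 1"
      "\<And>n i t. t \<le> c $ i - s / 2 + w n / 2 \<or> c $ i + s / 2 - w n / 2 \<le> t \<Longrightarrow> h n i t = 0"
      "\<And>n i t. c $ i - s / 2 + w n \<le> t \<and> t \<le> c $ i + s / 2 - w n \<Longrightarrow> h n i t = 1 \<and> h' n i t = 0"
      "\<And>n i t. \<bar>h' n i t\<bar> \<le> 3 / w n" unfolding C_def by blast+
  define X where "X n = (\<lambda>x::real^'d. \<Prod>i\<in>UNIV. h n i (x $ i))" for n
  have pd: "pderiv_axis i (X n) x = h' n i (x $ i) * (\<Prod>j\<in>UNIV - {i}. h n j (x $ j))" for n i x
    unfolding X_def by (rule pderiv_prod) (use h in auto)
  have pr: "0 \<le> (\<Prod>j\<in>J. h n j (x $ j))" "(\<Prod>j\<in>J. h n j (x $ j)) \<le> 1" for J n and x :: "real^'d"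
    using h(3) by (auto intro: prod_nonneg prod_le_1)
  show ?thesis
  proof (rule that[of X w], unfold cutoff_sequence_def, intro conjI allI impI)
    show "test_fun (cube c s) (X n)" for n
      unfolding X_def using w0[of n]
      by (intro test_fun_tensor[of "h n" "\<lambda>i. c $ i - s / 2 + w n / 2" "\<lambda>i. c $ i + s / 2 - w n / 2"] h(1,4)) auto
    show "\<And>n x. 0 \<le> X n x" "\<And>n x. X n x \<le> 1" unfolding X_def using pr by blast+
    show "X n x = 1" if "\<forall>i. c $ i - s / 2 + w n \<le> x $ i \<and> x $ i \<le> c $ i + s / 2 - w n" for n x
      unfolding X_def using h(5) that by (simp add: prod.neutral)
    show "pderiv_axis i (X n) x = 0" if "c $ i - s / 2 + w n \<le> x $ i" "x $ i \<le> c $ i + s / 2 - w n" for n x i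
      unfolding pd using h(5) that by simp
    show "\<bar>pderiv_axis i (X n) x\<bar> \<le> 3 / w n" for n x i
    proof -
      have "\<bar>h' n i (x $ i)\<bar> * \<bar>\<Prod>j\<in>UNIV - {i}. h n j (x $ j)\<bar> \<le> 3 / w n * 1"
        using h(6) pr w0[of n] by (intro mult_mono) (auto simp: abs_of_nonneg less_imp_le)
      then show ?thesis by (simp add: pd abs_mult)
    qed
  qed (fact wlim w0)+
qed

lemma eventually_cube_inner:
  fixes c :: "real^'d::finite"
  assumes "w \<longlonglongrightarrow> 0" "x \<in> cube c s"
  shows "\<forall>\<^sub>F n in sequentially. \<forall>i. c $ i - s / 2 + w n \<le> x $ i \<and> x $ i \<le> c $ i + s / 2 - w n"
proof (rule eventually_all_finite)
  fix i
  have "0 < min (x $ i - (c $ i - s / 2)) (c $ i + s / 2 - x $ i)"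
  proof -
    have "c $ i - s / 2 < x $ i" "x $ i < c $ i + s / 2" using assms(2) by (auto simp: mem_cube)
    then show ?thesis by simp
  qed
  from order_tendstoD(2)[OF assms(1) this]
  show "\<forall>\<^sub>F n in sequentially. c $ i - s / 2 + w n \<le> x $ i \<and> x $ i \<le> c $ i + s / 2 - w n"
    by eventually_elim auto
qed

lemma cube_integral_cutoff_limit:
  fixes c :: "real^'d::finite"
  assumes F: "integrable (lebesgue_on (cube c s)) F"
    and X: "cutoff_sequence c s X w"
  shows "(\<lambda>n. \<integral>x. F x * X n x \<partial>lebesgue_on (cube c s)) \<longlonglongrightarrow> (\<integral>x. F x \<partial>lebesgue_on (cube c s))"
proof (rule integral_dominated_convergence)
  have Xm: "X n \<in> borel_measurable (lebesgue_on (cube c s))" for n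
    by (intro continuous_measurable_cube test_fun_props(2)[OF cutoff_sequenceD(1)[OF X]])
  show "(\<lambda>x. F x * X n x) \<in> borel_measurable (lebesgue_on (cube c s))" for n
    using F by (intro borel_measurable_times Xm) auto
  show "integrable (lebesgue_on (cube c s)) (\<lambda>x. \<bar>F x\<bar>)" using F by simp
  show "AE x in lebesgue_on (cube c s). norm (F x * X n x) \<le> \<bar>F x\<bar>" for n
    using cutoff_sequenceD(2,3)[OF X, of n] by (intro AE_I2) (simp add: abs_mult mult_left_le)
  show "AE x in lebesgue_on (cube c s). (\<lambda>n. F x * X n x) \<longlonglongrightarrow> F x"
  proof (rule AE_I2)
    fix x assume "x \<in> space (lebesgue_on (cube c s))"
    then have "x \<in> cube c s" by simp
    from eventually_cube_inner[OF cutoff_sequenceD(4)[OF X] this]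
    have "\<forall>\<^sub>F n in sequentially. F x * X n x = F x" by eventually_elim (use cutoff_sequenceD(6)[OF X] in simp)
    then show "(\<lambda>n. F x * X n x) \<longlonglongrightarrow> F x" by (rule tendsto_eventually)
  qed
qed (use F in auto)

text \<open>Cosine products times cutoffs are test functions. Removing the cutoff in the limit shows
  that \<open>f\<close> annihilates every cosine product, and completeness finishes.\<close>

lemma test_fun_zero_AE:
  fixes c :: "real^'d::finite"
  assumes s: "0 < s" and f: "sq_integrable (lebesgue_on (cube c s)) f"
    and z: "\<And>\<phi>. test_fun (cube c s) \<phi> \<Longrightarrow> (\<integral>x. f x * \<phi> x \<partial>lebesgue_on (cube c s)) = 0"
  shows "AE x in lebesgue_on (cube c s). f x = 0"
proof (rule trig_prod_complete[OF s f])
  fix k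
  let ?e = "trig_prod c s (\<lambda>_. True) k"
  obtain X w where X: "cutoff_sequence c s X w" using cutoff_sequence_exists[OF s] by blast
  have "(\<lambda>n. \<integral>x. f x * ?e x * X n x \<partial>lebesgue_on (cube c s)) \<longlonglongrightarrow> (\<integral>x. f x * ?e x \<partial>lebesgue_on (cube c s))"
    by (intro cube_integral_cutoff_limit[OF _ X] sq_integrable_prod f trig_prod_sq_integrable)
  moreover have "(\<integral>x. f x * ?e x * X n x \<partial>lebesgue_on (cube c s)) = 0" for n
    using z[OF test_fun_mult[OF cutoff_sequenceD(1)[OF X, of n] smooth_fun_trig_prod[of c s "\<lambda>_. True" k]]] by (simp add: mult.assoc)
  ultimately show "(\<integral>x. f x * ?e x \<partial>lebesgue_on (cube c s)) = 0" by (simp add: LIMSEQ_const_iff)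
qed

section \<open>Uniqueness and calculus of weak gradients\<close>

lemma weak_gradD:
  assumes "weak_grad S u g"
  shows "sq_integrable (lebesgue_on S) (\<lambda>x. g x $ i)"
    and "test_fun S \<phi> \<Longrightarrow> (\<integral>x. u x * pderiv_axis i \<phi> x \<partial>lebesgue_on S) = - (\<integral>x. g x $ i * \<phi> x \<partial>lebesgue_on S)"
  using assms by (auto simp: weak_grad_def L2_eq)

text \<open>Allows the arbitrary representative chosen by \<open>wgrad\<close> to be exchanged for
  any weak gradient at hand.\<close>

lemma weak_grad_unique:
  fixes c :: "real^'d::finite"
  assumes s: "0 < s" and g: "weak_grad (cube c s) u g" "weak_grad (cube c s) u h"
  shows "AE x in lebesgue_on (cube c s). g x = h x"
proof -
  let ?M = "lebesgue_on (cube c s)"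
  have "AE x in ?M. g x $ i - h x $ i = 0" for i
  proof (rule test_fun_zero_AE[OF s])
    have G: "sq_integrable ?M (\<lambda>x. g x $ i)" and H: "sq_integrable ?M (\<lambda>x. h x $ i)"
      using g by (auto simp: weak_grad_def L2_eq)
    show "sq_integrable ?M (\<lambda>x. g x $ i - h x $ i)" using G H by (rule sq_integrable_diff)
    fix \<phi> :: "real^'d \<Rightarrow> real" assume \<phi>: "test_fun (cube c s) \<phi>"
    then obtain B where "\<And>x. \<bar>\<phi> x\<bar> \<le> B" using test_fun_props(6) by blast
    then have P: "sq_integrable ?M \<phi>"
      by (intro finite_measure.sq_integrable_bounded[OF finite_measure_cube] continuous_measurable_cube test_fun_props(2)[OF \<phi>])
    have "(\<integral>x. g x $ i * \<phi> x \<partial>?M) = (\<integral>x. h x $ i * \<phi> x \<partial>?M)"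
      using weak_gradD(2)[OF g(1) \<phi>, of i] weak_gradD(2)[OF g(2) \<phi>, of i] by simp
    then show "(\<integral>x. (g x $ i - h x $ i) * \<phi> x \<partial>?M) = 0"
      using sq_integrable_prod[OF G P] sq_integrable_prod[OF H P] by (simp add: left_diff_distrib)
  qed
  then have "AE x in ?M. \<forall>i. g x $ i - h x $ i = 0" by (rule AE_finite_allI[OF finite_class.finite_UNIV, simplified])
  then show ?thesis by eventually_elim (simp add: vec_eq_iff)
qed

lemma test_fun_pderiv_sq_integrable:
  assumes "test_fun (cube c s) \<phi>"
  shows "sq_integrable (lebesgue_on (cube c t)) (pderiv_axis i \<phi>)" "sq_integrable (lebesgue_on (cube c t)) \<phi>"
proof -
  obtain B where "\<And>x. \<bar>pderiv_axis i \<phi> x\<bar> \<le> B" using test_fun_props(7)[OF assms] by blast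
  then show "sq_integrable (lebesgue_on (cube c t)) (pderiv_axis i \<phi>)"
    by (intro finite_measure.sq_integrable_bounded[OF finite_measure_cube] continuous_measurable_cube test_fun_props(3)[OF assms])
  obtain B where "\<And>x. \<bar>\<phi> x\<bar> \<le> B" using test_fun_props(6)[OF assms] by blast
  then show "sq_integrable (lebesgue_on (cube c t)) \<phi>"
    by (intro finite_measure.sq_integrable_bounded[OF finite_measure_cube] continuous_measurable_cube test_fun_props(2)[OF assms])
qed

lemma weak_grad_add:
  fixes c :: "real^'d::finite"
  assumes u: "sq_integrable (lebesgue_on (cube c s)) u" "weak_grad (cube c s) u g"
    and v: "sq_integrable (lebesgue_on (cube c s)) v" "weak_grad (cube c s) v h"
  shows "weak_grad (cube c s) (\<lambda>x. u x + v x) (\<lambda>x. g x + h x)"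
  unfolding weak_grad_def L2_eq
proof (intro conjI allI impI)
  note G = weak_gradD(1)[OF u(2)] and H = weak_gradD(1)[OF v(2)]
  show "sq_integrable (lebesgue_on (cube c s)) (\<lambda>x. (g x + h x) $ i)" for i
    using sq_integrable_add[OF G H] by simp
  fix \<phi> :: "real^'d \<Rightarrow> real" and i assume \<phi>: "test_fun (cube c s) \<phi>"
  note P = test_fun_pderiv_sq_integrable[OF \<phi>, of s]
  show "(\<integral>x. (u x + v x) * pderiv_axis i \<phi> x \<partial>lebesgue_on (cube c s)) = - (\<integral>x. (g x + h x) $ i * \<phi> x \<partial>lebesgue_on (cube c s))"
    using sq_integrable_prod[OF u(1) P(1)] sq_integrable_prod[OF v(1) P(1)] sq_integrable_prod[OF G P(2)] sq_integrable_prod[OF H P(2)]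
      weak_gradD(2)[OF u(2) \<phi>, of i] weak_gradD(2)[OF v(2) \<phi>, of i]
    by (simp add: distrib_right)
qed

lemma weak_grad_cmult:
  assumes "weak_grad S u g"
  shows "weak_grad S (\<lambda>x. a * u x) (\<lambda>x. a *\<^sub>R g x)"
  using assms unfolding weak_grad_def L2_eq
  by (auto intro: sq_integrable_cmult simp: mult.assoc)

lemma weak_grad_diff:
  fixes c :: "real^'d::finite"
  assumes "sq_integrable (lebesgue_on (cube c s)) u" "weak_grad (cube c s) u g"
    and "sq_integrable (lebesgue_on (cube c s)) v" "weak_grad (cube c s) v h"
  shows "weak_grad (cube c s) (\<lambda>x. u x - v x) (\<lambda>x. g x - h x)"
  using weak_grad_add[OF assms(1,2) sq_integrable_cmult[OF assms(3), of "-1"] weak_grad_cmult[OF assms(4), of "-1"]] by simp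

lemma weak_grad_zero: "weak_grad S (\<lambda>x. 0) (\<lambda>x. 0)"
  by (simp add: weak_grad_def L2_eq)

lemma weak_grad_sum:
  fixes c :: "real^'d::finite"
  assumes "\<And>i. i \<in> I \<Longrightarrow> sq_integrable (lebesgue_on (cube c s)) (u i)"
    and "\<And>i. i \<in> I \<Longrightarrow> weak_grad (cube c s) (u i) (g i)"
  shows "weak_grad (cube c s) (\<lambda>x. \<Sum>i\<in>I. u i x) (\<lambda>x. \<Sum>i\<in>I. g i x)"
  using assms
proof (induction I rule: infinite_finite_induct)
  case (insert i I)
  have "weak_grad (cube c s) (\<lambda>x. u i x + (\<Sum>i\<in>I. u i x)) (\<lambda>x. g i x + (\<Sum>i\<in>I. g i x))"
    using insert by (intro weak_grad_add sq_integrable_sum) auto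
  then show ?case using insert by simp
qed (auto intro: weak_grad_zero)

lemma integral_lebesgue_on_subset:
  fixes f :: "'a::euclidean_space \<Rightarrow> real"
  assumes "S \<subseteq> T" "S \<in> sets lebesgue" "T \<in> sets lebesgue" "\<And>x. x \<notin> S \<Longrightarrow> f x = 0"
  shows "(\<integral>x. f x \<partial>lebesgue_on S) = (\<integral>x. f x \<partial>lebesgue_on T)"
proof -
  have "indicator S x *\<^sub>R f x = indicator T x *\<^sub>R f x" for x
    using assms(1) assms(4)[of x] by (auto simp: indicator_def)
  then show ?thesis using assms(2,3) by (simp only: integral_restrict_space sets.Int_space_eq2)
qed

lemma sq_integrable_subset:
  assumes "sq_integrable (lebesgue_on T) f" "S \<subseteq> T" "S \<in> sets lebesgue" "T \<in> sets lebesgue"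
  shows "sq_integrable (lebesgue_on S) f"
  unfolding sq_integrable_def
proof
  show "f \<in> borel_measurable (lebesgue_on S)"
    by (rule measurable_restrict_mono[OF sq_integrable_measurable[OF assms(1)] assms(2)])
  have "integrable lebesgue (\<lambda>x. indicator T x *\<^sub>R (f x)\<^sup>2)"
    using assms by (simp add: sq_integrable_def integrable_restrict_space)
  from integrable_mult_indicator[OF assms(3) this]
  moreover have "(\<lambda>x. indicator S x *\<^sub>R (indicator T x *\<^sub>R (f x)\<^sup>2)) = (\<lambda>x. indicator S x *\<^sub>R (f x)\<^sup>2)"
    using assms(2) by (auto simp: indicator_def fun_eq_iff)
  ultimately have "integrable lebesgue (\<lambda>x. indicator S x *\<^sub>R (f x)\<^sup>2)" by (simp only:)
  then show "integrable (lebesgue_on S) (\<lambda>x. (f x)\<^sup>2)"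
    using assms(3) by (simp add: integrable_restrict_space)
qed

lemma weak_grad_subset:
  fixes u :: "real^'d::finite \<Rightarrow> real"
  assumes g: "weak_grad T u g" and "S \<subseteq> T" "S \<in> sets lebesgue" "T \<in> sets lebesgue"
  shows "weak_grad S u g"
  unfolding weak_grad_def L2_eq
proof (intro conjI allI impI)
  show "sq_integrable (lebesgue_on S) (\<lambda>x. g x $ i)" for i
    using weak_gradD(1)[OF g] assms(2-4) by (rule sq_integrable_subset)
  fix \<phi> :: "real^'d \<Rightarrow> real" and i assume \<phi>: "test_fun S \<phi>"
  have "(\<integral>x. u x * pderiv_axis i \<phi> x \<partial>lebesgue_on S) = (\<integral>x. u x * pderiv_axis i \<phi> x \<partial>lebesgue_on T)"
    by (rule integral_lebesgue_on_subset) (use assms test_fun_props(5)[OF \<phi>] in auto)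
  moreover have "(\<integral>x. g x $ i * \<phi> x \<partial>lebesgue_on S) = (\<integral>x. g x $ i * \<phi> x \<partial>lebesgue_on T)"
    by (rule integral_lebesgue_on_subset) (use assms test_fun_props(4)[OF \<phi>] in auto)
  ultimately show "(\<integral>x. u x * pderiv_axis i \<phi> x \<partial>lebesgue_on S) = - (\<integral>x. g x $ i * \<phi> x \<partial>lebesgue_on S)"
    using weak_gradD(2)[OF g test_fun_subset[OF \<phi> assms(2)], of i] by simp
qed

text \<open>Translation invariance makes the integral of every difference quotient vanish.\<close>

lemma integral_pderiv_test_fun:
  fixes c :: "real^'d::finite"
  assumes \<phi>: "test_fun (cube c s) \<phi>"
  shows "(\<integral>x. pderiv_axis i \<phi> x \<partial>lebesgue_on (cube c s)) = 0"
proof -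
  let ?a = "axis i 1 :: real^'d"
  have sm: "smooth_fun \<phi>" by (rule test_fun_props(1)[OF \<phi>])
  have [measurable]: "\<phi> \<in> borel_measurable borel" "pderiv_axis i \<phi> \<in> borel_measurable borel"
    by (intro borel_measurable_continuous_onI test_fun_props[OF \<phi>])+
  obtain B where B: "\<And>x. \<bar>pderiv_axis i \<phi> x\<bar> \<le> B" using test_fun_props(7)[OF \<phi>] by blast
  obtain B' where B': "\<And>x. \<bar>\<phi> x\<bar> \<le> B'" using test_fun_props(6)[OF \<phi>] by blast
  obtain R where R: "\<And>x. x \<in> cube c s \<Longrightarrow> norm x \<le> R" using bounded_cube[of c s] unfolding bounded_iff by blast
  define h where "h n = inverse (real (Suc n))" for n
  have h: "0 < h n" "h n \<le> 1" for n by (auto simp: h_def field_simps)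
  define D where "D n x = (\<phi> (x + h n *\<^sub>R ?a) - \<phi> x) / h n" for n x
  have Dm [measurable]: "D n \<in> borel_measurable borel" for n unfolding D_def by measurable
  have int: "integrable lborel \<phi>"
  proof (rule Bochner_Integration.integrable_bound[of _ "\<lambda>x. B' * indicator (cube c s) x"])
    show "integrable lborel (\<lambda>x. B' * indicator (cube c s) x)"
      by (intro integrable_mult_right integrable_real_indicator)
        (auto simp: cube_def intro: emeasure_lborel_box_finite[unfolded infinity_ennreal_def])
    show "AE x in lborel. norm (\<phi> x) \<le> norm (B' * indicator (cube c s) x)"
    proof (rule AE_I2)
      fix x show "norm (\<phi> x) \<le> norm (B' * indicator (cube c s) x)"
        using B'[of x] test_fun_props(4)[OF \<phi>, of x] by (cases "x \<in> cube c s") auto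
    qed
  qed simp
  have tr: "integrable lborel (\<lambda>x. \<phi> (x + y))" "(\<integral>x. \<phi> (x + y) \<partial>lborel) = (\<integral>x. \<phi> x \<partial>lborel)" for y
  proof -
    have e: "(\<lambda>x. \<phi> (x + y)) = (\<lambda>x. \<phi> (y + x))" by (simp add: add.commute)
    show "integrable lborel (\<lambda>x. \<phi> (x + y))" unfolding e
      using int integrable_distr_eq[of "(+) y" lborel borel \<phi>] lborel_distr_plus[of y] by simp
    show "(\<integral>x. \<phi> (x + y) \<partial>lborel) = (\<integral>x. \<phi> x \<partial>lborel)" unfolding e
      using integral_distr[of "(+) y" lborel borel \<phi>] lborel_distr_plus[of y] by simp
  qed
  have D0: "(\<integral>x. D n x \<partial>lborel) = 0" for n
    using tr[of "h n *\<^sub>R ?a"] int unfolding D_def by simp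
  \<comment> \<open>The difference quotients are dominated: by the mean value theorem each is a
    value of the derivative at a point less than 1 away, hence at most \<open>B\<close>, and 0
    outside the ball of radius \<open>R + 1\<close>.\<close>
  have "(\<lambda>n. \<integral>x. D n x \<partial>lborel) \<longlonglongrightarrow> (\<integral>x. pderiv_axis i \<phi> x \<partial>lborel)"
  proof (rule integral_dominated_convergence[where w="\<lambda>x. B * indicator (cball 0 (R + 1)) x"])
    show "integrable lborel (\<lambda>x. B * indicator (cball 0 (R + 1)) x)"
      by (intro integrable_mult_right integrable_real_indicator) (auto intro: emeasure_lborel_cball_finite[unfolded infinity_ennreal_def])
    show "AE x in lborel. (\<lambda>n. D n x) \<longlonglongrightarrow> pderiv_axis i \<phi> x"
    proof (rule AE_I2)
      fix x
      have "((\<lambda>t. (\<phi> (x + (0 + t) *\<^sub>R ?a) - \<phi> (x + 0 *\<^sub>R ?a)) / t) \<longlongrightarrow> pderiv_axis i \<phi> x) (at 0)"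
        using smooth_fun_has_pderiv[OF sm, of x i] unfolding DERIV_def .
      moreover have "filterlim h (at 0) sequentially"
        unfolding filterlim_at h_def using LIMSEQ_inverse_real_of_nat by simp
      ultimately have "(\<lambda>n. (\<phi> (x + (0 + h n) *\<^sub>R ?a) - \<phi> (x + 0 *\<^sub>R ?a)) / h n) \<longlonglongrightarrow> pderiv_axis i \<phi> x"
        by (rule filterlim_compose)
      then show "(\<lambda>n. D n x) \<longlonglongrightarrow> pderiv_axis i \<phi> x" by (simp add: D_def)
    qed
    show "AE x in lborel. norm (D n x) \<le> B * indicator (cball 0 (R + 1)) x" for n
    proof (rule AE_I2)
      fix x
      have "\<exists>z>0. z < h n \<and> \<phi> (x + h n *\<^sub>R ?a) - \<phi> (x + 0 *\<^sub>R ?a) = (h n - 0) * pderiv_axis i \<phi> (x + z *\<^sub>R ?a)"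
        by (rule MVT2[OF h(1)]) (rule smooth_fun_has_pderiv_at[OF sm])
      then obtain z where z: "0 < z" "z < h n" "D n x = pderiv_axis i \<phi> (x + z *\<^sub>R ?a)"
        using h(1)[of n] by (auto simp: D_def)
      show "norm (D n x) \<le> B * indicator (cball 0 (R + 1)) x"
      proof (cases "norm x \<le> R + 1")
        case True
        then show ?thesis using B z(3) by simp
      next
        case False
        have "norm x \<le> norm (x + z *\<^sub>R ?a) + norm (z *\<^sub>R ?a)"
          using norm_triangle_ineq4[of "x + z *\<^sub>R ?a" "z *\<^sub>R ?a"] by simp
        then have "norm (x + z *\<^sub>R ?a) > R" using False z h(2)[of n] by (simp add: norm_axis_1)
        then have "x + z *\<^sub>R ?a \<notin> cube c s" using R by force
        then show ?thesis using test_fun_props(5)[OF \<phi>] z(3) False by simp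
      qed
    qed
  qed simp_all
  then have "(\<integral>x. pderiv_axis i \<phi> x \<partial>lborel) = 0" using D0 by (simp add: LIMSEQ_const_iff)
  moreover have "(\<integral>x. pderiv_axis i \<phi> x \<partial>lborel) = (\<integral>x. pderiv_axis i \<phi> x \<partial>lebesgue)"
    by (rule integral_completion[symmetric]) simp
  moreover have "(\<integral>x. pderiv_axis i \<phi> x \<partial>lebesgue_on (cube c s)) = (\<integral>x. pderiv_axis i \<phi> x \<partial>lebesgue_on UNIV)"
    by (rule integral_lebesgue_on_subset) (use test_fun_props(5)[OF \<phi>] in auto)
  ultimately show ?thesis by (simp add: lebesgue_on_UNIV_eq)
qed

lemma weak_grad_const: "weak_grad (cube c s) (\<lambda>x. a) (\<lambda>x. 0)"
  using integral_pderiv_test_fun by (auto simp: weak_grad_def L2_eq)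

lemma weak_grad_limit:
  fixes c :: "real^'d::finite"
  assumes g: "\<And>n. weak_grad (cube c s) (u n) (g n)" and u: "l2_lim (lebesgue_on (cube c s)) u U"
    and G: "\<And>i. l2_lim (lebesgue_on (cube c s)) (\<lambda>n x. g n x $ i) (\<lambda>x. G x $ i)"
  shows "weak_grad (cube c s) U G"
  unfolding weak_grad_def L2_eq
proof (intro conjI allI impI)
  let ?M = "lebesgue_on (cube c s)"
  show "sq_integrable ?M (\<lambda>x. G x $ i)" for i using l2_lim_sq_integrable(2)[OF G] .
  fix \<phi> :: "real^'d \<Rightarrow> real" and i assume \<phi>: "test_fun (cube c s) \<phi>"
  note P = test_fun_pderiv_sq_integrable[OF \<phi>, of s]
  have "(\<lambda>n. \<integral>x. pderiv_axis i \<phi> x * u n x \<partial>?M) \<longlonglongrightarrow> (\<integral>x. pderiv_axis i \<phi> x * U x \<partial>?M)"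
    by (rule l2_lim_inner_right[OF u P(1)])
  moreover have "(\<lambda>n. - (\<integral>x. \<phi> x * g n x $ i \<partial>?M)) \<longlonglongrightarrow> - (\<integral>x. \<phi> x * G x $ i \<partial>?M)"
    by (intro tendsto_minus l2_lim_inner_right[OF G P(2)])
  moreover have "(\<integral>x. pderiv_axis i \<phi> x * u n x \<partial>?M) = - (\<integral>x. \<phi> x * g n x $ i \<partial>?M)" for n
    using weak_gradD(2)[OF g \<phi>, of n i] by (simp add: mult.commute)
  ultimately have "(\<integral>x. pderiv_axis i \<phi> x * U x \<partial>?M) = - (\<integral>x. \<phi> x * G x $ i \<partial>?M)"
    using LIMSEQ_unique by simp
  then show "(\<integral>x. U x * pderiv_axis i \<phi> x \<partial>?M) = - (\<integral>x. G x $ i * \<phi> x \<partial>?M)" by (simp add: mult.commute)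
qed

text \<open>The cutoff gradient is of size \<open>1/w\<close>, but only at distance \<open>\<le> w\<close> from the faces where the
  factor \<open>\<Phi>\<close> is of size \<open>w\<close>; so the boundary term stays bounded and tends to 0 pointwise.\<close>

lemma weak_grad_vanishing_on_faces:
  fixes c :: "real^'d::finite"
  assumes s: "0 < s" and u: "sq_integrable (lebesgue_on (cube c s)) u" and g: "weak_grad (cube c s) u g"
    and \<Phi>: "smooth_fun \<Phi>" and B: "\<And>x. \<bar>\<Phi> x\<bar> \<le> B" "\<And>x. \<bar>pderiv_axis i \<Phi> x\<bar> \<le> B"
    and face: "\<And>x. x \<in> cube c s \<Longrightarrow> \<bar>\<Phi> x\<bar> \<le> B * (x $ i - (c $ i - s / 2)) \<and> \<bar>\<Phi> x\<bar> \<le> B * (c $ i + s / 2 - x $ i)"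
  shows "(\<integral>x. u x * pderiv_axis i \<Phi> x \<partial>lebesgue_on (cube c s)) = - (\<integral>x. g x $ i * \<Phi> x \<partial>lebesgue_on (cube c s))"
proof -
  let ?M = "lebesgue_on (cube c s)"
  interpret finite_measure ?M by (rule finite_measure_cube)
  obtain X w where X0: "cutoff_sequence c s X w" using cutoff_sequence_exists[OF s] by blast
  note X = cutoff_sequenceD(1-4)[OF X0] and w = cutoff_sequenceD(5)[OF X0] and Xd = cutoff_sequenceD(7,8)[OF X0]
  have B0: "0 \<le> B" using B(1)[of c] by simp
  have \<Phi>m: "\<Phi> \<in> borel_measurable ?M" "pderiv_axis i \<Phi> \<in> borel_measurable ?M"
    by (intro continuous_measurable_cube smooth_fun_continuous smooth_fun_pderiv \<Phi>)+
  have \<Phi>s: "sq_integrable ?M \<Phi>" "sq_integrable ?M (pderiv_axis i \<Phi>)"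
    using sq_integrable_bounded[OF \<Phi>m(1) B(1)] sq_integrable_bounded[OF \<Phi>m(2) B(2)] by auto
  have lim1: "(\<lambda>n. \<integral>x. u x * pderiv_axis i \<Phi> x * X n x \<partial>?M) \<longlonglongrightarrow> (\<integral>x. u x * pderiv_axis i \<Phi> x \<partial>?M)"
    by (intro cube_integral_cutoff_limit[OF _ X0] sq_integrable_prod u \<Phi>s)
  have lim2: "(\<lambda>n. \<integral>x. g x $ i * \<Phi> x * X n x \<partial>?M) \<longlonglongrightarrow> (\<integral>x. g x $ i * \<Phi> x \<partial>?M)"
    by (intro cube_integral_cutoff_limit[OF _ X0] sq_integrable_prod weak_gradD(1)[OF g] \<Phi>s)
  have Xdm: "pderiv_axis i (X n) \<in> borel_measurable ?M" for n
    by (intro continuous_measurable_cube test_fun_props(3)[OF X(1)])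
  have um: "u \<in> borel_measurable ?M" using u by (rule sq_integrable_measurable)
  have bd: "\<bar>\<Phi> x * pderiv_axis i (X n) x\<bar> \<le> 3 * B" if x: "x \<in> cube c s" for n x
  proof (cases "c $ i - s / 2 + w n \<le> x $ i \<and> x $ i \<le> c $ i + s / 2 - w n")
    case True
    then show ?thesis using Xd(1) B0 by simp
  next
    case False
    then have "x $ i - (c $ i - s / 2) \<le> w n \<or> c $ i + s / 2 - x $ i \<le> w n" by auto
    then have "\<bar>\<Phi> x\<bar> \<le> B * w n" using face[OF x] B0 by (meson mult_left_mono order_trans)
    then have "\<bar>\<Phi> x\<bar> * \<bar>pderiv_axis i (X n) x\<bar> \<le> (B * w n) * (3 / w n)"
      using Xd(2) B0 w[of n] by (intro mult_mono) auto
    then show ?thesis using w[of n] by (simp add: abs_mult)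
  qed
  have lim3: "(\<lambda>n. \<integral>x. u x * (\<Phi> x * pderiv_axis i (X n) x) \<partial>?M) \<longlonglongrightarrow> (\<integral>x. 0 \<partial>?M)"
  proof (rule integral_dominated_convergence[where w="\<lambda>x. 3 * B * \<bar>u x\<bar>"])
    show "integrable ?M (\<lambda>x. 3 * B * \<bar>u x\<bar>)" using sq_integrable_integrable[OF u] by simp
    show "(\<lambda>x. u x * (\<Phi> x * pderiv_axis i (X n) x)) \<in> borel_measurable ?M" for n
      by (intro borel_measurable_times um \<Phi>m Xdm)
    show "AE x in ?M. norm (u x * (\<Phi> x * pderiv_axis i (X n) x)) \<le> 3 * B * \<bar>u x\<bar>" for n
    proof (rule AE_I2)
      fix x assume "x \<in> space ?M"
      then have "\<bar>\<Phi> x * pderiv_axis i (X n) x\<bar> \<le> 3 * B" using bd by simp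
      then have "\<bar>u x\<bar> * \<bar>\<Phi> x * pderiv_axis i (X n) x\<bar> \<le> \<bar>u x\<bar> * (3 * B)" by (rule mult_left_mono) simp
      then show "norm (u x * (\<Phi> x * pderiv_axis i (X n) x)) \<le> 3 * B * \<bar>u x\<bar>" by (simp add: abs_mult mult_ac)
    qed
    show "AE x in ?M. (\<lambda>n. u x * (\<Phi> x * pderiv_axis i (X n) x)) \<longlonglongrightarrow> 0"
    proof (rule AE_I2)
      fix x assume "x \<in> space ?M"
      then have "x \<in> cube c s" by simp
      from eventually_cube_inner[OF X(4) this]
      have "\<forall>\<^sub>F n in sequentially. u x * (\<Phi> x * pderiv_axis i (X n) x) = 0"
        by eventually_elim (use Xd(1) in simp)
      then show "(\<lambda>n. u x * (\<Phi> x * pderiv_axis i (X n) x)) \<longlonglongrightarrow> 0" by (rule tendsto_eventually)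
    qed
  qed simp
  have eq: "(\<integral>x. u x * pderiv_axis i \<Phi> x * X n x \<partial>?M) + (\<integral>x. u x * (\<Phi> x * pderiv_axis i (X n) x) \<partial>?M)
     = - (\<integral>x. g x $ i * \<Phi> x * X n x \<partial>?M)" for n
  proof -
    have s1: "sq_integrable ?M (\<lambda>x. X n x * pderiv_axis i \<Phi> x)"
      by (rule sq_integrable_bounded_mult[OF \<Phi>s(2), where B=1])
        (use X in \<open>auto intro: continuous_measurable_cube test_fun_props(2)\<close>)
    have s2: "sq_integrable ?M (\<lambda>x. \<Phi> x * pderiv_axis i (X n) x)"
      using bd by (intro sq_integrable_bounded[where B="3 * B"] borel_measurable_times \<Phi>m Xdm) auto
    have "pderiv_axis i (\<lambda>x. \<Phi> x * X n x) x = X n x * pderiv_axis i \<Phi> x + \<Phi> x * pderiv_axis i (X n) x" for x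
      by (simp add: pderiv_mult[OF \<Phi> test_fun_props(1)[OF X(1)]])
    then have "(\<integral>x. u x * (X n x * pderiv_axis i \<Phi> x + \<Phi> x * pderiv_axis i (X n) x) \<partial>?M) = - (\<integral>x. g x $ i * (\<Phi> x * X n x) \<partial>?M)"
      using weak_gradD(2)[OF g test_fun_mult[OF X(1) \<Phi>], of i n] by simp
    moreover have "(\<integral>x. u x * (X n x * pderiv_axis i \<Phi> x + \<Phi> x * pderiv_axis i (X n) x) \<partial>?M)
      = (\<integral>x. u x * (X n x * pderiv_axis i \<Phi> x) \<partial>?M) + (\<integral>x. u x * (\<Phi> x * pderiv_axis i (X n) x) \<partial>?M)"
      using sq_integrable_prod[OF u s1] sq_integrable_prod[OF u s2] by (simp add: distrib_left)
    ultimately show ?thesis by (simp add: mult_ac)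
  qed
  have "(\<lambda>n. (\<integral>x. u x * pderiv_axis i \<Phi> x * X n x \<partial>?M) + (\<integral>x. u x * (\<Phi> x * pderiv_axis i (X n) x) \<partial>?M))
      \<longlonglongrightarrow> (\<integral>x. u x * pderiv_axis i \<Phi> x \<partial>?M) + (\<integral>x. 0 \<partial>?M)"
    by (intro tendsto_add lim1 lim3)
  moreover have "(\<lambda>n. - (\<integral>x. g x $ i * \<Phi> x * X n x \<partial>?M)) \<longlonglongrightarrow> - (\<integral>x. g x $ i * \<Phi> x \<partial>?M)"
    by (intro tendsto_minus lim2)
  ultimately show ?thesis unfolding eq using LIMSEQ_unique by fastforce
qed

section \<open>Weak gradients in terms of cosine coefficients\<close>

lemma pderiv_trig_prod:
  fixes c :: "real^'d::finite"
  shows "pderiv_axis i (trig_prod c s \<tau> k) x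
    = (if \<tau> i then - 1 else 1) * (real (k i) * pi / s) * trig_prod c s (\<tau>(i := \<not> \<tau> i)) k x"
proof -
  let ?g = "\<lambda>j t. trig (\<tau> j) (k j) (cube_angle c s j t)"
  let ?g' = "\<lambda>t. (if \<tau> i then - 1 else 1) * (real (k i) * pi / s) * trig (\<not> \<tau> i) (k i) (cube_angle c s i t)"
  have "((\<lambda>t. cube_angle c s i t) has_real_derivative pi / s) (at t)" for t
  proof -
    have "(\<lambda>t. cube_angle c s i t) = (\<lambda>t. pi / s * (t - (c $ i - s / 2)))" by (simp add: cube_angle_def fun_eq_iff)
    moreover have "((\<lambda>t. pi / s * (t - (c $ i - s / 2))) has_real_derivative pi / s * (1 - 0)) (at t)"
      by (intro DERIV_cmult DERIV_diff DERIV_ident DERIV_const)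
    ultimately show ?thesis by simp
  qed
  then have "(?g i has_real_derivative ?g' t) (at t)" for t
    by (cases "\<tau> i") (auto simp: trig_def intro!: derivative_eq_intros)
  then have "pderiv_axis i (\<lambda>x. \<Prod>j\<in>UNIV. ?g j (x $ j)) x = ?g' (x $ i) * (\<Prod>j\<in>UNIV - {i}. ?g j (x $ j))"
    by (intro pderiv_prod smooth1_trig_angle)
  moreover have "trig_prod c s (\<tau>(i := \<not> \<tau> i)) k x
      = trig (\<not> \<tau> i) (k i) (cube_angle c s i (x $ i)) * (\<Prod>j\<in>UNIV - {i}. ?g j (x $ j))"
    unfolding trig_prod_def by (subst prod.remove[of UNIV i]) (auto intro!: prod.cong)
  moreover have "trig_prod c s \<tau> k = (\<lambda>x. \<Prod>j\<in>UNIV. ?g j (x $ j))" by (simp add: trig_prod_def fun_eq_iff)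
  ultimately show ?thesis by (simp add: mult.assoc)
qed

lemma abs_sin_mult_le: "\<bar>sin (real k * t)\<bar> \<le> real k * \<bar>t\<bar>"
  using abs_sin_x_le_abs_x[of "real k * t"] by (simp add: abs_mult)

text \<open>The testing function has a sine in variable i and cosines elsewhere. It vanishes on the
  faces orthogonal to axis i, so no boundary term arises whatever the boundary values of
  \<open>u\<close> are, and its i-th derivative is a multiple of the pure cosine product.\<close>

lemma trig_coeff_weak_grad:
  fixes c :: "real^'d::finite"
  assumes s: "0 < s" and u: "sq_integrable (lebesgue_on (cube c s)) u" and g: "weak_grad (cube c s) u g"
  shows "trig_coeff c s (\<lambda>j. j \<noteq> i) (\<lambda>x. g x $ i) k = - (real (k i) * pi / s) * trig_coeff c s (\<lambda>_. True) u k"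
proof -
  let ?M = "lebesgue_on (cube c s)" and ?\<Phi> = "trig_prod c s (\<lambda>j. j \<noteq> i) k"
  \<comment> \<open>One constant that bounds the function (by 1), its i-th derivative, and its
    linear growth away from the faces (both by \<open>real (k i) * pi / s\<close>).\<close>
  define B where "B = 1 + real (k i) * pi / s"
  have B1: "1 \<le> B" "real (k i) * pi / s \<le> B" "0 \<le> real (k i) * pi / s" using s by (auto simp: B_def)
  have upd: "(\<lambda>j. j \<noteq> i)(i := True) = (\<lambda>_. True)" by auto
  have pd: "pderiv_axis i ?\<Phi> x = (real (k i) * pi / s) * trig_prod c s (\<lambda>_. True) k x" for x
    using pderiv_trig_prod[of i c s "\<lambda>j. j \<noteq> i" k x] by (simp add: upd)
  have "(\<integral>x. u x * pderiv_axis i ?\<Phi> x \<partial>?M) = - (\<integral>x. g x $ i * ?\<Phi> x \<partial>?M)"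
  proof (rule weak_grad_vanishing_on_faces[OF s u g smooth_fun_trig_prod])
    show "\<bar>?\<Phi> x\<bar> \<le> B" for x using trig_prod_le_1[of c s _ k x] B1 by (meson order_trans)
    show "\<bar>pderiv_axis i ?\<Phi> x\<bar> \<le> B" for x
    proof -
      have "\<bar>pderiv_axis i ?\<Phi> x\<bar> = (real (k i) * pi / s) * \<bar>trig_prod c s (\<lambda>_. True) k x\<bar>"
        by (simp only: pd abs_mult[of "real (k i) * pi / s"] abs_of_nonneg[OF B1(3)])
      also have "\<dots> \<le> (real (k i) * pi / s) * 1" by (intro mult_left_mono trig_prod_le_1 B1)
      finally show ?thesis using B1 by simp
    qed
    fix x assume x: "x \<in> cube c s"
    let ?t = "cube_angle c s i (x $ i)"
    note t = angle_in_interior[OF s x, of i]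
    have "?\<Phi> x = sin (real (k i) * ?t) * (\<Prod>j\<in>UNIV - {i}. trig (j \<noteq> i) (k j) (cube_angle c s j (x $ j)))"
      unfolding trig_prod_def by (subst prod.remove[of UNIV i]) (auto simp: trig_def)
    moreover have "\<bar>\<Prod>j\<in>UNIV - {i}. trig (j \<noteq> i) (k j) (cube_angle c s j (x $ j))\<bar> \<le> 1"
      unfolding abs_prod by (intro prod_le_1) (auto simp: trig_le_1)
    ultimately have le: "\<bar>?\<Phi> x\<bar> \<le> \<bar>sin (real (k i) * ?t)\<bar>" by (simp add: abs_mult mult_left_le)
    have "\<bar>sin (real (k i) * ?t)\<bar> \<le> real (k i) * ?t" using abs_sin_mult_le[of "k i" ?t] t by simp
    also have "\<dots> = real (k i) * pi / s * (x $ i - (c $ i - s / 2))" by (simp add: cube_angle_def)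
    also have "\<dots> \<le> B * (x $ i - (c $ i - s / 2))" using x B1 by (intro mult_right_mono) (auto simp: mem_cube less_imp_le)
    finally have 1: "\<bar>?\<Phi> x\<bar> \<le> B * (x $ i - (c $ i - s / 2))" using le by simp
    \<comment> \<open>At the far face the angle tends to pi; for an integer frequency the absolute
      value of the sine is symmetric under reflecting the angle at pi / 2.\<close>
    have "\<bar>sin (real (k i) * ?t)\<bar> = \<bar>sin (real (k i) * (pi - ?t))\<bar>"
      by (simp add: right_diff_distrib sin_diff sin_times_pi_eq_0 abs_mult)
    also have "\<dots> \<le> real (k i) * (pi - ?t)" using abs_sin_mult_le[of "k i" "pi - ?t"] t by simp
    also have "pi - ?t = pi / s * (c $ i + s / 2 - x $ i)" using s by (simp add: cube_angle_def field_simps)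
    also have "real (k i) * (pi / s * (c $ i + s / 2 - x $ i)) = real (k i) * pi / s * (c $ i + s / 2 - x $ i)" by simp
    also have "\<dots> \<le> B * (c $ i + s / 2 - x $ i)" using x B1 by (intro mult_right_mono) (auto simp: mem_cube less_imp_le)
    finally have 2: "\<bar>?\<Phi> x\<bar> \<le> B * (c $ i + s / 2 - x $ i)" using le by simp
    show "\<bar>?\<Phi> x\<bar> \<le> B * (x $ i - (c $ i - s / 2)) \<and> \<bar>?\<Phi> x\<bar> \<le> B * (c $ i + s / 2 - x $ i)" using 1 2 by simp
  qed
  moreover have "(\<integral>x. u x * pderiv_axis i ?\<Phi> x \<partial>?M) = real (k i) * pi / s * (\<integral>x. u x * trig_prod c s (\<lambda>_. True) k x \<partial>?M)"
  proof -
    have "(\<integral>x. u x * pderiv_axis i ?\<Phi> x \<partial>?M) = (\<integral>x. (real (k i) * pi / s) * (u x * trig_prod c s (\<lambda>_. True) k x) \<partial>?M)"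
      unfolding pd by (intro Bochner_Integration.integral_cong refl) simp
    then show ?thesis by simp
  qed
  ultimately show ?thesis unfolding trig_coeff_def by simp
qed

lemma trig_prod_norm_sin:
  fixes i :: "'d::finite"
  assumes "k i \<noteq> 0"
  shows "trig_prod_norm s (\<lambda>j. j \<noteq> i) k = trig_prod_norm s (\<lambda>_. True) k"
  unfolding trig_prod_norm_def by (intro prod.cong) (auto simp: trig_norm_def assms)

lemma trig_norm_nonneg: "0 \<le> s \<Longrightarrow> 0 \<le> trig_prod_norm s \<tau> k"
  unfolding trig_prod_norm_def by (intro prod_nonneg) (auto simp: trig_norm_def)

text \<open>Termwise differentiation of the cosine sum gives the mixed sum of the weak derivative:
  for \<open>k i \<noteq> 0\<close> the norms agree, and for \<open>k i = 0\<close> both terms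
  vanish. Consequently the smooth functions \<open>trig_sum\<close> converge to \<open>u\<close>
  together with their gradients.\<close>

lemma pderiv_trig_sum:
  fixes c :: "real^'d::finite"
  assumes s: "0 < s" and u: "sq_integrable (lebesgue_on (cube c s)) u" and g: "weak_grad (cube c s) u g"
  shows "pderiv_axis i (trig_sum c s (\<lambda>_. True) u n) x = trig_sum c s (\<lambda>j. j \<noteq> i) (\<lambda>x. g x $ i) n x"
proof -
  have upd: "(\<lambda>_. True)(i := \<not> True) = (\<lambda>j. j \<noteq> i)" by auto
  have pd: "pderiv_axis i (trig_prod c s (\<lambda>_. True) k) x = - (real (k i) * pi / s) * trig_prod c s (\<lambda>j. j \<noteq> i) k x" for k
    using pderiv_trig_prod[of i c s "\<lambda>_. True" k x] by (simp only: upd) simp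
  let ?C = "\<lambda>k. trig_coeff c s (\<lambda>_. True) u k / trig_prod_norm s (\<lambda>_. True) k"
  have "pderiv_axis i (trig_sum c s (\<lambda>_. True) u n) x
    = (\<Sum>k\<in>freq_box n. pderiv_axis i (\<lambda>x. ?C k * trig_prod c s (\<lambda>_. True) k x) x)"
    unfolding trig_sum_def[abs_def] by (rule pderiv_sum) (intro smooth_fun_mult smooth_fun_const smooth_fun_trig_prod)
  also have "\<dots> = (\<Sum>k\<in>freq_box n. ?C k * pderiv_axis i (trig_prod c s (\<lambda>_. True) k) x)"
    by (simp only: pderiv_cmult[OF smooth_fun_trig_prod])
  also have "\<dots> = trig_sum c s (\<lambda>j. j \<noteq> i) (\<lambda>x. g x $ i) n x"
    unfolding trig_sum_def
  proof (intro sum.cong refl)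
    fix k
    show "trig_coeff c s (\<lambda>_. True) u k / trig_prod_norm s (\<lambda>_. True) k * pderiv_axis i (trig_prod c s (\<lambda>_. True) k) x
      = trig_coeff c s (\<lambda>j. j \<noteq> i) (\<lambda>x. g x $ i) k / trig_prod_norm s (\<lambda>j. j \<noteq> i) k * trig_prod c s (\<lambda>j. j \<noteq> i) k x"
      unfolding pd trig_coeff_weak_grad[OF s u g] by (cases "k i = 0") (auto simp: trig_prod_norm_sin mult_ac)
  qed
  finally show ?thesis .
qed

lemma smooth_fun_trig_sum: "smooth_fun (trig_sum c s \<tau> u n)"
  unfolding trig_sum_def[abs_def]
  by (intro smooth_fun_sum smooth_fun_mult smooth_fun_const smooth_fun_trig_prod)

lemma pderiv_trig_sum_converges:
  fixes c :: "real^'d::finite"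
  assumes s: "0 < s" and u: "sq_integrable (lebesgue_on (cube c s)) u" and g: "weak_grad (cube c s) u g"
  shows "l2_lim (lebesgue_on (cube c s)) (\<lambda>n. pderiv_axis i (trig_sum c s (\<lambda>_. True) u n)) (\<lambda>x. g x $ i)"
proof -
  have "(\<lambda>n. pderiv_axis i (trig_sum c s (\<lambda>_. True) u n)) = trig_sum c s (\<lambda>j. j \<noteq> i) (\<lambda>x. g x $ i)"
    by (intro ext pderiv_trig_sum[OF s u g])
  then show ?thesis using trig_sum_converges[OF s weak_gradD(1)[OF g]] by simp
qed

text \<open>A mode outside \<open>freq_box K\<close> has some frequency at least \<open>K\<close>,
  so the derivative in that direction already pays \<open>(pi * real K / s)\<^sup>2\<close> times
  its weight. Parseval for \<open>u\<close> and Bessel for each derivative then sum this up. The low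
  modes are kept on the right: they are made to converge for compactness and to vanish for the
  eigenvalue bound.\<close>

lemma cube_spectral_inequality:
  fixes c :: "real^'d::finite"
  assumes s: "0 < s" and u: "sq_integrable (lebesgue_on (cube c s)) u" and g: "weak_grad (cube c s) u g"
  shows "(pi * real K / s)\<^sup>2 * (\<integral>x. (u x)\<^sup>2 \<partial>lebesgue_on (cube c s))
    \<le> (pi * real K / s)\<^sup>2 * (\<Sum>k\<in>freq_box K. (trig_coeff c s (\<lambda>_. True) u k)\<^sup>2 / trig_prod_norm s (\<lambda>_. True) k)
      + (\<Sum>i\<in>UNIV. \<integral>x. (g x $ i)\<^sup>2 \<partial>lebesgue_on (cube c s))"
proof -
  let ?M = "lebesgue_on (cube c s)"
  define q where "q k = (trig_coeff c s (\<lambda>_. True) u k)\<^sup>2 / trig_prod_norm s (\<lambda>_. True) k" for k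
  define r where "r i k = (trig_coeff c s (\<lambda>j. j \<noteq> i) (\<lambda>x. g x $ i) k)\<^sup>2 / trig_prod_norm s (\<lambda>j. j \<noteq> i) k" for i k
  define L where "L = (pi * real K / s)\<^sup>2"
  have q0: "0 \<le> q k" for k unfolding q_def using s by (intro divide_nonneg_nonneg trig_norm_nonneg) auto
  have r: "r i k = (real (k i) * pi / s)\<^sup>2 * q k" for i k
    unfolding r_def q_def trig_coeff_weak_grad[OF s u g]
    by (cases "k i = 0") (auto simp: trig_prod_norm_sin power_mult_distrib power_divide)
  have Lq: "L * q k \<le> (\<Sum>i\<in>UNIV. r i k)" if "k \<notin> freq_box K" for k
  proof -
    from that obtain i where i: "K \<le> k i" by (auto simp: freq_box_def not_less)
    have "L * q k \<le> r i k"
      unfolding r L_def using i s by (intro mult_right_mono power_mono divide_right_mono q0) auto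
    also have "\<dots> \<le> (\<Sum>i\<in>UNIV. r i k)" by (rule member_le_sum) (auto simp: r q0)
    finally show ?thesis .
  qed
  have step: "L * (\<Sum>k\<in>freq_box n. q k) \<le> L * (\<Sum>k\<in>freq_box K. q k) + (\<Sum>i\<in>UNIV. \<integral>x. (g x $ i)\<^sup>2 \<partial>?M)" for n
  proof -
    have "(\<Sum>k\<in>freq_box n. q k) \<le> (\<Sum>k\<in>freq_box K \<union> (freq_box n - freq_box K). q k)"
      by (intro sum_mono2) (auto simp: finite_freq_box q0)
    also have "\<dots> = (\<Sum>k\<in>freq_box K. q k) + (\<Sum>k\<in>freq_box n - freq_box K. q k)"
      by (intro sum.union_disjoint) (auto simp: finite_freq_box)
    finally have "L * (\<Sum>k\<in>freq_box n. q k) \<le> L * (\<Sum>k\<in>freq_box K. q k) + L * (\<Sum>k\<in>freq_box n - freq_box K. q k)"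
      unfolding distrib_left[symmetric] by (intro mult_left_mono) (auto simp: L_def)
    also have "L * (\<Sum>k\<in>freq_box n - freq_box K. q k) \<le> (\<Sum>k\<in>freq_box n - freq_box K. \<Sum>i\<in>UNIV. r i k)"
      unfolding sum_distrib_left using Lq by (intro sum_mono) auto
    also have "\<dots> = (\<Sum>i\<in>UNIV. \<Sum>k\<in>freq_box n - freq_box K. r i k)" by (rule sum.swap)
    also have "\<dots> \<le> (\<Sum>i\<in>UNIV. \<integral>x. (g x $ i)\<^sup>2 \<partial>?M)"
      unfolding r_def by (intro sum_mono trig_Bessel[OF s weak_gradD(1)[OF g]]) (simp add: finite_freq_box)
    finally show ?thesis by simp
  qed
  have "(\<lambda>n. L * (\<Sum>k\<in>freq_box n. q k)) \<longlonglongrightarrow> L * (\<integral>x. (u x)\<^sup>2 \<partial>?M)"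
    unfolding q_def by (intro tendsto_mult tendsto_const trig_Parseval[OF s u])
  then show ?thesis unfolding L_def[symmetric] q_def[symmetric]
    using step by (intro LIMSEQ_le_const2) auto
qed

subsection \<open>The energy form and the Caccioppoli inequality\<close>

definition l2_field :: "(real^'d::finite) set \<Rightarrow> (real^'d \<Rightarrow> real^'d) \<Rightarrow> bool" where
  "l2_field S G \<longleftrightarrow> (\<forall>i. sq_integrable (lebesgue_on S) (\<lambda>x. G x $ i))"

text \<open>Stated for fields because the representatives picked by \<open>wgrad\<close> add up only
  almost everywhere; bilinear algebra is carried out here and transferred to
  \<open>energy_form\<close> at the end.\<close>

definition field_form :: "(real^'d::finite) set \<Rightarrow> (real^'d \<Rightarrow> real^'d^'d) \<Rightarrow> (real^'d \<Rightarrow> real^'d) \<Rightarrow> (real^'d \<Rightarrow> real^'d) \<Rightarrow> real" where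
  "field_form S A G H = (\<integral>x. (A x *v G x) \<bullet> H x \<partial>lebesgue_on S)"

lemma l2_fieldD: "l2_field S G \<Longrightarrow> sq_integrable (lebesgue_on S) (\<lambda>x. G x $ i)"
  by (simp add: l2_field_def)

lemma weak_grad_l2_field: "weak_grad S u g \<Longrightarrow> l2_field S g"
  by (simp add: weak_grad_def L2_eq l2_field_def)

lemma l2_field_add: "l2_field S G \<Longrightarrow> l2_field S H \<Longrightarrow> l2_field S (\<lambda>x. G x + H x)"
  by (simp add: l2_field_def sq_integrable_add)

lemma l2_field_diff: "l2_field S G \<Longrightarrow> l2_field S H \<Longrightarrow> l2_field S (\<lambda>x. G x - H x)"
  by (simp add: l2_field_def sq_integrable_diff)

lemma l2_field_scale: "l2_field S G \<Longrightarrow> l2_field S (\<lambda>x. a *\<^sub>R G x)"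
  by (simp add: l2_field_def sq_integrable_cmult)

lemma l2_field_sum: "(\<And>i. i \<in> I \<Longrightarrow> l2_field S (G i)) \<Longrightarrow> l2_field S (\<lambda>x. \<Sum>i\<in>I. G i x)"
  by (simp add: l2_field_def sq_integrable_sum)

text \<open>Polarization: four times the entry is the difference of the quadratic form at the sum
  and at the difference of two unit vectors, and both values lie between 0 and
  \<open>4 * \<beta>\<close>. Bounded entries keep \<open>A x *v G x\<close> square
  integrable.\<close>

lemma coeff_matrix_entry:
  assumes A: "coeff_matrix S A \<alpha> \<beta>" and x: "x \<in> S"
  shows "\<bar>A x $ i $ k\<bar> \<le> \<beta>"
proof -
  let ?e = "\<lambda>i. axis i (1::real)"
  have pos: "0 < \<alpha>" "0 < \<beta>" using A by (auto simp: coeff_matrix_def)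
  have T: "transpose (A x) = A x"
    and Q: "\<And>v. \<alpha> * (norm v)\<^sup>2 \<le> v \<bullet> (A x *v v) \<and> v \<bullet> (A x *v v) \<le> \<beta> * (norm v)\<^sup>2"
    using A x unfolding coeff_matrix_def by blast+
  have sym: "A x $ k $ i = A x $ i $ k" using arg_cong[OF T, of "\<lambda>B. B $ i $ k"] by (simp add: transpose_def)
  have ent: "?e j \<bullet> (A x *v ?e l) = A x $ j $ l" for j l
    by (simp add: inner_axis' matrix_vector_mul_component inner_axis)
  have four: "(?e i + ?e k) \<bullet> (A x *v (?e i + ?e k)) - (?e i - ?e k) \<bullet> (A x *v (?e i - ?e k)) = 4 * A x $ i $ k"
    by (simp add: matrix_vector_right_distrib matrix_vector_mult_diff_distrib inner_add_left inner_add_right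
        inner_diff_left inner_diff_right ent sym)
  have nonneg: "0 \<le> v \<bullet> (A x *v v)" for v
    using Q[of v] pos by (meson mult_nonneg_nonneg order_trans less_imp_le zero_le_power2)
  have n: "norm (?e i + ?e k) \<le> 2" "norm (?e i - ?e k) \<le> 2"
    using norm_triangle_ineq[of "?e i" "?e k"] norm_triangle_ineq4[of "?e i" "?e k"] by (auto simp: norm_axis_1)
  have "(norm (?e i + ?e k))\<^sup>2 \<le> 2\<^sup>2" "(norm (?e i - ?e k))\<^sup>2 \<le> 2\<^sup>2"
    using power_mono[OF n(1), of 2] power_mono[OF n(2), of 2] by simp_all
  moreover have Q4: "v \<bullet> (A x *v v) \<le> \<beta> * 4" if "(norm v)\<^sup>2 \<le> 2\<^sup>2" for v
  proof -
    have "\<beta> * (norm v)\<^sup>2 \<le> \<beta> * 4" using that pos by (intro mult_left_mono) auto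
    then show ?thesis using Q[of v] by linarith
  qed
  ultimately have u: "(?e i + ?e k) \<bullet> (A x *v (?e i + ?e k)) \<le> \<beta> * 4"
    "(?e i - ?e k) \<bullet> (A x *v (?e i - ?e k)) \<le> \<beta> * 4"
    by blast+
  then show ?thesis using four nonneg[of "?e i + ?e k"] nonneg[of "?e i - ?e k"] by linarith
qed

lemma coeff_matrix_props:
  assumes A: "coeff_matrix S A \<alpha> \<beta>"
  shows "0 < \<alpha>" "0 < \<beta>" "(\<lambda>x. A x $ i $ k) \<in> borel_measurable (lebesgue_on S)"
    "x \<in> S \<Longrightarrow> \<alpha> * (norm v)\<^sup>2 \<le> (A x *v v) \<bullet> v" "x \<in> S \<Longrightarrow> (A x *v v) \<bullet> v \<le> \<beta> * (norm v)\<^sup>2"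
    "x \<in> S \<Longrightarrow> (A x *v v) \<bullet> w = (A x *v w) \<bullet> v"
proof -
  show "0 < \<alpha>" "0 < \<beta>" "(\<lambda>x. A x $ i $ k) \<in> borel_measurable (lebesgue_on S)"
    using A by (auto simp: coeff_matrix_def)
  show "x \<in> S \<Longrightarrow> \<alpha> * (norm v)\<^sup>2 \<le> (A x *v v) \<bullet> v" "x \<in> S \<Longrightarrow> (A x *v v) \<bullet> v \<le> \<beta> * (norm v)\<^sup>2"
    using A unfolding coeff_matrix_def inner_commute[of "A x *v v"] by blast+
  assume "x \<in> S"
  then have "transpose (A x) = A x" using A by (auto simp: coeff_matrix_def)
  then show "(A x *v v) \<bullet> w = (A x *v w) \<bullet> v"
    by (metis dot_lmul_matrix inner_commute transpose_matrix_vector)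
qed

lemma l2_field_matrix:
  assumes A: "coeff_matrix S A \<alpha> \<beta>" and G: "l2_field S G"
  shows "l2_field S (\<lambda>x. A x *v G x)"
  unfolding l2_field_def matrix_vector_mult_def vec_lambda_beta
  by (intro allI sq_integrable_sum sq_integrable_bounded_mult[OF l2_fieldD[OF G] coeff_matrix_props(3)[OF A], where B=\<beta>])
    (auto intro: coeff_matrix_entry[OF A])

lemma l2_field_inner_integrable:
  assumes "l2_field S G" "l2_field S H"
  shows "integrable (lebesgue_on S) (\<lambda>x. G x \<bullet> H x)"
    and "(\<integral>x. G x \<bullet> H x \<partial>lebesgue_on S) = (\<Sum>i\<in>UNIV. \<integral>x. G x $ i * H x $ i \<partial>lebesgue_on S)"
  using sq_integrable_prod[OF l2_fieldD[OF assms(1)] l2_fieldD[OF assms(2)]]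
  by (auto simp: inner_vec_def intro: Bochner_Integration.integral_sum)

lemma field_form_integrable:
  assumes "coeff_matrix S A \<alpha> \<beta>" "l2_field S G" "l2_field S H"
  shows "integrable (lebesgue_on S) (\<lambda>x. (A x *v G x) \<bullet> H x)"
  by (rule l2_field_inner_integrable(1)[OF l2_field_matrix[OF assms(1,2)] assms(3)])

lemma field_form_sym:
  assumes "coeff_matrix S A \<alpha> \<beta>"
  shows "field_form S A G H = field_form S A H G"
  unfolding field_form_def
  by (intro Bochner_Integration.integral_cong refl) (use coeff_matrix_props(6)[OF assms] in simp)

lemma field_form_add_right:
  assumes "coeff_matrix S A \<alpha> \<beta>" "l2_field S F" "l2_field S G" "l2_field S H"
  shows "field_form S A F (\<lambda>x. G x + H x) = field_form S A F G + field_form S A F H"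
  using field_form_integrable[OF assms(1,2,3)] field_form_integrable[OF assms(1,2,4)]
  by (simp add: field_form_def inner_add_right)

lemma field_form_diff_right:
  assumes "coeff_matrix S A \<alpha> \<beta>" "l2_field S F" "l2_field S G" "l2_field S H"
  shows "field_form S A F (\<lambda>x. G x - H x) = field_form S A F G - field_form S A F H"
  using field_form_integrable[OF assms(1,2,3)] field_form_integrable[OF assms(1,2,4)]
  by (simp add: field_form_def inner_diff_right)

lemma field_form_scale_right: "field_form S A F (\<lambda>x. a *\<^sub>R G x) = a * field_form S A F G"
  by (simp add: field_form_def)

lemma field_form_sum_right:
  assumes A: "coeff_matrix S A \<alpha> \<beta>" and F: "l2_field S F" and G: "\<And>i. i \<in> I \<Longrightarrow> l2_field S (G i)"
  shows "field_form S A F (\<lambda>x. \<Sum>i\<in>I. G i x) = (\<Sum>i\<in>I. field_form S A F (G i))"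
  unfolding field_form_def inner_sum_right
  by (intro Bochner_Integration.integral_sum field_form_integrable[OF A F G])

lemma field_form_add_left:
  assumes "coeff_matrix S A \<alpha> \<beta>" "l2_field S F" "l2_field S G" "l2_field S H"
  shows "field_form S A (\<lambda>x. G x + H x) F = field_form S A G F + field_form S A H F"
  using field_form_add_right[OF assms] field_form_sym[OF assms(1)] by metis

lemma field_form_diff_left:
  assumes "coeff_matrix S A \<alpha> \<beta>" "l2_field S F" "l2_field S G" "l2_field S H"
  shows "field_form S A (\<lambda>x. G x - H x) F = field_form S A G F - field_form S A H F"
  using field_form_diff_right[OF assms] field_form_sym[OF assms(1)] by metis

lemma field_form_scale_left:
  assumes "coeff_matrix S A \<alpha> \<beta>"
  shows "field_form S A (\<lambda>x. a *\<^sub>R G x) F = a * field_form S A G F"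
  using field_form_scale_right field_form_sym[OF assms] by metis

lemma field_form_nonneg:
  assumes A: "coeff_matrix S A \<alpha> \<beta>"
  shows "0 \<le> field_form S A G G"
  unfolding field_form_def
proof (rule integral_nonneg_AE, rule AE_I2)
  fix x assume "x \<in> space (lebesgue_on S)"
  then have "\<alpha> * (norm (G x))\<^sup>2 \<le> (A x *v G x) \<bullet> G x" using coeff_matrix_props(4)[OF A] by simp
  then show "0 \<le> (A x *v G x) \<bullet> G x"
    using coeff_matrix_props(1)[OF A] by (meson mult_nonneg_nonneg order_trans less_imp_le zero_le_power2)
qed

lemma norm_squared_sum: "(norm (v :: real^'d::finite))\<^sup>2 = (\<Sum>i\<in>UNIV. (v $ i)\<^sup>2)"
  unfolding power2_norm_eq_inner inner_vec_def by (simp add: power2_eq_square)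

lemma integral_norm_squared:
  assumes "l2_field S G"
  shows "integrable (lebesgue_on S) (\<lambda>x. (norm (G x))\<^sup>2)"
    and "(\<integral>x. (norm (G x))\<^sup>2 \<partial>lebesgue_on S) = (\<Sum>i\<in>UNIV. \<integral>x. (G x $ i)\<^sup>2 \<partial>lebesgue_on S)"
  unfolding norm_squared_sum
  using sq_integrable_square[OF l2_fieldD[OF assms]] by (auto intro: Bochner_Integration.integral_sum)

lemma field_form_bounds:
  assumes A: "coeff_matrix S A \<alpha> \<beta>" and G: "l2_field S G"
  shows "\<alpha> * (\<Sum>i\<in>UNIV. \<integral>x. (G x $ i)\<^sup>2 \<partial>lebesgue_on S) \<le> field_form S A G G"
    and "field_form S A G G \<le> \<beta> * (\<Sum>i\<in>UNIV. \<integral>x. (G x $ i)\<^sup>2 \<partial>lebesgue_on S)"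
proof -
  have "(\<integral>x. \<alpha> * (norm (G x))\<^sup>2 \<partial>lebesgue_on S) \<le> field_form S A G G"
    unfolding field_form_def using coeff_matrix_props(4)[OF A] integral_norm_squared(1)[OF G]
    by (intro integral_mono field_form_integrable[OF A G G]) auto
  moreover have "field_form S A G G \<le> (\<integral>x. \<beta> * (norm (G x))\<^sup>2 \<partial>lebesgue_on S)"
    unfolding field_form_def using coeff_matrix_props(5)[OF A] integral_norm_squared(1)[OF G]
    by (intro integral_mono field_form_integrable[OF A G G]) auto
  ultimately show "\<alpha> * (\<Sum>i\<in>UNIV. \<integral>x. (G x $ i)\<^sup>2 \<partial>lebesgue_on S) \<le> field_form S A G G"
    "field_form S A G G \<le> \<beta> * (\<Sum>i\<in>UNIV. \<integral>x. (G x $ i)\<^sup>2 \<partial>lebesgue_on S)"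
    by (simp_all add: integral_norm_squared(2)[OF G])
qed

lemma field_form_limit_right:
  assumes A: "coeff_matrix S A \<alpha> \<beta>" and F: "l2_field S F"
    and G: "\<And>i. l2_lim (lebesgue_on S) (\<lambda>n x. G n x $ i) (\<lambda>x. H x $ i)"
  shows "(\<lambda>n. field_form S A F (G n)) \<longlonglongrightarrow> field_form S A F H"
proof -
  have l: "l2_field S (G n)" "l2_field S H" for n
    using G by (auto simp: l2_field_def l2_lim_def)
  note AF = l2_field_matrix[OF A F]
  show ?thesis
    unfolding field_form_def l2_field_inner_integrable(2)[OF AF l(1)] l2_field_inner_integrable(2)[OF AF l(2)]
    by (intro tendsto_sum l2_lim_inner_right[OF G] l2_fieldD[OF AF])
qed

lemma field_form_limit_diag:
  assumes A: "coeff_matrix S A \<alpha> \<beta>"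
    and G: "\<And>i. l2_lim (lebesgue_on S) (\<lambda>n x. G n x $ i) (\<lambda>x. H x $ i)"
  shows "(\<lambda>n. field_form S A (G n) (G n)) \<longlonglongrightarrow> field_form S A H H"
proof -
  have l: "l2_field S (G n)" "l2_field S H" for n
    using G by (auto simp: l2_field_def l2_lim_def)
  let ?D = "\<lambda>n x. H x - G n x"
  have D: "l2_field S (?D n)" for n by (intro l2_field_diff l)
  have up: "(\<lambda>n. \<beta> * (\<Sum>i\<in>UNIV. \<integral>x. (?D n x $ i)\<^sup>2 \<partial>lebesgue_on S)) \<longlonglongrightarrow> 0"
  proof -
    have "(\<lambda>n. \<integral>x. (?D n x $ i)\<^sup>2 \<partial>lebesgue_on S) \<longlonglongrightarrow> 0" for i using G[of i] by (simp add: l2_lim_def)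
    then show ?thesis by (intro tendsto_mult_right_zero tendsto_null_sum)
  qed
  have "(\<lambda>n. field_form S A (?D n) (?D n)) \<longlonglongrightarrow> 0"
  proof (rule tendsto_sandwich[OF _ _ tendsto_const up])
    show "\<forall>\<^sub>F n in sequentially. 0 \<le> field_form S A (?D n) (?D n)"
      by (intro always_eventually allI field_form_nonneg[OF A])
    show "\<forall>\<^sub>F n in sequentially. field_form S A (?D n) (?D n)
        \<le> \<beta> * (\<Sum>i\<in>UNIV. \<integral>x. (?D n x $ i)\<^sup>2 \<partial>lebesgue_on S)"
      by (intro always_eventually allI field_form_bounds(2)[OF A D])
  qed
  moreover have "(\<lambda>n. field_form S A H (G n)) \<longlonglongrightarrow> field_form S A H H"
    by (rule field_form_limit_right[OF A l(2) G])
  ultimately have "(\<lambda>n. field_form S A (?D n) (?D n) + 2 * field_form S A H (G n) - field_form S A H H)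
      \<longlonglongrightarrow> 0 + 2 * field_form S A H H - field_form S A H H"
    by (intro tendsto_intros)
  moreover have "field_form S A (G n) (G n) = field_form S A (?D n) (?D n) + 2 * field_form S A H (G n) - field_form S A H H" for n
    using field_form_diff_right[OF A D[of n] l(2) l(1)[of n]] field_form_diff_left[OF A l(2) l(2) l(1)[of n]]
      field_form_diff_left[OF A l(1)[of n] l(2) l(1)[of n]] field_form_sym[OF A, of "G n" H] by linarith
  ultimately show ?thesis by simp
qed

lemma field_form_cong_AE:
  assumes A: "coeff_matrix S A \<alpha> \<beta>" and l: "l2_field S G" "l2_field S G'" "l2_field S H" "l2_field S H'"
    and e: "AE x in lebesgue_on S. G x = G' x" "AE x in lebesgue_on S. H x = H' x"
  shows "field_form S A G H = field_form S A G' H'"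
  unfolding field_form_def
proof (rule integral_cong_AE)
  show "AE x in lebesgue_on S. (A x *v G x) \<bullet> H x = (A x *v G' x) \<bullet> H' x"
    using e by eventually_elim simp
qed (use field_form_integrable[OF A l(1,3)] field_form_integrable[OF A l(2,4)] in auto)

lemma weak_grad_wgrad: "weak_grad S u g \<Longrightarrow> weak_grad S u (wgrad S u)"
  unfolding wgrad_def by (rule someI[of "weak_grad S u"])

text \<open>The point of transfer from \<open>wgrad\<close> to explicit gradients; it rests on
  uniqueness of the weak gradient.\<close>

lemma energy_form_eq:
  assumes s: "0 < s" and A: "coeff_matrix (cube c s) A \<alpha> \<beta>"
    and u: "weak_grad (cube c s) u g" and w: "weak_grad (cube c s) w h"
  shows "energy_form (cube c s) A u w = field_form (cube c s) A g h"
proof -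
  have "field_form (cube c s) A (wgrad (cube c s) u) (wgrad (cube c s) w) = field_form (cube c s) A g h"
    by (rule field_form_cong_AE[OF A weak_grad_l2_field[OF weak_grad_wgrad[OF u]] weak_grad_l2_field[OF u]
        weak_grad_l2_field[OF weak_grad_wgrad[OF w]] weak_grad_l2_field[OF w]
        weak_grad_unique[OF s weak_grad_wgrad[OF u] u] weak_grad_unique[OF s weak_grad_wgrad[OF w] w]])
  then show ?thesis by (simp add: energy_form_def field_form_def)
qed

lemma coeff_matrix_subset:
  assumes A: "coeff_matrix T A \<alpha> \<beta>" and S: "S \<subseteq> T"
  shows "coeff_matrix S A \<alpha> \<beta>"
  using A S measurable_restrict_mono[OF _ S, of _ lebesgue borel] unfolding coeff_matrix_def by (auto simp: subset_iff)

lemma l2_field_cgrad: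
  assumes "test_fun (cube c s) \<phi>"
  shows "l2_field (cube c t) (cgrad \<phi>)"
  unfolding l2_field_def cgrad_def using test_fun_pderiv_sq_integrable(1)[OF assms] by simp

lemma H_A_field_form:
  assumes s: "0 < s" and A: "coeff_matrix (cube c s) A \<alpha> \<beta>"
    and u: "H_A (cube c s) A u" "weak_grad (cube c s) u g" and \<phi>: "test_fun (cube c s) \<phi>"
  shows "field_form (cube c s) A g (cgrad \<phi>) = 0"
proof -
  have "field_form (cube c s) A (wgrad (cube c s) u) (cgrad \<phi>) = field_form (cube c s) A g (cgrad \<phi>)"
    by (rule field_form_cong_AE[OF A weak_grad_l2_field[OF weak_grad_wgrad[OF u(2)]] weak_grad_l2_field[OF u(2)]
        l2_field_cgrad[OF \<phi>] l2_field_cgrad[OF \<phi>] weak_grad_unique[OF s weak_grad_wgrad[OF u(2)] u(2)]]) simp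
  then show ?thesis using u(1) \<phi> by (simp add: H_A_def field_form_def)
qed

text \<open>\<open>H_A\<close> tests only with smooth compactly supported functions. The form is
  continuous in the mean-square norm of the gradient, so orthogonality passes to the closure that
  defines \<open>H1_0\<close>.\<close>

lemma H_A_orthogonal_H1_0:
  assumes s: "0 < s" and A: "coeff_matrix (cube c s) A \<alpha> \<beta>"
    and u: "H_A (cube c s) A u" "weak_grad (cube c s) u g"
    and w: "H1_0 (cube c s) w" "weak_grad (cube c s) w h"
  shows "field_form (cube c s) A g h = 0"
proof -
  let ?M = "lebesgue_on (cube c s)" and ?h = "wgrad (cube c s) w"
  from w(1) obtain \<phi> :: "nat \<Rightarrow> real^'a \<Rightarrow> real" where \<phi>: "\<And>k. test_fun (cube c s) (\<phi> k)"
    and lim: "(\<lambda>k. (\<integral>x. (w x - \<phi> k x)\<^sup>2 \<partial>?M) + (\<integral>x. (norm (?h x - cgrad (\<phi> k) x))\<^sup>2 \<partial>?M)) \<longlonglongrightarrow> 0"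
    unfolding H1_0_def by blast
  have h': "l2_field (cube c s) ?h" by (rule weak_grad_l2_field[OF weak_grad_wgrad[OF w(2)]])
  note cg = l2_field_cgrad[OF \<phi>, of s]
  have "l2_lim ?M (\<lambda>k x. cgrad (\<phi> k) x $ i) (\<lambda>x. ?h x $ i)" for i
    unfolding l2_lim_def
  proof (intro conjI allI)
    show "sq_integrable ?M (\<lambda>x. cgrad (\<phi> k) x $ i)" for k by (rule l2_fieldD[OF cg])
    show "sq_integrable ?M (\<lambda>x. ?h x $ i)" by (rule l2_fieldD[OF h'])
    show "(\<lambda>k. \<integral>x. (?h x $ i - cgrad (\<phi> k) x $ i)\<^sup>2 \<partial>?M) \<longlonglongrightarrow> 0"
    proof (rule tendsto_sandwich[OF _ _ tendsto_const lim])
      show "\<forall>\<^sub>F k in sequentially. (\<integral>x. (?h x $ i - cgrad (\<phi> k) x $ i)\<^sup>2 \<partial>?M)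
        \<le> (\<integral>x. (w x - \<phi> k x)\<^sup>2 \<partial>?M) + (\<integral>x. (norm (?h x - cgrad (\<phi> k) x))\<^sup>2 \<partial>?M)"
      proof (intro always_eventually allI)
        fix k
        have "(\<integral>x. ((?h x - cgrad (\<phi> k) x) $ i)\<^sup>2 \<partial>?M) \<le> (\<Sum>i\<in>UNIV. \<integral>x. ((?h x - cgrad (\<phi> k) x) $ i)\<^sup>2 \<partial>?M)"
          by (rule member_le_sum) (auto intro: sq_integral_nonneg)
        also have "\<dots> = (\<integral>x. (norm (?h x - cgrad (\<phi> k) x))\<^sup>2 \<partial>?M)"
          by (rule integral_norm_squared(2)[OF l2_field_diff[OF h' cg], symmetric])
        finally show "(\<integral>x. (?h x $ i - cgrad (\<phi> k) x $ i)\<^sup>2 \<partial>?M)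
          \<le> (\<integral>x. (w x - \<phi> k x)\<^sup>2 \<partial>?M) + (\<integral>x. (norm (?h x - cgrad (\<phi> k) x))\<^sup>2 \<partial>?M)"
          using sq_integral_nonneg[of ?M "\<lambda>x. w x - \<phi> k x"] unfolding vector_minus_component by linarith
      qed
    qed (auto intro: sq_integral_nonneg)
  qed
  from field_form_limit_right[OF A weak_grad_l2_field[OF u(2)] this]
  have "(\<lambda>k. field_form (cube c s) A g (cgrad (\<phi> k))) \<longlonglongrightarrow> field_form (cube c s) A g ?h" .
  then have "field_form (cube c s) A g ?h = 0"
    using H_A_field_form[OF s A u \<phi>] by (simp add: LIMSEQ_const_iff)
  moreover have "field_form (cube c s) A g ?h = field_form (cube c s) A g h"
    by (rule field_form_cong_AE[OF A weak_grad_l2_field[OF u(2)] weak_grad_l2_field[OF u(2)] h' weak_grad_l2_field[OF w(2)]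
        _ weak_grad_unique[OF s weak_grad_wgrad[OF w(2)] w(2)]]) simp
  ultimately show ?thesis by simp
qed

section \<open>The Caccioppoli inequality\<close>

lemma caccioppoli_cutoff:
  fixes c :: "real^'d::finite"
  assumes t: "0 < t" "t < s"
  obtains \<eta> where "test_fun (cube c s) \<eta>" "\<And>x. \<bar>\<eta> x\<bar> \<le> 1" "\<And>x. x \<in> cube c t \<Longrightarrow> \<eta> x = 1"
    "\<And>x i. x \<in> cube c t \<Longrightarrow> pderiv_axis i \<eta> x = 0" "\<And>x i. \<bar>pderiv_axis i \<eta> x\<bar> \<le> 16 / 5 / (s - t)"
proof -
  define \<delta> where "\<delta> = (s - t) / 2"
  have \<delta>: "0 < \<delta>" using t by (simp add: \<delta>_def)
  define P where "P i h h' \<longleftrightarrow> smooth1 h \<and> (\<forall>r. (h has_real_derivative h' r) (at r)) \<and> (\<forall>r. 0 \<le> h r \<and> h r \<le> 1)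
      \<and> (\<forall>r. r \<le> c $ i - s / 2 + \<delta> / 16 \<or> c $ i + s / 2 - \<delta> / 16 \<le> r \<longrightarrow> h r = 0)
      \<and> (\<forall>r. c $ i - t / 2 \<le> r \<and> r \<le> c $ i + t / 2 \<longrightarrow> h r = 1 \<and> h' r = 0)
      \<and> (\<forall>r. \<bar>h' r\<bar> \<le> 16 / 5 / (s - t))" for i h h'
  have "\<exists>h h'. P i h h'" for i
  proof -
    \<comment> \<open>Of the layer \<delta> = (s - t)/2 a fraction 1/16 secures compact support and
      15/16 carries the ramp: (3/2) / (15/16 * (s - t)/2) = (16/5) / (s - t).\<close>
    let ?p = "c $ i - s / 2 + \<delta> / 16" and ?q = "c $ i + s / 2 - \<delta> / 16" and ?w = "15 / 16 * \<delta>"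
    have w: "0 < ?w" and le: "?p + ?w \<le> ?q - ?w" and e: "?p + ?w = c $ i - t / 2" "?q - ?w = c $ i + t / 2"
      and sl: "3 / 2 / ?w = 16 / 5 / (s - t)"
      using \<delta> t by (simp_all add: \<delta>_def field_simps)
    obtain h h' where h: "smooth1 h" "\<And>r. (h has_real_derivative h' r) (at r)"
      "\<And>r. 0 \<le> h r" "\<And>r. h r \<le> 1" "\<And>r. r \<le> ?p \<or> ?q \<le> r \<Longrightarrow> h r = 0"
      "\<And>r. ?p + ?w \<le> r \<Longrightarrow> r \<le> ?q - ?w \<Longrightarrow> h r = 1"
      "\<And>r. \<bar>h' r\<bar> \<le> 3 / 2 / ?w"
      "\<And>r. ?p + ?w \<le> r \<Longrightarrow> r \<le> ?q - ?w \<Longrightarrow> h' r = 0"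
      "\<And>r. r \<le> ?p \<or> ?q \<le> r \<Longrightarrow> h' r = 0"
      by (rule smooth_cutoff[OF w le]) (rule that)
    have "P i h h'"
      unfolding P_def using h(1-5) h(6,8)[unfolded e] h(7)[unfolded sl] by blast
    then show ?thesis by blast
  qed
  then obtain h h' where "\<And>i. P i (h i) (h' i)" by metis
  then have h: "\<And>i. smooth1 (h i)" "\<And>i r. (h i has_real_derivative h' i r) (at r)" "\<And>i r. 0 \<le> h i r \<and> h i r \<le> 1"
      "\<And>i r. r \<le> c $ i - s / 2 + \<delta> / 16 \<or> c $ i + s / 2 - \<delta> / 16 \<le> r \<Longrightarrow> h i r = 0"
      "\<And>i r. c $ i - t / 2 \<le> r \<and> r \<le> c $ i + t / 2 \<Longrightarrow> h i r = 1 \<and> h' i r = 0"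
      "\<And>i r. \<bar>h' i r\<bar> \<le> 16 / 5 / (s - t)"
    unfolding P_def by blast+
  define \<eta> where "\<eta> = (\<lambda>x::real^'d. \<Prod>i\<in>UNIV. h i (x $ i))"
  have pd: "pderiv_axis i \<eta> x = h' i (x $ i) * (\<Prod>j\<in>UNIV - {i}. h j (x $ j))" for i x
    unfolding \<eta>_def by (rule pderiv_prod) (use h in auto)
  have pr: "0 \<le> (\<Prod>j\<in>J. h j (x $ j))" "(\<Prod>j\<in>J. h j (x $ j)) \<le> 1" for J and x :: "real^'d"
    using h(3) by (auto intro: prod_nonneg prod_le_1)
  have inn: "c $ i - t / 2 \<le> x $ i \<and> x $ i \<le> c $ i + t / 2" if "x \<in> cube c t" for x i
    using that by (simp add: mem_cube less_imp_le)
  show ?thesis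
  proof (rule that[of \<eta>])
    show "test_fun (cube c s) \<eta>"
      unfolding \<eta>_def using \<delta>
      by (intro test_fun_tensor[of h "\<lambda>i. c $ i - s / 2 + \<delta> / 16" "\<lambda>i. c $ i + s / 2 - \<delta> / 16"] h(1,4)) auto
    show "\<bar>\<eta> x\<bar> \<le> 1" for x unfolding \<eta>_def using pr[of x UNIV] by simp
    show "\<eta> x = 1" if "x \<in> cube c t" for x
      unfolding \<eta>_def using h(5) inn[OF that] by (simp add: prod.neutral)
    show "pderiv_axis i \<eta> x = 0" if "x \<in> cube c t" for x i
      unfolding pd using h(5) inn[OF that] by simp
    show "\<bar>pderiv_axis i \<eta> x\<bar> \<le> 16 / 5 / (s - t)" for x i
    proof -
      have "\<bar>h' i (x $ i)\<bar> * \<bar>\<Prod>j\<in>UNIV - {i}. h j (x $ j)\<bar> \<le> 16 / 5 / (s - t) * 1"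
        using h(6) pr t by (intro mult_mono) (auto simp: abs_of_nonneg less_imp_le)
      then show ?thesis by (simp add: pd abs_mult)
    qed
  qed
qed

text \<open>The test function is \<open>\<eta>\<^sup>2 u\<close>, reached as the limit of \<open>\<eta>\<^sup>2 T\<^sub>n\<close> for the cosine sums \<open>T\<^sub>n\<close> of \<open>u\<close>.\<close>

lemma caccioppoli:
  fixes c :: "real^'d::finite"
  assumes t: "0 < t" "t < s" and A: "coeff_matrix (cube c s) A \<alpha> \<beta>"
    and u: "sq_integrable (lebesgue_on (cube c s)) u" and g: "weak_grad (cube c s) u g"
    and harm: "\<And>\<phi>. test_fun (cube c s) \<phi> \<Longrightarrow> field_form (cube c s) A g (cgrad \<phi>) = 0"
  shows "field_form (cube c t) A g g \<le> \<beta> * real CARD('d) * (16 / 5 / (s - t))\<^sup>2 * (\<integral>x. (u x)\<^sup>2 \<partial>lebesgue_on (cube c s))"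
proof -
  let ?M = "lebesgue_on (cube c s)"
  interpret finite_measure ?M by (rule finite_measure_cube)
  have s: "0 < s" using t by simp
  obtain \<eta> where \<eta>: "test_fun (cube c s) \<eta>" "\<And>x. \<bar>\<eta> x\<bar> \<le> 1" "\<And>x. x \<in> cube c t \<Longrightarrow> \<eta> x = 1"
    "\<And>x i. x \<in> cube c t \<Longrightarrow> pderiv_axis i \<eta> x = 0" "\<And>x i. \<bar>pderiv_axis i \<eta> x\<bar> \<le> 16 / 5 / (s - t)"
    by (rule caccioppoli_cutoff[OF t]) (rule that)
  define L where "L = 16 / 5 / (s - t)"
  have L0: "0 \<le> L" using t by (simp add: L_def)
  have sm: "smooth_fun \<eta>" by (rule test_fun_props(1)[OF \<eta>(1)])
  have \<eta>m: "\<eta> \<in> borel_measurable ?M" "pderiv_axis i \<eta> \<in> borel_measurable ?M" for i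
    by (intro continuous_measurable_cube test_fun_props[OF \<eta>(1)])+
  define D where "D x = (\<chi> i. pderiv_axis i \<eta> x)" for x
  have DL: "\<bar>D x $ i\<bar> \<le> L" for x i using \<eta>(5)[of i x] by (simp only: D_def vec_lambda_beta L_def)
  have m1: "(\<lambda>x. \<eta> x * \<eta> x) \<in> borel_measurable ?M" by (intro borel_measurable_times \<eta>m)
  have m2: "(\<lambda>x. 2 * \<eta> x * D x $ i) \<in> borel_measurable ?M" for i
    unfolding D_def vec_lambda_beta by (intro borel_measurable_times borel_measurable_const \<eta>m)
  have b1: "\<bar>\<eta> x * \<eta> x\<bar> \<le> 1" for x using mult_mono[OF \<eta>(2)[of x] \<eta>(2)[of x]] by (simp add: abs_mult)
  have b2: "\<bar>2 * \<eta> x * D x $ i\<bar> \<le> 2 * L" for x i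
    using mult_mono[OF \<eta>(2)[of x] \<eta>(5)[of i x]] L0 by (simp add: abs_mult D_def L_def)
  define T where "T = trig_sum c s (\<lambda>_. True) u"
  have Tl: "l2_lim ?M T u" unfolding T_def by (rule trig_sum_converges[OF s u])
  have Tsm: "smooth_fun (T n)" for n unfolding T_def by (rule smooth_fun_trig_sum)
  define \<phi> where "\<phi> n = (\<lambda>x. \<eta> x * T n x * \<eta> x)" for n
  have \<phi>t: "test_fun (cube c s) (\<phi> n)" for n
    unfolding \<phi>_def by (intro test_fun_mult[OF \<eta>(1)] smooth_fun_mult sm Tsm)
  \<comment> \<open>The gradient of \<open>\<eta>\<^sup>2 u\<close>, as the limit of the gradients
    of the test functions.\<close>
  define V where "V x = (\<eta> x)\<^sup>2 *\<^sub>R g x + (2 * \<eta> x * u x) *\<^sub>R D x" for x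
  have lim: "l2_lim ?M (\<lambda>n x. cgrad (\<phi> n) x $ i) (\<lambda>x. V x $ i)" for i
  proof -
    have "l2_lim ?M (\<lambda>n x. \<eta> x * \<eta> x * pderiv_axis i (T n) x + 2 * \<eta> x * D x $ i * T n x)
       (\<lambda>x. \<eta> x * \<eta> x * g x $ i + 2 * \<eta> x * D x $ i * u x)"
      unfolding T_def
      by (intro l2_lim_add l2_lim_bounded_mult[OF pderiv_trig_sum_converges[OF s u g] m1, where B=1]
          l2_lim_bounded_mult[OF trig_sum_converges[OF s u] m2, where B="2 * L"] b1 b2)
    moreover have "cgrad (\<phi> n) x $ i = \<eta> x * \<eta> x * pderiv_axis i (T n) x + 2 * \<eta> x * D x $ i * T n x" for n x
      unfolding cgrad_def \<phi>_def vec_lambda_beta D_def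
      by (simp only: pderiv_mult[OF smooth_fun_mult[OF sm Tsm] sm] pderiv_mult[OF sm Tsm]) (simp add: algebra_simps)
    moreover have "V x $ i = \<eta> x * \<eta> x * g x $ i + 2 * \<eta> x * D x $ i * u x" for x
      by (simp add: V_def power2_eq_square)
    ultimately show ?thesis by simp
  qed
  have gl: "l2_field (cube c s) g" by (rule weak_grad_l2_field[OF g])
  have Vl: "l2_field (cube c s) V" unfolding l2_field_def using l2_lim_sq_integrable(2)[OF lim] by simp
  have z: "field_form (cube c s) A g V = 0"
    using field_form_limit_right[OF A gl lim] harm[OF \<phi>t] by (simp add: LIMSEQ_const_iff)
  define uD where "uD x = u x *\<^sub>R D x" for x
  have uDl: "l2_field (cube c s) uD"
    unfolding l2_field_def
  proof
    fix i
    have "sq_integrable ?M (\<lambda>x. D x $ i * u x)"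
      by (rule sq_integrable_bounded_mult[OF u _ DL]) (simp add: D_def \<eta>m)
    then show "sq_integrable ?M (\<lambda>x. uD x $ i)" by (simp add: uD_def mult.commute)
  qed
  \<comment> \<open>The gradient of \<open>\<eta> u\<close>. By symmetry of \<open>A\<close> its
    energy is exactly the pairing of \<open>g\<close> with \<open>V\<close> plus the energy of
    \<open>u\<close> times the cutoff gradient. The first term is 0, so nothing has to be absorbed
    by Young's inequality and the constant in front is 1.\<close>
  define W where "W x = \<eta> x *\<^sub>R g x + uD x" for x
  have Wl: "l2_field (cube c s) W"
    unfolding W_def
  proof (intro l2_field_add uDl)
    show "l2_field (cube c s) (\<lambda>x. \<eta> x *\<^sub>R g x)"
      unfolding l2_field_def
      using sq_integrable_bounded_mult[OF l2_fieldD[OF gl] \<eta>m(1), where B=1] \<eta>(2) by simp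
  qed
  have "field_form (cube c s) A W W = field_form (cube c s) A g V + field_form (cube c s) A uD uD"
  proof -
    have "field_form (cube c s) A W W = (\<integral>x. (A x *v g x) \<bullet> V x + (A x *v uD x) \<bullet> uD x \<partial>?M)"
      unfolding field_form_def
    proof (intro Bochner_Integration.integral_cong refl)
      fix x assume "x \<in> space ?M"
      then have x: "x \<in> cube c s" by simp
      have *: "(A x *v uD x) \<bullet> g x = (A x *v g x) \<bullet> uD x" by (rule coeff_matrix_props(6)[OF A x])
      show "(A x *v W x) \<bullet> W x = (A x *v g x) \<bullet> V x + (A x *v uD x) \<bullet> uD x"
        unfolding W_def
        by (simp add: matrix_vector_right_distrib matrix_vector_mult_scaleR inner_add_left inner_add_right *)
          (simp add: V_def uD_def inner_add_right power2_eq_square algebra_simps matrix_vector_mult_scaleR)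
    qed
    then show ?thesis
      using field_form_integrable[OF A gl Vl] field_form_integrable[OF A uDl uDl] by (simp add: field_form_def)
  qed
  also have "\<dots> \<le> \<beta> * (\<Sum>i\<in>(UNIV::'d set). \<integral>x. (uD x $ i)\<^sup>2 \<partial>?M)"
    using z field_form_bounds(2)[OF A uDl] by simp
  also have "(\<Sum>i\<in>(UNIV::'d set). \<integral>x. (uD x $ i)\<^sup>2 \<partial>?M) \<le> (\<Sum>i\<in>(UNIV::'d set). L\<^sup>2 * (\<integral>x. (u x)\<^sup>2 \<partial>?M))"
  proof (rule sum_mono)
    fix i
    have "(\<integral>x. (uD x $ i)\<^sup>2 \<partial>?M) \<le> (\<integral>x. L\<^sup>2 * (u x)\<^sup>2 \<partial>?M)"
    proof (rule integral_mono)
      show "integrable ?M (\<lambda>x. (uD x $ i)\<^sup>2)" by (rule sq_integrable_square[OF l2_fieldD[OF uDl]])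
      show "integrable ?M (\<lambda>x. L\<^sup>2 * (u x)\<^sup>2)" using sq_integrable_square[OF u] by simp
      fix x
      have "\<bar>D x $ i\<bar> \<le> \<bar>L\<bar>" using \<eta>(5)[of i x] L0 by (simp add: D_def L_def)
      then have "(D x $ i)\<^sup>2 \<le> L\<^sup>2" by (simp only: abs_le_square_iff)
      then have "(D x $ i)\<^sup>2 * (u x)\<^sup>2 \<le> L\<^sup>2 * (u x)\<^sup>2" by (rule mult_right_mono) simp
      then show "(uD x $ i)\<^sup>2 \<le> L\<^sup>2 * (u x)\<^sup>2" by (simp add: uD_def power_mult_distrib mult.commute)
    qed
    then show "(\<integral>x. (uD x $ i)\<^sup>2 \<partial>?M) \<le> L\<^sup>2 * (\<integral>x. (u x)\<^sup>2 \<partial>?M)" by simp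
  qed
  also have "\<beta> * (\<Sum>i\<in>(UNIV::'d set). L\<^sup>2 * (\<integral>x. (u x)\<^sup>2 \<partial>?M)) = \<beta> * real CARD('d) * L\<^sup>2 * (\<integral>x. (u x)\<^sup>2 \<partial>?M)"
    by simp
  finally have W: "field_form (cube c s) A W W \<le> \<beta> * real CARD('d) * L\<^sup>2 * (\<integral>x. (u x)\<^sup>2 \<partial>?M)"
    using coeff_matrix_props(2)[OF A] by (simp add: mult_left_mono)
  have sub: "cube c t \<subseteq> cube c s" using t by (intro cube_mono) simp
  \<comment> \<open>On the inner cube \<eta> is 1 and its gradient is 0, so \<open>W\<close> equals
    \<open>g\<close> there; the indicator extends the integral to the large cube.\<close>
  have "field_form (cube c t) A g g = (\<integral>x. indicator (cube c t) x *\<^sub>R ((A x *v W x) \<bullet> W x) \<partial>?M)"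
  proof -
    have "field_form (cube c t) A g g = (\<integral>x. (A x *v W x) \<bullet> W x \<partial>lebesgue_on (cube c t))"
      unfolding field_form_def
      by (intro Bochner_Integration.integral_cong refl) (simp add: W_def uD_def D_def \<eta>(3,4) zero_vec_def[symmetric])
    also have "\<dots> = (\<integral>x. indicator (cube c t) x *\<^sub>R ((A x *v W x) \<bullet> W x) \<partial>lebesgue_on (cube c t))"
      by (intro Bochner_Integration.integral_cong refl) simp
    also have "\<dots> = (\<integral>x. indicator (cube c t) x *\<^sub>R ((A x *v W x) \<bullet> W x) \<partial>?M)"
      by (rule integral_lebesgue_on_subset[OF sub]) auto
    finally show ?thesis .
  qed
  also have "\<dots> \<le> field_form (cube c s) A W W"
    unfolding field_form_def
  proof (rule integral_mono)
    show "integrable ?M (\<lambda>x. (A x *v W x) \<bullet> W x)" by (rule field_form_integrable[OF A Wl Wl])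
    then show "integrable ?M (\<lambda>x. indicator (cube c t) x *\<^sub>R ((A x *v W x) \<bullet> W x))"
      by (intro integrable_mult_indicator) (auto simp: sets_restrict_space_iff sub)
    fix x assume "x \<in> space ?M"
    then have "\<alpha> * (norm (W x))\<^sup>2 \<le> (A x *v W x) \<bullet> W x" using coeff_matrix_props(4)[OF A] by simp
    then have "0 \<le> (A x *v W x) \<bullet> W x"
      using coeff_matrix_props(1)[OF A] by (meson mult_nonneg_nonneg order_trans less_imp_le zero_le_power2)
    then show "indicator (cube c t) x *\<^sub>R ((A x *v W x) \<bullet> W x) \<le> (A x *v W x) \<bullet> W x"
      by (simp add: indicator_def)
  qed
  finally show ?thesis using W unfolding L_def by simp
qed

subsection \<open>Compactness and the Neumann spectrum\<close>

text \<open>Gaussian elimination: each step solves one equation for a pivot unknown and substitutes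
  it into the remaining equations.\<close>

lemma underdetermined_system:
  fixes a :: "'k \<Rightarrow> 'j \<Rightarrow> real"
  assumes "finite F" "finite J" "card F < card J"
  shows "\<exists>x. (\<exists>j\<in>J. x j \<noteq> 0) \<and> (\<forall>k\<in>F. (\<Sum>j\<in>J. a k j * x j) = 0)"
  using assms
proof (induction F arbitrary: J a rule: finite_induct)
  case empty
  then show ?case by (intro exI[of _ "\<lambda>_. 1"]) (auto simp: card_gt_0_iff)
next
  case (insert k F)
  show ?case
  proof (cases "\<forall>j\<in>J. a k j = 0")
    case True
    have "card F < card J" using insert by simp
    from insert.IH[OF insert.prems(1) this, of a] show ?thesis using True by auto
  next
    case False
    then obtain j0 where j0: "j0 \<in> J" "a k j0 \<noteq> 0" by blast
    let ?J = "J - {j0}"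
    have "card F < card ?J" using insert j0 by (simp add: card_Diff_singleton)
    from insert.IH[OF _ this, of "\<lambda>l j. a l j - a l j0 * a k j / a k j0"] insert.prems(1)
    obtain x where x: "\<exists>j\<in>?J. x j \<noteq> 0" "\<And>l. l \<in> F \<Longrightarrow> (\<Sum>j\<in>?J. (a l j - a l j0 * a k j / a k j0) * x j) = 0"
      by auto
    define r where "r = (\<Sum>j\<in>?J. a k j * x j)"
    define y where "y = x(j0 := - r / a k j0)"
    have split: "(\<Sum>j\<in>J. a l j * y j) = a l j0 * (- r / a k j0) + (\<Sum>j\<in>?J. a l j * x j)" for l
    proof -
      have "(\<Sum>j\<in>J. a l j * y j) = a l j0 * y j0 + (\<Sum>j\<in>?J. a l j * y j)"
        by (rule sum.remove[OF insert.prems(1) j0(1)])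
      moreover have "(\<Sum>j\<in>?J. a l j * y j) = (\<Sum>j\<in>?J. a l j * x j)"
        by (intro sum.cong) (auto simp: y_def)
      ultimately show ?thesis by (simp add: y_def)
    qed
    have "(\<Sum>j\<in>J. a l j * y j) = 0" if "l \<in> F" for l
    proof -
      have "(\<Sum>j\<in>?J. (a l j - a l j0 * a k j / a k j0) * x j)
          = (\<Sum>j\<in>?J. a l j * x j) - (\<Sum>j\<in>?J. a l j0 / a k j0 * (a k j * x j))"
        unfolding sum_subtractf[symmetric] by (intro sum.cong) (auto simp: algebra_simps)
      also have "\<dots> = (\<Sum>j\<in>?J. a l j * x j) - a l j0 / a k j0 * r"
        by (simp only: r_def sum_distrib_left)
      finally show ?thesis using x(2)[OF that] split[of l] by simp
    qed
    moreover have "(\<Sum>j\<in>J. a k j * y j) = 0" using split[of k] j0 by (simp add: r_def)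
    moreover have "\<exists>j\<in>J. y j \<noteq> 0" using x(1) by (auto simp: y_def)
    ultimately show ?thesis by auto
  qed
qed

text \<open>The first-order condition at a minimum. Comparing \<open>c\<close> with the positive
  number |c| + 1 avoids a case split on its sign.\<close>

lemma quadratic_nonneg_imp_linear_zero:
  fixes b c :: real
  assumes "\<And>t. 0 \<le> 2 * t * b + t\<^sup>2 * c"
  shows "b = 0"
proof (rule ccontr)
  assume b: "b \<noteq> 0"
  define d where "d = \<bar>c\<bar> + 1"
  have d: "0 < d" "c \<le> d" by (auto simp: d_def)
  have "0 \<le> 2 * (- b / d) * b + (- b / d)\<^sup>2 * c" by (rule assms)
  also have "\<dots> \<le> 2 * (- b / d) * b + (- b / d)\<^sup>2 * d" using d by (intro add_left_mono mult_left_mono) auto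
  also have "\<dots> = - (b\<^sup>2 / d)" using d by (simp add: power2_eq_square field_simps)
  also have "\<dots> < 0" using b d by simp
  finally show False by simp
qed

text \<open>Gram-Schmidt by induction on the number of fields, in a form that tolerates linearly
  dependent fields; independence of the gradients of the harmonic extensions therefore never has to
  be shown. If the orthogonalized last field has zero energy, its pairing with everything is 0 and
  the coefficient x / 0 = 0 is correct.\<close>

lemma field_form_projection:
  fixes n :: nat
  assumes A: "coeff_matrix S A \<alpha> \<beta>"
  shows "l2_field S F \<Longrightarrow> (\<And>i. i < n \<Longrightarrow> l2_field S (W i)) \<Longrightarrow>
    \<exists>c. \<forall>k<n. field_form S A (\<lambda>x. F x - (\<Sum>i<n. c i *\<^sub>R W i x)) (W k) = 0"
proof (induction n arbitrary: F)
  case 0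
  then show ?case by simp
next
  case (Suc n)
  have W: "l2_field S (W i)" if "i < Suc n" for i using Suc.prems(2) that by simp
  have "\<exists>c. \<forall>k<n. field_form S A (\<lambda>x. F x - (\<Sum>i<n. c i *\<^sub>R W i x)) (W k) = 0"
    by (rule Suc.IH[OF Suc.prems(1) W[OF less_SucI]])
  then obtain c where c: "\<And>k. k < n \<Longrightarrow> field_form S A (\<lambda>x. F x - (\<Sum>i<n. c i *\<^sub>R W i x)) (W k) = 0" by blast
  have "\<exists>c. \<forall>k<n. field_form S A (\<lambda>x. W n x - (\<Sum>i<n. c i *\<^sub>R W i x)) (W k) = 0"
    by (rule Suc.IH[OF W[OF lessI] W[OF less_SucI]])
  then obtain e where e: "\<And>k. k < n \<Longrightarrow> field_form S A (\<lambda>x. W n x - (\<Sum>i<n. e i *\<^sub>R W i x)) (W k) = 0" by blast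
  define F' where "F' x = F x - (\<Sum>i<n. c i *\<^sub>R W i x)" for x
  \<comment> \<open>The last field made orthogonal to the earlier ones, so that adding a multiple of
    it does not spoil the conditions already met.\<close>
  define V where "V x = W n x - (\<Sum>i<n. e i *\<^sub>R W i x)" for x
  have l: "l2_field S F'" "l2_field S V"
    unfolding F'_def V_def using Suc.prems(1) W by (intro l2_field_diff l2_field_sum l2_field_scale; simp)+
  define t where "t = field_form S A F' V / field_form S A V V"
  have FV: "field_form S A F' V = t * field_form S A V V"
  proof (cases "field_form S A V V = 0")
    case True
    have "0 \<le> 2 * r * field_form S A V F' + r\<^sup>2 * field_form S A F' F'" for r
    proof -
      let ?X = "\<lambda>x. V x + r *\<^sub>R F' x"
      have "0 \<le> field_form S A ?X ?X" by (rule field_form_nonneg[OF A])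
      also have "field_form S A ?X ?X = field_form S A V V + 2 * r * field_form S A V F' + r\<^sup>2 * field_form S A F' F'"
        using l by (simp add: field_form_add_right[OF A] field_form_add_left[OF A] l2_field_add l2_field_scale
            field_form_scale_right field_form_scale_left[OF A] field_form_sym[OF A, of F' V] power2_eq_square algebra_simps)
      finally show ?thesis using True by simp
    qed
    then have "field_form S A V F' = 0" by (rule quadratic_nonneg_imp_linear_zero)
    then show ?thesis using True field_form_sym[OF A, of F' V] by simp
  qed (simp add: t_def)
  let ?c = "\<lambda>i. if i = n then t else c i - t * e i"
  have R: "F x - (\<Sum>i<Suc n. ?c i *\<^sub>R W i x) = F' x - t *\<^sub>R V x" for x
  proof -
    have "(\<Sum>i<n. ?c i *\<^sub>R W i x) = (\<Sum>i<n. c i *\<^sub>R W i x) - t *\<^sub>R (\<Sum>i<n. e i *\<^sub>R W i x)"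
      unfolding scaleR_sum_right sum_subtractf[symmetric] by (intro sum.cong) (auto simp: scaleR_diff_left)
    then show ?thesis by (simp add: F'_def V_def algebra_simps)
  qed
  have B: "field_form S A (\<lambda>x. F' x - t *\<^sub>R V x) H = field_form S A F' H - t * field_form S A V H" if "l2_field S H" for H
    using that l by (simp add: field_form_diff_left[OF A] l2_field_scale field_form_scale_left[OF A])
  have lt: "field_form S A (\<lambda>x. F' x - t *\<^sub>R V x) (W k) = 0" if "k < n" for k
    using that c[OF that] e[OF that] W[of k] B unfolding F'_def[symmetric] V_def[symmetric] by simp
  have "field_form S A (\<lambda>x. F' x - t *\<^sub>R V x) (W n) = 0"
  proof -
    have Wn: "W n = (\<lambda>x. V x + (\<Sum>i<n. e i *\<^sub>R W i x))" by (simp add: V_def)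
    have sl: "l2_field S (\<lambda>x. \<Sum>i<n. e i *\<^sub>R W i x)" using W by (intro l2_field_sum l2_field_scale) simp
    have tl: "l2_field S (\<lambda>x. F' x - t *\<^sub>R V x)" by (intro l2_field_diff l2_field_scale l)
    have "field_form S A (\<lambda>x. F' x - t *\<^sub>R V x) (W n) = field_form S A (\<lambda>x. F' x - t *\<^sub>R V x) V
       + field_form S A (\<lambda>x. F' x - t *\<^sub>R V x) (\<lambda>x. \<Sum>i<n. e i *\<^sub>R W i x)"
      by (subst Wn) (rule field_form_add_right[OF A tl l(2) sl])
    also have "field_form S A (\<lambda>x. F' x - t *\<^sub>R V x) (\<lambda>x. \<Sum>i<n. e i *\<^sub>R W i x) = 0"
      using lt W by (subst field_form_sum_right[OF A tl]) (auto intro: l2_field_scale simp: field_form_scale_right)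
    also have "field_form S A (\<lambda>x. F' x - t *\<^sub>R V x) V = 0" using B[OF l(2)] FV by simp
    finally show ?thesis by simp
  qed
  then show ?case using lt R by (intro exI[of _ ?c]) (auto simp: less_Suc_eq)
qed

section \<open>Compactness and minimizers of the energy quotient\<close>

lemma trig_coeff_diff:
  assumes "sq_integrable (lebesgue_on (cube c s)) u" "sq_integrable (lebesgue_on (cube c s)) v"
  shows "trig_coeff c s \<tau> (\<lambda>x. u x - v x) k = trig_coeff c s \<tau> u k - trig_coeff c s \<tau> v k"
  using sq_integrable_prod[OF assms(1) trig_prod_sq_integrable[of c s c s \<tau> k]]
    sq_integrable_prod[OF assms(2) trig_prod_sq_integrable[of c s c s \<tau> k]]
  by (simp add: trig_coeff_def left_diff_distrib)

text \<open>Tychonoff's theorem in place of a diagonal extraction: countability of the index type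
  makes the compact product sequentially compact.\<close>

lemma bounded_sequences_subsequence:
  fixes q :: "nat \<Rightarrow> 'k::countable \<Rightarrow> real"
  assumes "\<And>n k. \<bar>q n k\<bar> \<le> b k"
  obtains r l where "strict_mono r" "\<And>k. (\<lambda>n. q (r n) k) \<longlonglongrightarrow> l k"
proof -
  define P where "P = PiE UNIV (\<lambda>k. {- b k..b k})"
  have "compactin (product_topology (\<lambda>_. euclidean) UNIV) P"
    unfolding P_def by (subst compactin_PiE) auto
  then have "compact P" by (simp add: euclidean_product_topology)
  then have "seq_compact P" by (rule compact_imp_seq_compact)
  moreover have "q n \<in> P" for n using assms[of n] by (auto simp: P_def abs_le_iff minus_le_iff)
  ultimately obtain l r where r: "strict_mono r" "(q \<circ> r) \<longlonglongrightarrow> l"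
    unfolding seq_compact_def by metis
  have "(\<lambda>n. q (r n) k) \<longlonglongrightarrow> l k" for k
    using continuous_on_tendsto_compose[OF continuous_on_product_coordinates[of k] r(2)] by (simp add: o_def)
  then show ?thesis using that r(1) by blast
qed

text \<open>Along a subsequence every cosine coefficient converges. For a difference of two members
  the finitely many low modes are then small, and the spectral inequality bounds the rest by the
  gradients divided by the square of the cutoff frequency.\<close>

lemma rellich:
  fixes c :: "real^'d::finite" and u :: "nat \<Rightarrow> real^'d \<Rightarrow> real"
  assumes s: "0 < s" and u: "\<And>n. sq_integrable (lebesgue_on (cube c s)) (u n)"
    and g: "\<And>n. weak_grad (cube c s) (u n) (g n)"
    and R: "\<And>n. (\<integral>x. (u n x)\<^sup>2 \<partial>lebesgue_on (cube c s)) \<le> R"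
      "\<And>n. (\<Sum>i\<in>UNIV. \<integral>x. (g n x $ i)\<^sup>2 \<partial>lebesgue_on (cube c s)) \<le> R"
  obtains r U where "strict_mono r" "l2_lim (lebesgue_on (cube c s)) (\<lambda>n. u (r n)) U"
proof -
  let ?M = "lebesgue_on (cube c s)" and ?N = "trig_prod_norm s (\<lambda>_::'d. True)"
  interpret finite_measure ?M by (rule finite_measure_cube)
  define q where "q n k = trig_coeff c s (\<lambda>_. True) (u n) k" for n k
  have N0: "0 \<le> ?N k" for k using s by (intro trig_norm_nonneg) simp
  have R0: "0 \<le> R" using R(1)[of 0] sq_integral_nonneg[of ?M "u 0"] by linarith
  have "\<bar>q n k\<bar> \<le> R * ?N k + 1" for n k
  proof -
    have "(q n k)\<^sup>2 \<le> (\<integral>x. (u n x)\<^sup>2 \<partial>?M) * (\<integral>x. (trig_prod c s (\<lambda>_. True) k x)\<^sup>2 \<partial>?M)"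
      unfolding q_def trig_coeff_def by (rule Cauchy_Schwarz_integral[OF u trig_prod_sq_integrable])
    also have "\<dots> \<le> R * ?N k"
      unfolding trig_prod_norm_eq[OF s] by (intro mult_right_mono R N0)
    finally have "(q n k)\<^sup>2 \<le> R * ?N k" .
    moreover have "\<bar>y\<bar> \<le> y\<^sup>2 + 1" for y :: real
    proof -
      have "0 \<le> (\<bar>y\<bar> - 1)\<^sup>2" by simp
      then show ?thesis by (simp add: power2_diff)
    qed
    ultimately show ?thesis by (meson add_right_mono order_trans)
  qed
  then obtain r l where r: "strict_mono r" and l: "\<And>k. (\<lambda>n. q (r n) k) \<longlonglongrightarrow> l k"
    using bounded_sequences_subsequence[of q "\<lambda>k. R * ?N k + 1"] by metis
  have "\<exists>n0. \<forall>m\<ge>n0. \<forall>n\<ge>n0. (\<integral>x. (u (r m) x - u (r n) x)\<^sup>2 \<partial>?M) < e" if e: "0 < e" for e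
  proof -
    \<comment> \<open>Chosen so that the gradients of a difference, whose squares sum to at most
      \<open>4 * R\<close>, contribute less than e/2 after division by \<open>L\<close>; the
      successor in \<open>L\<close> keeps it positive.\<close>
    obtain K where K: "8 * R * s\<^sup>2 / e < real K" using reals_Archimedean2 by blast
    define L where "L = (pi * real (Suc K) / s)\<^sup>2"
    have L0: "0 < L" using s by (simp add: L_def)
    have Ls: "real (Suc K) / s\<^sup>2 \<le> L"
    proof -
      have p: "1 \<le> pi * pi" using mult_mono[of 1 pi 1 pi] pi_ge_two by simp
      have k: "real (Suc K) \<le> real (Suc K) * real (Suc K)" by simp
      have "1 * real (Suc K) \<le> (pi * pi) * (real (Suc K) * real (Suc K))" using p k by (intro mult_mono) auto
      then show ?thesis unfolding L_def power_divide by (intro divide_right_mono) (auto simp: power2_eq_square mult_ac)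
    qed
    have "8 * R / e < real (Suc K) / s\<^sup>2"
      using K s by (simp add: field_simps)
    then have "8 * R / e < L" using Ls by (rule less_le_trans)
    then have RL: "4 * R < L * (e / 2)" using e by (simp add: field_simps)
    define T where "T n = (\<Sum>k\<in>freq_box (Suc K). (q (r n) k - l k)\<^sup>2 / ?N k)" for n
    have "T \<longlonglongrightarrow> (\<Sum>k\<in>freq_box (Suc K). (l k - l k)\<^sup>2 / ?N k)"
      unfolding T_def divide_inverse by (intro tendsto_intros l)
    then have "T \<longlonglongrightarrow> 0" by simp
    then obtain n0 where n0: "\<And>n. n \<ge> n0 \<Longrightarrow> T n < e / 8"
      using order_tendstoD(2)[of T 0 sequentially "e / 8"] e unfolding eventually_sequentially by auto
    have "(\<integral>x. (u (r m) x - u (r n) x)\<^sup>2 \<partial>?M) < e" if mn: "m \<ge> n0" "n \<ge> n0" for m n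
    proof -
      let ?w = "\<lambda>x. u (r m) x - u (r n) x" and ?h = "\<lambda>x. g (r m) x - g (r n) x"
      have "L * (\<integral>x. (?w x)\<^sup>2 \<partial>?M) \<le> L * (\<Sum>k\<in>freq_box (Suc K). (trig_coeff c s (\<lambda>_. True) ?w k)\<^sup>2 / ?N k)
          + (\<Sum>i\<in>UNIV. \<integral>x. (?h x $ i)\<^sup>2 \<partial>?M)"
        unfolding L_def by (rule cube_spectral_inequality[OF s sq_integrable_diff[OF u u] weak_grad_diff[OF u g u g]])
      also have "(\<Sum>k\<in>freq_box (Suc K). (trig_coeff c s (\<lambda>_. True) ?w k)\<^sup>2 / ?N k)
          \<le> (\<Sum>k\<in>freq_box (Suc K). 2 * ((q (r m) k - l k)\<^sup>2 / ?N k) + 2 * ((q (r n) k - l k)\<^sup>2 / ?N k))"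
      proof (rule sum_mono)
        fix k
        have "(a - b)\<^sup>2 \<le> 2 * (a - y)\<^sup>2 + 2 * (b - y)\<^sup>2" for a b y :: real
          using zero_le_power2[of "(a - y) + (b - y)"] by (simp add: power2_eq_square algebra_simps)
        then have "(q (r m) k - q (r n) k)\<^sup>2 / ?N k \<le> (2 * (q (r m) k - l k)\<^sup>2 + 2 * (q (r n) k - l k)\<^sup>2) / ?N k"
          by (intro divide_right_mono N0)
        then show "(trig_coeff c s (\<lambda>_. True) ?w k)\<^sup>2 / ?N k
            \<le> 2 * ((q (r m) k - l k)\<^sup>2 / ?N k) + 2 * ((q (r n) k - l k)\<^sup>2 / ?N k)"
          by (simp add: trig_coeff_diff[OF u u] q_def add_divide_distrib)
      qed
      also have "\<dots> = 2 * T m + 2 * T n" by (simp add: T_def sum.distrib sum_distrib_left)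
      also have "(\<Sum>i\<in>UNIV. \<integral>x. (?h x $ i)\<^sup>2 \<partial>?M)
          \<le> (\<Sum>i\<in>UNIV. 2 * (\<integral>x. (g (r m) x $ i)\<^sup>2 \<partial>?M) + 2 * (\<integral>x. (g (r n) x $ i)\<^sup>2 \<partial>?M))"
        using sq_integral_triangle[OF weak_gradD(1)[OF g] sq_integrable_zero weak_gradD(1)[OF g]]
        by (intro sum_mono) simp
      also have "\<dots> \<le> 2 * R + 2 * R"
        unfolding sum.distrib sum_distrib_left[symmetric] using R(2)[of "r m"] R(2)[of "r n"] by linarith
      finally have "L * (\<integral>x. (?w x)\<^sup>2 \<partial>?M) \<le> L * (2 * T m + 2 * T n) + (2 * R + 2 * R)"
        using L0 by (simp add: mult_left_mono)
      also have "\<dots> \<le> L * (e / 2) + 4 * R"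
        using n0[OF mn(1)] n0[OF mn(2)] L0 by (intro add_mono mult_left_mono) auto
      also have "\<dots> < L * (e / 2) + L * (e / 2)" using RL by simp
      also have "\<dots> = L * e" by (simp add: algebra_simps)
      finally show ?thesis using L0 by simp
    qed
    then show ?thesis by blast
  qed
  from Riesz_Fischer[OF u this] obtain U where "l2_lim ?M (\<lambda>n. u (r n)) U" by blast
  then show ?thesis using that r by blast
qed

text \<open>By the parallelogram identity a minimizing sequence that converges in mean square also has
  convergent gradients.\<close>

lemma rayleigh_minimizer:
  fixes c :: "real^'d::finite" and p :: "'i \<Rightarrow> real^'d \<Rightarrow> real"
  defines "M \<equiv> \<lambda>s. lebesgue_on (cube c s)"
  assumes s: "0 < s" and A: "coeff_matrix (cube c s) A \<alpha> \<beta>"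
    and p: "\<And>i. i \<in> I \<Longrightarrow> sq_integrable (M s) (p i)"
    and w0: "sq_integrable (M s) w0" "weak_grad (cube c s) w0 h0" "\<And>i. i \<in> I \<Longrightarrow> (\<integral>x. p i x * w0 x \<partial>M s) = 0"
      "(\<integral>x. (w0 x)\<^sup>2 \<partial>M s) \<noteq> 0"
  obtains U G where "sq_integrable (M s) U" "weak_grad (cube c s) U G" "(\<integral>x. (U x)\<^sup>2 \<partial>M s) = 1"
    "\<And>i. i \<in> I \<Longrightarrow> (\<integral>x. p i x * U x \<partial>M s) = 0"
    "\<And>w h. sq_integrable (M s) w \<Longrightarrow> weak_grad (cube c s) w h \<Longrightarrow> (\<forall>i\<in>I. (\<integral>x. p i x * w x \<partial>M s) = 0)
      \<Longrightarrow> field_form (cube c s) A G G * (\<integral>x. (w x)\<^sup>2 \<partial>M s) \<le> field_form (cube c s) A h h"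
proof -
  let ?M = "M s" and ?S = "cube c s"
  interpret finite_measure ?M unfolding M_def by (rule finite_measure_cube)
  let ?E = "\<lambda>h. field_form ?S A h h"
  have \<alpha>: "0 < \<alpha>" by (rule coeff_matrix_props(1)[OF A])
  define adm where "adm w h \<longleftrightarrow> sq_integrable ?M w \<and> weak_grad ?S w h \<and> (\<forall>i\<in>I. (\<integral>x. p i x * w x \<partial>?M) = 0)" for w h
  have admD: "sq_integrable ?M w" "weak_grad ?S w h" "l2_field ?S h" "i \<in> I \<Longrightarrow> (\<integral>x. p i x * w x \<partial>?M) = 0" if "adm w h" for w h i
    using that by (auto simp: adm_def intro: weak_grad_l2_field)
  have adm_scale: "adm (\<lambda>x. a * w x) (\<lambda>x. a *\<^sub>R h x)" if "adm w h" for a w h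
  proof -
    have "(\<integral>x. p i x * (a * w x) \<partial>?M) = a * (\<integral>x. p i x * w x \<partial>?M)" for i
      by (simp add: mult.left_commute)
    then show ?thesis using that unfolding adm_def by (auto intro: sq_integrable_cmult weak_grad_cmult)
  qed
  have adm_add: "adm (\<lambda>x. w x + w' x) (\<lambda>x. h x + h' x)" if "adm w h" "adm w' h'" for w h w' h'
  proof -
    have "(\<integral>x. p i x * (w x + w' x) \<partial>?M) = 0" if i: "i \<in> I" for i
      using sq_integrable_prod[OF p[OF i] admD(1)[OF \<open>adm w h\<close>]] sq_integrable_prod[OF p[OF i] admD(1)[OF \<open>adm w' h'\<close>]]
        admD(4)[OF \<open>adm w h\<close> i] admD(4)[OF \<open>adm w' h'\<close> i] by (simp add: distrib_left)
    then show ?thesis unfolding adm_def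
      using admD(1,2)[OF \<open>adm w h\<close>] admD(1,2)[OF \<open>adm w' h'\<close>] unfolding M_def
      by (auto intro: sq_integrable_add weak_grad_add)
  qed
  define Q where "Q = {?E h | w h. adm w h \<and> (\<integral>x. (w x)\<^sup>2 \<partial>?M) = 1}"
  define m where "m = Inf Q"
  have norm1: "(\<integral>x. (inverse (sqrt (\<integral>x. (w x)\<^sup>2 \<partial>?M)) * w x)\<^sup>2 \<partial>?M) = 1" if "(\<integral>x. (w x)\<^sup>2 \<partial>?M) \<noteq> 0" for w :: "real^'d \<Rightarrow> real"
    using that sq_integral_nonneg[of ?M w] by (simp add: power_mult_distrib power_inverse)
  have a0: "adm w0 h0" using w0 by (simp add: adm_def)
  have Qne: "Q \<noteq> {}"
    unfolding Q_def using adm_scale[OF a0, of "inverse (sqrt (\<integral>x. (w0 x)\<^sup>2 \<partial>?M))"] norm1[OF w0(4)] by blast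
  have Qbd: "bdd_below Q" unfolding Q_def by (intro bdd_belowI[of _ 0]) (auto intro: field_form_nonneg[OF A])
  have m0: "0 \<le> m" unfolding m_def by (rule cInf_greatest[OF Qne]) (auto simp: Q_def intro: field_form_nonneg[OF A])
  \<comment> \<open>The homogeneous form of the infimum, usable for functions that are not
    normalized, such as sums of two members of the minimizing sequence.\<close>
  have low: "m * (\<integral>x. (w x)\<^sup>2 \<partial>?M) \<le> ?E h" if a: "adm w h" for w h
  proof (cases "(\<integral>x. (w x)\<^sup>2 \<partial>?M) = 0")
    case True
    then show ?thesis using field_form_nonneg[OF A] by simp
  next
    case False
    define N where "N = (\<integral>x. (w x)\<^sup>2 \<partial>?M)"
    have N: "0 < N" using False sq_integral_nonneg[of ?M w] unfolding N_def by linarith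
    let ?a = "inverse (sqrt N)"
    have "?E (\<lambda>x. ?a *\<^sub>R h x) \<in> Q"
      unfolding Q_def using adm_scale[OF a, of ?a] norm1[OF False] unfolding N_def by blast
    then have "m \<le> ?E (\<lambda>x. ?a *\<^sub>R h x)" unfolding m_def using Qbd by (rule cInf_lower)
    also have "\<dots> = ?a * (?a * ?E h)" by (simp only: field_form_scale_left[OF A] field_form_scale_right)
    also have "\<dots> = ?E h / N" using N by (simp add: field_simps real_sqrt_mult_self)
    finally show ?thesis using N by (simp add: N_def[symmetric] field_simps)
  qed
  have "\<exists>w h. adm w h \<and> (\<integral>x. (w x)\<^sup>2 \<partial>?M) = 1 \<and> ?E h < m + inverse (real (Suc j))" for j
  proof -
    have "\<exists>q\<in>Q. q < m + inverse (real (Suc j))" unfolding m_def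
      by (rule cInf_lessD[OF Qne, of "Inf Q + inverse (real (Suc j))"]) simp
    then show ?thesis unfolding Q_def by blast
  qed
  then obtain w h where wh: "\<And>j. adm (w j) (h j)" "\<And>j. (\<integral>x. (w j x)\<^sup>2 \<partial>?M) = 1" "\<And>j. ?E (h j) < m + inverse (real (Suc j))"
    by metis
  \<comment> \<open>Compactness asks for one bound on both the mean square, which is 1, and the
    gradients; hence the maximum.\<close>
  have gb: "(\<Sum>i\<in>UNIV. \<integral>x. (h j x $ i)\<^sup>2 \<partial>?M) \<le> max 1 ((m + 1) / \<alpha>)" for j
  proof -
    have "\<alpha> * (\<Sum>i\<in>UNIV. \<integral>x. (h j x $ i)\<^sup>2 \<partial>?M) \<le> ?E (h j)"
      unfolding M_def by (rule field_form_bounds(1)[OF A admD(3)[OF wh(1)]])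
    also have "\<dots> \<le> m + 1" using wh(3)[of j] inverse_le_1_iff[of "real (Suc j)"] by simp
    finally show ?thesis using \<alpha> by (simp add: field_simps le_max_iff_disj)
  qed
  obtain r U where r: "strict_mono r" and U: "l2_lim ?M (\<lambda>n. w (r n)) U"
    unfolding M_def
    by (rule rellich[OF s, of c w h "max 1 ((m + 1) / \<alpha>)"])
      (use admD[OF wh(1)] wh(2) gb in \<open>auto simp: M_def\<close>)
  define a where "a n = w (r n)" for n
  define b where "b n = h (r n)" for n
  have ab: "adm (a n) (b n)" "(\<integral>x. (a n x)\<^sup>2 \<partial>?M) = 1" for n using wh by (auto simp: a_def b_def)
  have aU: "l2_lim ?M a U" using U by (simp add: a_def[abs_def])
  have sU: "sq_integrable ?M U" by (rule l2_lim_sq_integrable(2)[OF aU])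
  have Elim: "(\<lambda>n. ?E (b n)) \<longlonglongrightarrow> m"
  proof (rule tendsto_sandwich)
    show "\<forall>\<^sub>F n in sequentially. m \<le> ?E (b n)" using low[OF ab(1)] ab(2) by (intro always_eventually) simp
    show "\<forall>\<^sub>F n in sequentially. ?E (b n) \<le> m + inverse (real (Suc (r n)))"
      unfolding b_def using wh(3) by (intro always_eventually allI less_imp_le)
    have "(\<lambda>n. m + inverse (real (Suc (r n)))) \<longlonglongrightarrow> m + 0"
      using LIMSEQ_subseq_LIMSEQ[OF LIMSEQ_inverse_real_of_nat r] by (intro tendsto_intros) (simp add: o_def)
    then show "(\<lambda>n. m + inverse (real (Suc (r n)))) \<longlonglongrightarrow> m" by simp
  qed simp
  have diff: "\<alpha> * (\<integral>x. (b k x $ i - b n x $ i)\<^sup>2 \<partial>?M)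
      \<le> 2 * (?E (b k) - m) + 2 * (?E (b n) - m) + m * (\<integral>x. (a k x - a n x)\<^sup>2 \<partial>?M)" for k n i
  proof -
    note lk = admD(3)[OF ab(1)[of k]] and ln = admD(3)[OF ab(1)[of n]]
    note sk = admD(1)[OF ab(1)[of k]] and sn = admD(1)[OF ab(1)[of n]]
    let ?D = "\<lambda>x. b k x - b n x" and ?P = "\<lambda>x. b k x + b n x"
    have "(\<integral>x. (?D x $ i)\<^sup>2 \<partial>?M) \<le> (\<Sum>i\<in>UNIV. \<integral>x. (?D x $ i)\<^sup>2 \<partial>?M)"
      by (rule member_le_sum) (auto intro: sq_integral_nonneg)
    then have "\<alpha> * (\<integral>x. (?D x $ i)\<^sup>2 \<partial>?M) \<le> \<alpha> * (\<Sum>i\<in>UNIV. \<integral>x. (?D x $ i)\<^sup>2 \<partial>?M)"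
      using \<alpha> by (intro mult_left_mono) auto
    also have "\<dots> \<le> ?E ?D" unfolding M_def by (rule field_form_bounds(1)[OF A l2_field_diff[OF lk ln]])
    also have "?E ?D = 2 * ?E (b k) + 2 * ?E (b n) - ?E ?P"
      using lk ln by (simp add: field_form_add_right[OF A] field_form_add_left[OF A] field_form_diff_right[OF A]
          field_form_diff_left[OF A] l2_field_add l2_field_diff)
    also have "m * (\<integral>x. (a k x + a n x)\<^sup>2 \<partial>?M) \<le> ?E ?P" by (rule low[OF adm_add[OF ab(1) ab(1)]])
    then have "2 * ?E (b k) + 2 * ?E (b n) - ?E ?P \<le> 2 * ?E (b k) + 2 * ?E (b n) - m * (\<integral>x. (a k x + a n x)\<^sup>2 \<partial>?M)"
      by simp
    also have "(\<integral>x. (a k x + a n x)\<^sup>2 \<partial>?M) = 4 - (\<integral>x. (a k x - a n x)\<^sup>2 \<partial>?M)"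
    proof -
      have "(\<integral>x. (a k x + a n x)\<^sup>2 \<partial>?M) = (\<integral>x. 2 * (a k x)\<^sup>2 + 2 * (a n x)\<^sup>2 - (a k x - a n x)\<^sup>2 \<partial>?M)"
        by (intro Bochner_Integration.integral_cong refl) (simp add: power2_eq_square algebra_simps)
      also have "\<dots> = 2 * (\<integral>x. (a k x)\<^sup>2 \<partial>?M) + 2 * (\<integral>x. (a n x)\<^sup>2 \<partial>?M) - (\<integral>x. (a k x - a n x)\<^sup>2 \<partial>?M)"
        using sq_integrable_square[OF sk] sq_integrable_square[OF sn] sq_integrable_square[OF sq_integrable_diff[OF sk sn]]
        by simp
      finally show ?thesis using ab(2) by simp
    qed
    finally show ?thesis by (simp add: algebra_simps)
  qed
  have "\<exists>G. l2_lim ?M (\<lambda>n x. b n x $ i) G" for i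
  proof -
    have bs: "sq_integrable ?M (\<lambda>x. b n x $ i)" for n unfolding M_def by (rule l2_fieldD[OF admD(3)[OF ab(1)]])
    have "\<exists>N. \<forall>k\<ge>N. \<forall>n\<ge>N. (\<integral>x. (b k x $ i - b n x $ i)\<^sup>2 \<partial>?M) < e" if e: "0 < e" for e
    proof -
      \<comment> \<open>The two energy excesses, each below \<alpha> e / 8 and taken twice, give
        less than \<alpha> e / 2; the mean-square term gives at most
        \<open>4 * (m + 1) * \<delta>\<close>, which is the other half. Dividing by
        \<open>m + 1\<close> covers the case \<open>m = 0\<close>.\<close>
      define \<delta> where "\<delta> = \<alpha> * e / (8 * (m + 1))"
      have \<delta>: "0 < \<delta>" "0 < \<alpha> * e / 8" using e \<alpha> m0 by (auto simp: \<delta>_def)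
      have "\<forall>\<^sub>F n in sequentially. ?E (b n) < m + \<alpha> * e / 8" using Elim \<delta>(2) by (intro order_tendstoD(2)) auto
      moreover have "\<forall>\<^sub>F n in sequentially. (\<integral>x. (U x - a n x)\<^sup>2 \<partial>?M) < \<delta>"
        using aU \<delta>(1) unfolding l2_lim_def by (intro order_tendstoD(2)[of _ 0]) auto
      ultimately have "\<forall>\<^sub>F n in sequentially. ?E (b n) < m + \<alpha> * e / 8 \<and> (\<integral>x. (U x - a n x)\<^sup>2 \<partial>?M) < \<delta>"
        by (rule eventually_conj)
      then obtain N where N: "\<And>n. n \<ge> N \<Longrightarrow> ?E (b n) < m + \<alpha> * e / 8 \<and> (\<integral>x. (U x - a n x)\<^sup>2 \<partial>?M) < \<delta>"
        unfolding eventually_sequentially by blast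
      have "(\<integral>x. (b k x $ i - b n x $ i)\<^sup>2 \<partial>?M) < e" if kn: "k \<ge> N" "n \<ge> N" for k n
      proof -
        have "(\<integral>x. (a k x - a n x)\<^sup>2 \<partial>?M) \<le> 2 * (\<integral>x. (a k x - U x)\<^sup>2 \<partial>?M) + 2 * (\<integral>x. (U x - a n x)\<^sup>2 \<partial>?M)"
          by (rule sq_integral_triangle[OF admD(1)[OF ab(1)] sU admD(1)[OF ab(1)]])
        also have "(\<integral>x. (a k x - U x)\<^sup>2 \<partial>?M) = (\<integral>x. (U x - a k x)\<^sup>2 \<partial>?M)" by (simp add: power2_commute)
        also have "2 * (\<integral>x. (U x - a k x)\<^sup>2 \<partial>?M) + 2 * (\<integral>x. (U x - a n x)\<^sup>2 \<partial>?M) \<le> 4 * \<delta>"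
          using N[OF kn(1)] N[OF kn(2)] by linarith
        finally have "m * (\<integral>x. (a k x - a n x)\<^sup>2 \<partial>?M) \<le> m * (4 * \<delta>)" using m0 by (rule mult_left_mono)
        also have "\<dots> \<le> (m + 1) * (4 * \<delta>)" using \<delta>(1) by (intro mult_right_mono) auto
        also have "\<dots> = \<alpha> * e / 2" using m0 by (simp add: \<delta>_def field_simps)
        finally have "\<alpha> * (\<integral>x. (b k x $ i - b n x $ i)\<^sup>2 \<partial>?M) < \<alpha> * e"
        proof -
          have arith: "x < y" if "z \<le> y / 2" "x \<le> 2 * (p - m) + 2 * (q - m) + z" "p < m + y / 8" "q < m + y / 8"
            for x y z p q :: real using that by argo
          show "\<alpha> * (\<integral>x. (b k x $ i - b n x $ i)\<^sup>2 \<partial>?M) < \<alpha> * e" if "m * (\<integral>x. (a k x - a n x)\<^sup>2 \<partial>?M) \<le> \<alpha> * e / 2"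
            by (rule arith[OF that diff N[OF kn(1), THEN conjunct1] N[OF kn(2), THEN conjunct1]])
        qed
        then show ?thesis using \<alpha> by simp
      qed
      then show ?thesis by blast
    qed
    from Riesz_Fischer[OF bs this] show ?thesis by blast
  qed
  then obtain G' where G': "\<And>i. l2_lim ?M (\<lambda>n x. b n x $ i) (G' i)" by metis
  define G where "G x = (\<chi> i. G' i x)" for x
  have bG: "l2_lim (lebesgue_on ?S) (\<lambda>n x. b n x $ i) (\<lambda>x. G x $ i)" for i using G'[of i] by (simp add: G_def M_def)
  have wg: "weak_grad ?S U G"
    by (rule weak_grad_limit[OF admD(2)[OF ab(1)] aU[unfolded M_def] bG])
  have EG: "?E G = m"
    using field_form_limit_diag[OF A bG] Elim LIMSEQ_unique by blast
  show ?thesis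
  proof (rule that[OF sU wg])
    show "(\<integral>x. (U x)\<^sup>2 \<partial>?M) = 1" using l2_lim_square[OF aU] ab(2) by (simp add: LIMSEQ_const_iff)
    show "(\<integral>x. p i x * U x \<partial>?M) = 0" if "i \<in> I" for i
      using l2_lim_inner_right[OF aU p[OF that]] admD(4)[OF ab(1) that] by (simp add: LIMSEQ_const_iff)
    show "?E G * (\<integral>x. (w x)\<^sup>2 \<partial>?M) \<le> ?E h" if "sq_integrable ?M w" "weak_grad ?S w h"
      "\<forall>i\<in>I. (\<integral>x. p i x * w x \<partial>?M) = 0" for w h
      unfolding EG by (rule low) (use that in \<open>auto simp: adm_def\<close>)
  qed
qed

section \<open>Neumann eigenfunctions and the gap above the first n of them\<close>

lemma H1_iff: "H1 S u \<longleftrightarrow> sq_integrable (lebesgue_on S) u \<and> (\<exists>g. weak_grad S u g)"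
  by (simp add: H1_def L2_eq)

lemma neumann_eig_field_form:
  assumes s: "0 < s" and A: "coeff_matrix (cube c s) A \<alpha> \<beta>" and v: "neumann_eig (cube c s) A \<mu> v"
    and g: "weak_grad (cube c s) v g"
    and w: "sq_integrable (lebesgue_on (cube c s)) w" "weak_grad (cube c s) w h"
  shows "field_form (cube c s) A g h = \<mu> * (\<integral>x. v x * w x \<partial>lebesgue_on (cube c s))"
proof -
  have "H1 (cube c s) w" using w by (auto simp: H1_iff)
  then have "energy_form (cube c s) A v w = \<mu> * (\<integral>x. v x * w x \<partial>lebesgue_on (cube c s))"
    using v by (simp add: neumann_eig_def)
  then show ?thesis by (simp add: energy_form_eq[OF s A g w(2)])
qed

lemma neumann_eig_mean_zero:
  assumes s: "0 < s" and A: "coeff_matrix (cube c s) A \<alpha> \<beta>" and v: "neumann_eig (cube c s) A \<mu> v" and \<mu>: "\<mu> \<noteq> 0"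
  shows "(\<integral>x. v x \<partial>lebesgue_on (cube c s)) = 0"
proof -
  obtain g where g: "weak_grad (cube c s) v g" using v by (auto simp: neumann_eig_def H1_iff)
  have "sq_integrable (lebesgue_on (cube c s)) (\<lambda>x. 1)"
    by (rule finite_measure.sq_integrable_bounded[OF finite_measure_cube, of _ _ _ 1]) auto
  from neumann_eig_field_form[OF s A v g this weak_grad_const]
  show ?thesis using \<mu> by (simp add: field_form_def)
qed

lemma trig_coeff_sum:
  assumes "\<And>j. j \<in> J \<Longrightarrow> sq_integrable (lebesgue_on (cube c s)) (P j)"
  shows "trig_coeff c s \<tau> (\<lambda>x. \<Sum>j\<in>J. y j * P j x) k = (\<Sum>j\<in>J. trig_coeff c s \<tau> (P j) k * y j)"
proof -
  have "trig_coeff c s \<tau> (\<lambda>x. \<Sum>j\<in>J. y j * P j x) k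
    = (\<integral>x. (\<Sum>j\<in>J. y j * (P j x * trig_prod c s \<tau> k x)) \<partial>lebesgue_on (cube c s))"
    by (simp add: trig_coeff_def sum_distrib_right mult.assoc)
  also have "\<dots> = (\<Sum>j\<in>J. trig_coeff c s \<tau> (P j) k * y j)"
    using sq_integrable_prod[OF assms trig_prod_sq_integrable[of c s c s \<tau> k]]
    by (subst Bochner_Integration.integral_sum) (auto simp: trig_coeff_def mult.commute)
  finally show ?thesis .
qed

lemma integral_inner_sum:
  assumes "\<And>j. j \<in> J \<Longrightarrow> sq_integrable M (P j)" "sq_integrable M w"
  shows "(\<integral>x. w x * (\<Sum>j\<in>J. y j * P j x) \<partial>M) = (\<Sum>j\<in>J. y j * (\<integral>x. w x * P j x \<partial>M))"
proof -
  have "(\<integral>x. w x * (\<Sum>j\<in>J. y j * P j x) \<partial>M) = (\<integral>x. (\<Sum>j\<in>J. y j * (w x * P j x)) \<partial>M)"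
    by (intro Bochner_Integration.integral_cong refl) (simp add: sum_distrib_left mult.left_commute)
  then show ?thesis
    using sq_integrable_prod[OF assms(2) assms(1)] by (simp add: Bochner_Integration.integral_sum)
qed

text \<open>If more than \<open>K\<^sup>d\<close> orthonormal Neumann eigenfunctions have eigenvalue at most \<open>m\<close>, some
  combination of them is orthogonal to the \<open>K\<^sup>d\<close> lowest cosines, which forces \<open>m\<close> to be large.\<close>

lemma eigenvalue_lower_bound:
  fixes c :: "real^'d::finite" and P :: "nat \<Rightarrow> real^'d \<Rightarrow> real"
  assumes s: "0 < s" and A: "coeff_matrix (cube c s) A \<alpha> \<beta>"
    and P: "\<And>j. j \<le> n \<Longrightarrow> neumann_eig (cube c s) A (\<mu> j) (P j)" "\<And>j. j \<le> n \<Longrightarrow> \<mu> j \<le> m"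
    and orth: "\<And>i j. i \<le> n \<Longrightarrow> j \<le> n \<Longrightarrow> (\<integral>x. P i x * P j x \<partial>lebesgue_on (cube c s)) = (if i = j then 1 else 0)"
    and K: "K ^ CARD('d) \<le> n"
  shows "\<alpha> * (pi * real K / s)\<^sup>2 \<le> m"
proof -
  let ?M = "lebesgue_on (cube c s)"
  have Ps: "sq_integrable ?M (P j)" and "\<exists>g. weak_grad (cube c s) (P j) g" if "j \<in> {..n}" for j
    using P(1)[of j] that by (auto simp: neumann_eig_def H1_iff)
  then obtain G where G: "\<And>j. j \<in> {..n} \<Longrightarrow> weak_grad (cube c s) (P j) (G j)" by metis
  \<comment> \<open>The functions are indexed by 0 to n, one more than the bound n on the number of
    low cosines.\<close>
  have "card (freq_box K :: ('d \<Rightarrow> nat) set) < card {..n}" using K by (simp add: card_freq_box)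
  from underdetermined_system[OF finite_freq_box finite_atMost this, of "\<lambda>k j. trig_coeff c s (\<lambda>_. True) (P j) k"]
  obtain y where y: "\<exists>j\<in>{..n}. y j \<noteq> 0"
    and yk: "\<And>k. k \<in> freq_box K \<Longrightarrow> (\<Sum>j\<in>{..n}. trig_coeff c s (\<lambda>_. True) (P j) k * y j) = 0" by blast
  define w where "w x = (\<Sum>j\<in>{..n}. y j * P j x)" for x
  define h where "h x = (\<Sum>j\<in>{..n}. y j *\<^sub>R G j x)" for x
  have ws: "sq_integrable ?M w" unfolding w_def[abs_def] by (intro sq_integrable_sum sq_integrable_cmult Ps)
  have wh: "weak_grad (cube c s) w h"
    unfolding w_def[abs_def] h_def[abs_def] by (intro weak_grad_sum sq_integrable_cmult Ps weak_grad_cmult G)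
  have wk: "trig_coeff c s (\<lambda>_. True) w k = 0" if "k \<in> freq_box K" for k
    unfolding w_def[abs_def] using trig_coeff_sum[of "{..n}" c s P, OF Ps] yk[OF that] by simp
  have Pw: "(\<integral>x. P j x * w x \<partial>?M) = y j" if j: "j \<in> {..n}" for j
  proof -
    have "(\<integral>x. P j x * w x \<partial>?M) = (\<Sum>l\<in>{..n}. y l * (\<integral>x. P j x * P l x \<partial>?M))"
      unfolding w_def by (rule integral_inner_sum[OF Ps Ps[OF j]])
    also have "\<dots> = (\<Sum>l\<in>{..n}. if j = l then y l else 0)" using j orth by (intro sum.cong) auto
    finally show ?thesis using j by simp
  qed
  have w2: "(\<integral>x. (w x)\<^sup>2 \<partial>?M) = (\<Sum>j\<in>{..n}. (y j)\<^sup>2)"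
  proof -
    have "(\<integral>x. (w x)\<^sup>2 \<partial>?M) = (\<integral>x. w x * (\<Sum>j\<in>{..n}. y j * P j x) \<partial>?M)" by (simp add: power2_eq_square w_def)
    also have "\<dots> = (\<Sum>j\<in>{..n}. y j * (\<integral>x. w x * P j x \<partial>?M))" by (rule integral_inner_sum[OF Ps ws])
    also have "\<dots> = (\<Sum>j\<in>{..n}. (y j)\<^sup>2)"
      using Pw by (intro sum.cong refl) (simp add: mult.commute power2_eq_square)
    finally show ?thesis .
  qed
  have Eh: "field_form (cube c s) A h h \<le> m * (\<integral>x. (w x)\<^sup>2 \<partial>?M)"
  proof -
    have hl: "l2_field (cube c s) h" by (rule weak_grad_l2_field[OF wh])
    have "field_form (cube c s) A h h = (\<Sum>j\<in>{..n}. field_form (cube c s) A h (\<lambda>x. y j *\<^sub>R G j x))"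
      by (subst (2) h_def[abs_def], rule field_form_sum_right[OF A hl])
        (intro l2_field_scale weak_grad_l2_field[OF G])
    also have "\<dots> = (\<Sum>j\<in>{..n}. y j * field_form (cube c s) A (G j) h)"
      by (simp add: field_form_scale_right field_form_sym[OF A, of h])
    also have "\<dots> = (\<Sum>j\<in>{..n}. y j * (\<mu> j * y j))"
      using neumann_eig_field_form[OF s A P(1) G ws wh] Pw by (intro sum.cong refl) simp
    also have "\<dots> \<le> (\<Sum>j\<in>{..n}. m * (y j)\<^sup>2)"
      using P(2) by (intro sum_mono) (simp add: power2_eq_square mult_right_mono mult.left_commute[of "y _"])
    finally show ?thesis by (simp add: w2 sum_distrib_left)
  qed
  have "(pi * real K / s)\<^sup>2 * (\<integral>x. (w x)\<^sup>2 \<partial>?M) \<le> (\<Sum>i\<in>UNIV. \<integral>x. (h x $ i)\<^sup>2 \<partial>?M)"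
    using cube_spectral_inequality[OF s ws wh, of K] wk by simp
  then have "\<alpha> * ((pi * real K / s)\<^sup>2 * (\<integral>x. (w x)\<^sup>2 \<partial>?M)) \<le> \<alpha> * (\<Sum>i\<in>UNIV. \<integral>x. (h x $ i)\<^sup>2 \<partial>?M)"
    using coeff_matrix_props(1)[OF A] by (intro mult_left_mono) auto
  also have "\<dots> \<le> field_form (cube c s) A h h" by (rule field_form_bounds(1)[OF A weak_grad_l2_field[OF wh]])
  also note Eh
  finally have "\<alpha> * (pi * real K / s)\<^sup>2 * (\<integral>x. (w x)\<^sup>2 \<partial>?M) \<le> m * (\<integral>x. (w x)\<^sup>2 \<partial>?M)" by (simp add: mult.assoc)
  moreover have "0 < (\<integral>x. (w x)\<^sup>2 \<partial>?M)"
  proof -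
    obtain j where j: "j \<in> {..n}" "y j \<noteq> 0" using y by blast
    have "0 < (y j)\<^sup>2" using j by simp
    also have "\<dots> \<le> (\<Sum>j\<in>{..n}. (y j)\<^sup>2)" using j by (intro member_le_sum) auto
    finally show ?thesis by (simp add: w2)
  qed
  ultimately show ?thesis by simp
qed

lemma freq_box_1: "freq_box (Suc 0) = {\<lambda>_. 0}"
  by (auto simp: freq_box_def fun_eq_iff)

text \<open>The spectral inequality with K = 1, where the constant is the only low mode.\<close>

lemma mean_zero_poincare:
  fixes c :: "real^'d::finite"
  assumes s: "0 < s" and u: "sq_integrable (lebesgue_on (cube c s)) u" and g: "weak_grad (cube c s) u g"
    and z: "(\<integral>x. u x \<partial>lebesgue_on (cube c s)) = 0"
  shows "(pi / s)\<^sup>2 * (\<integral>x. (u x)\<^sup>2 \<partial>lebesgue_on (cube c s)) \<le> (\<Sum>i\<in>UNIV. \<integral>x. (g x $ i)\<^sup>2 \<partial>lebesgue_on (cube c s))"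
proof -
  have "trig_prod c s (\<lambda>_. True) (\<lambda>_. 0) = (\<lambda>x. 1)" by (simp add: trig_prod_def trig_def fun_eq_iff)
  then have "trig_coeff c s (\<lambda>_. True) u (\<lambda>_. 0) = 0" using z by (simp add: trig_coeff_def)
  then show ?thesis using cube_spectral_inequality[OF s u g, of "Suc 0"] by (simp add: freq_box_1)
qed

text \<open>The minimizer \<open>U\<close> on the complement is itself an eigenfunction with
  eigenvalue \<open>m\<close>. If \<open>m\<close> were below \<open>lam (n - 1)\<close>, it would
  lie in the span of the \<open>v i\<close>, to which it is orthogonal. So \<open>m\<close> bounds
  the eigenvalues of n + 1 orthonormal eigenfunctions from above, and the eigenvalue bound applies
  to \<open>m\<close>.\<close>

lemma orthogonal_complement_bound:
  fixes c :: "real^'d::finite"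
  assumes s: "0 < s" and A: "coeff_matrix (cube c s) A \<alpha> \<beta>"
    and eig: "first_neumann_eigs (cube c s) A n v lam" and n: "1 \<le> n" and K: "K ^ CARD('d) \<le> n"
    and u: "sq_integrable (lebesgue_on (cube c s)) u" "weak_grad (cube c s) u g"
    and u0: "(\<integral>x. u x \<partial>lebesgue_on (cube c s)) = 0"
    and uv: "\<And>i. i < n \<Longrightarrow> (\<integral>x. v i x * u x \<partial>lebesgue_on (cube c s)) = 0"
  shows "\<alpha> * (pi * real K / s)\<^sup>2 * (\<integral>x. (u x)\<^sup>2 \<partial>lebesgue_on (cube c s)) \<le> field_form (cube c s) A g g"
proof (cases "(\<integral>x. (u x)\<^sup>2 \<partial>lebesgue_on (cube c s)) = 0")
  case True
  then show ?thesis using field_form_nonneg[OF A, of g] by simp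
next
  case False
  let ?M = "lebesgue_on (cube c s)" and ?S = "cube c s"
  interpret finite_measure ?M by (rule finite_measure_cube)
  have E: "0 < lam i" "neumann_eig ?S A (lam i) (v i)" if "i < n" for i
    using eig that by (auto simp: first_neumann_eigs_def)
  have orth: "(\<integral>x. v i x * v k x \<partial>?M) = (if i = k then 1 else 0)" if "i < n" "k < n" for i k
    using eig that by (auto simp: first_neumann_eigs_def)
  have mono: "lam i \<le> lam (n - 1)" if "i < n" for i
    using eig that n unfolding first_neumann_eigs_def by auto
  have vs: "sq_integrable ?M (v i)" and "\<exists>g. weak_grad ?S (v i) g" if "i < n" for i
    using E(2)[OF that] by (auto simp: neumann_eig_def H1_iff)
  then obtain gv where gv: "\<And>i. i < n \<Longrightarrow> weak_grad ?S (v i) (gv i)" by metis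
  have v0: "(\<integral>x. v i x \<partial>?M) = 0" if "i < n" for i
    using neumann_eig_mean_zero[OF s A E(2)[OF that]] E(1)[OF that] by simp
  have one: "sq_integrable ?M (\<lambda>x. a)" for a :: real
    by (rule sq_integrable_bounded[of _ "\<bar>a\<bar>"]) auto
  \<comment> \<open>Indices from \<open>n\<close> on repeat the constant 1, so the single family
    \<open>p\<close> encodes orthogonality to the eigenfunctions and mean zero.\<close>
  define p where "p i = (if i < n then v i else (\<lambda>x. 1))" for i
  have ps: "sq_integrable ?M (p i)" for i using vs one by (simp add: p_def)
  have pu: "(\<integral>x. p i x * u x \<partial>?M) = 0" for i using uv u0 by (simp add: p_def)
  obtain U G where U: "sq_integrable ?M U" "weak_grad ?S U G" "(\<integral>x. (U x)\<^sup>2 \<partial>?M) = 1"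
    and pU0: "\<And>i. i \<in> UNIV \<Longrightarrow> (\<integral>x. p i x * U x \<partial>?M) = 0"
    and min0: "\<And>w h. sq_integrable ?M w \<Longrightarrow> weak_grad ?S w h \<Longrightarrow> \<forall>i\<in>UNIV. (\<integral>x. p i x * w x \<partial>?M) = 0
      \<Longrightarrow> field_form ?S A G G * (\<integral>x. (w x)\<^sup>2 \<partial>?M) \<le> field_form ?S A h h"
    by (rule rayleigh_minimizer[OF s A ps u(1,2) pu False]) (rule that)
  note pU = pU0[OF UNIV_I]
  have min: "field_form ?S A G G * (\<integral>x. (w x)\<^sup>2 \<partial>?M) \<le> field_form ?S A h h"
    if "sq_integrable ?M w" "weak_grad ?S w h" "\<And>i. (\<integral>x. p i x * w x \<partial>?M) = 0" for w h
    using that by (intro min0) auto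
  define m where "m = field_form ?S A G G"
  have Gl: "l2_field ?S G" by (rule weak_grad_l2_field[OF U(2)])
  have vU: "(\<integral>x. v i x * U x \<partial>?M) = 0" if "i < n" for i using pU[of i] that by (simp add: p_def)
  have U0: "(\<integral>x. U x \<partial>?M) = 0" using pU[of n] by (simp add: p_def)
  \<comment> \<open>The Euler-Lagrange equation for admissible directions only: moving along
    \<open>w\<close> keeps the constraints, and the minimum kills the linear term in
    \<open>t\<close>.\<close>
  have EL: "field_form ?S A G h = m * (\<integral>x. U x * w x \<partial>?M)"
    if w: "sq_integrable ?M w" "weak_grad ?S w h" and pw: "\<And>i. (\<integral>x. p i x * w x \<partial>?M) = 0" for w h
  proof -
    note hl = weak_grad_l2_field[OF w(2)]
    have "0 \<le> 2 * t * (field_form ?S A G h - m * (\<integral>x. U x * w x \<partial>?M))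
      + t\<^sup>2 * (field_form ?S A h h - m * (\<integral>x. (w x)\<^sup>2 \<partial>?M))" for t
    proof -
      let ?w = "\<lambda>x. U x + t * w x" and ?h = "\<lambda>x. G x + t *\<^sub>R h x"
      note ts = sq_integrable_cmult[OF w(1), of t]
      have "(\<integral>x. p i x * ?w x \<partial>?M) = 0" for i
        using sq_integrable_prod[OF ps U(1)] sq_integrable_prod[OF ps w(1)] pU pw
        by (simp add: distrib_left mult.left_commute[of _ t])
      then have "m * (\<integral>x. (?w x)\<^sup>2 \<partial>?M) \<le> field_form ?S A ?h ?h"
        unfolding m_def by (intro min sq_integrable_add U(1) ts weak_grad_add U(2) weak_grad_cmult w(2))
      moreover have "(\<integral>x. (?w x)\<^sup>2 \<partial>?M) = 1 + 2 * t * (\<integral>x. U x * w x \<partial>?M) + t\<^sup>2 * (\<integral>x. (w x)\<^sup>2 \<partial>?M)"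
      proof -
        have "(\<integral>x. (?w x)\<^sup>2 \<partial>?M) = (\<integral>x. (U x)\<^sup>2 + 2 * t * (U x * w x) + t\<^sup>2 * (w x)\<^sup>2 \<partial>?M)"
          by (intro Bochner_Integration.integral_cong refl) (simp add: power2_eq_square algebra_simps)
        then show ?thesis
          using sq_integrable_square[OF U(1)] sq_integrable_square[OF w(1)] sq_integrable_prod[OF U(1) w(1)] U(3) by simp
      qed
      moreover have "field_form ?S A ?h ?h = m + 2 * t * field_form ?S A G h + t\<^sup>2 * field_form ?S A h h"
        using Gl hl by (simp add: field_form_add_right[OF A] field_form_add_left[OF A] l2_field_add l2_field_scale
            field_form_scale_right field_form_scale_left[OF A] field_form_sym[OF A, of h G] power2_eq_square m_def algebra_simps)
      ultimately show ?thesis by (simp add: algebra_simps)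
    qed
    then have "field_form ?S A G h - m * (\<integral>x. U x * w x \<partial>?M) = 0" by (rule quadratic_nonneg_imp_linear_zero)
    then show ?thesis by simp
  qed
  have eigU: "neumann_eig ?S A m U"
    unfolding neumann_eig_def
  proof (intro conjI allI impI)
    show "H1 ?S U" using U by (auto simp: H1_iff)
    fix w assume "H1 ?S w"
    then obtain h where w: "sq_integrable ?M w" "weak_grad ?S w h" by (auto simp: H1_iff)
    \<comment> \<open>A general direction \<open>w\<close> is split off its projection
      \<open>q\<close> onto the constants and the \<open>v i\<close>. Both sides of the eigenvalue
      equation vanish on \<open>q\<close>: constants have zero gradient and zero pairing with
      \<open>U\<close>, and each \<open>v i\<close> is an eigenfunction orthogonal to
      \<open>U\<close>.\<close>
    define a where "a = (\<integral>x. w x \<partial>?M) / measure ?M ?S"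
    define b where "b i = (\<integral>x. v i x * w x \<partial>?M)" for i
    define q where "q x = a + (\<Sum>i<n. b i * v i x)" for x
    define k where "k x = (\<Sum>i<n. b i *\<^sub>R gv i x)" for x
    have qs: "sq_integrable ?M q"
      unfolding q_def[abs_def] using vs by (intro sq_integrable_add sq_integrable_sum sq_integrable_cmult one) simp
    have ss: "sq_integrable ?M (\<lambda>x. \<Sum>i<n. b i * v i x)" using vs by (intro sq_integrable_sum sq_integrable_cmult) simp
    have kg: "weak_grad ?S (\<lambda>x. \<Sum>i<n. b i * v i x) k"
      unfolding k_def[abs_def] using vs gv by (intro weak_grad_sum sq_integrable_cmult weak_grad_cmult) auto
    have qk: "weak_grad ?S q k"
      using weak_grad_add[OF one weak_grad_const[of c s a] ss kg] by (simp add: q_def[abs_def])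
    have mpos: "0 < measure ?M ?S" by (rule measure_cube_pos[OF s])
    have wq: "(\<integral>x. p i x * (w x - q x) \<partial>?M) = 0" for i
    proof (cases "i < n")
      case True
      have "(\<integral>x. v i x * q x \<partial>?M) = (\<integral>x. a * v i x + v i x * (\<Sum>j<n. b j * v j x) \<partial>?M)"
        by (simp add: q_def distrib_left mult.commute)
      also have "\<dots> = a * 0 + (\<Sum>j<n. b j * (\<integral>x. v i x * v j x \<partial>?M))"
        using sq_integrable_integrable[OF vs[OF True]] sq_integrable_prod[OF vs[OF True] ss] v0[OF True]
          integral_inner_sum[of "{..<n}" ?M v "v i" b] vs vs[OF True] by simp
      also have "\<dots> = (\<Sum>j<n. if i = j then b j else 0)"
        unfolding mult_zero_right add_0_left using orth[OF True] by (intro sum.cong refl) simp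
      also have "\<dots> = (\<integral>x. v i x * w x \<partial>?M)" using True by (simp add: b_def)
      finally show ?thesis
        using True sq_integrable_prod[OF vs[OF True] w(1)] sq_integrable_prod[OF vs[OF True] qs]
        by (simp add: p_def right_diff_distrib)
    next
      case False
      have "(\<integral>x. q x \<partial>?M) = a * measure ?M ?S + (\<integral>x. 1 * (\<Sum>j<n. b j * v j x) \<partial>?M)"
        using sq_integrable_integrable[OF ss] by (simp add: q_def)
      also have "(\<integral>x. 1 * (\<Sum>j<n. b j * v j x) \<partial>?M) = (\<Sum>j<n. b j * (\<integral>x. 1 * v j x \<partial>?M))"
        using vs by (intro integral_inner_sum one) simp
      also have "\<dots> = 0" using v0 by simp
      finally have "(\<integral>x. q x \<partial>?M) = (\<integral>x. w x \<partial>?M)" using mpos by (simp add: a_def)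
      then show ?thesis using False sq_integrable_integrable[OF qs] sq_integrable_integrable[OF w(1)] by (simp add: p_def)
    qed
    have kl: "l2_field ?S k" by (rule weak_grad_l2_field[OF qk])
    have Gk: "field_form ?S A G k = 0"
    proof -
      have "field_form ?S A G (gv i) = 0" if "i < n" for i
        using neumann_eig_field_form[OF s A E(2)[OF that] gv[OF that] U(1,2)] vU[OF that] field_form_sym[OF A, of G] by simp
      then show ?thesis
        unfolding k_def[abs_def] using gv
        by (subst field_form_sum_right[OF A Gl]) (auto intro: l2_field_scale weak_grad_l2_field simp: field_form_scale_right)
    qed
    have Uq: "(\<integral>x. U x * q x \<partial>?M) = 0"
    proof -
      have "(\<integral>x. U x * q x \<partial>?M) = a * (\<integral>x. U x \<partial>?M) + (\<integral>x. U x * (\<Sum>j<n. b j * v j x) \<partial>?M)"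
        using sq_integrable_integrable[OF U(1)] sq_integrable_prod[OF U(1) ss]
        by (simp add: q_def distrib_left mult.commute[of _ a])
      also have "(\<integral>x. U x * (\<Sum>j<n. b j * v j x) \<partial>?M) = (\<Sum>j<n. b j * (\<integral>x. U x * v j x \<partial>?M))"
        using vs by (intro integral_inner_sum U(1)) simp
      also have "\<dots> = 0" using vU by (simp add: mult.commute)
      finally show ?thesis using U0 by simp
    qed
    have "field_form ?S A G (\<lambda>x. h x - k x) = m * (\<integral>x. U x * (w x - q x) \<partial>?M)"
      by (rule EL[OF sq_integrable_diff[OF w(1) qs] weak_grad_diff[OF w qs qk] wq])
    then have "field_form ?S A G h = m * (\<integral>x. U x * w x \<partial>?M)"
      using Gk Uq sq_integrable_prod[OF U(1) w(1)] sq_integrable_prod[OF U(1) qs]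
      by (simp add: field_form_diff_right[OF A Gl weak_grad_l2_field[OF w(2)] kl] right_diff_distrib)
    then show "energy_form ?S A U w = m * (\<integral>x. U x * w x \<partial>?M)" by (simp add: energy_form_eq[OF s A U(2) w(2)])
  qed
  \<comment> \<open>The hypothesis on low eigenfunctions covers positive eigenvalues only; mean zero
    and the Poincare inequality exclude 0.\<close>
  have mpos: "0 < m"
  proof -
    have "(pi / s)\<^sup>2 \<le> (\<Sum>i\<in>UNIV. \<integral>x. (G x $ i)\<^sup>2 \<partial>?M)" using mean_zero_poincare[OF s U(1,2) U0] U(3) by simp
    moreover have "0 < (pi / s)\<^sup>2" using s by simp
    ultimately have "0 < (\<Sum>i\<in>UNIV. \<integral>x. (G x $ i)\<^sup>2 \<partial>?M)" by (rule less_le_trans[rotated])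
    then have "0 < \<alpha> * (\<Sum>i\<in>UNIV. \<integral>x. (G x $ i)\<^sup>2 \<partial>?M)"
      using coeff_matrix_props(1)[OF A] by (intro mult_pos_pos)
    then show ?thesis using field_form_bounds(1)[OF A Gl] by (simp add: m_def)
  qed
  \<comment> \<open>Membership in the span of the \<open>v i\<close> would give \<open>U\<close>
    zero mean square, against its normalization.\<close>
  have ge: "lam (n - 1) \<le> m"
  proof (rule ccontr)
    assume "\<not> lam (n - 1) \<le> m"
    then have lt: "m < lam (n - 1)" by simp
    have "\<forall>\<mu> w. neumann_eig ?S A \<mu> w \<and> 0 < \<mu> \<and> \<mu> < lam (n - 1) \<longrightarrow>
        (\<exists>c. AE x in ?M. w x = (\<Sum>i<n. c i * v i x))"
      using eig unfolding first_neumann_eigs_def by (elim conjE)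
    from this[rule_format, OF conjI[OF eigU conjI[OF mpos lt]]]
    obtain b where b: "AE x in ?M. U x = (\<Sum>i<n. b i * v i x)" by blast
    have ss: "sq_integrable ?M (\<lambda>x. \<Sum>i<n. b i * v i x)" using vs by (intro sq_integrable_sum sq_integrable_cmult) simp
    have "(\<integral>x. (U x)\<^sup>2 \<partial>?M) = (\<integral>x. U x * (\<Sum>i<n. b i * v i x) \<partial>?M)"
    proof (rule integral_cong_AE)
      show "AE x in ?M. (U x)\<^sup>2 = U x * (\<Sum>i<n. b i * v i x)"
        using b by eventually_elim (simp add: power2_eq_square)
    qed (use sq_integrable_square[OF U(1)] sq_integrable_prod[OF U(1) ss] in auto)
    also have "\<dots> = (\<Sum>j<n. b j * (\<integral>x. U x * v j x \<partial>?M))" using vs by (intro integral_inner_sum U(1)) simp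
    also have "\<dots> = 0" using vU by (simp add: mult.commute)
    finally show False using U(3) by simp
  qed
  define P where "P j = (if j < n then v j else U)" for j
  define \<mu> where "\<mu> j = (if j < n then lam j else m)" for j
  have "\<alpha> * (pi * real K / s)\<^sup>2 \<le> m"
  proof (rule eigenvalue_lower_bound[OF s A, of n \<mu> P])
    show "neumann_eig ?S A (\<mu> j) (P j)" if "j \<le> n" for j using E(2) eigU by (simp add: \<mu>_def P_def)
    show "\<mu> j \<le> m" if "j \<le> n" for j using mono[of j] ge by (auto simp: \<mu>_def)
    show "(\<integral>x. P i x * P j x \<partial>?M) = (if i = j then 1 else 0)" if "i \<le> n" "j \<le> n" for i j
    proof -
      have Uv: "(\<integral>x. U x * v k x \<partial>?M) = 0" if "k < n" for k using vU[OF that] by (simp add: mult.commute)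
      consider "i < n" "j < n" | "i < n" "j = n" | "i = n" "j < n" | "i = n" "j = n" using \<open>i \<le> n\<close> \<open>j \<le> n\<close> by linarith
      then show ?thesis
      proof cases
        case 1
        then show ?thesis using orth[OF 1] by (simp add: P_def)
      next
        case 2
        then show ?thesis using vU[OF 2(1)] by (simp add: P_def)
      next
        case 3
        then show ?thesis using Uv[OF 3(2)] by (simp add: P_def)
      next
        case 4
        then show ?thesis using U(3) by (simp add: P_def power2_eq_square)
      qed
    qed
  qed (rule K)
  then have "\<alpha> * (pi * real K / s)\<^sup>2 * (\<integral>x. (u x)\<^sup>2 \<partial>?M) \<le> m * (\<integral>x. (u x)\<^sup>2 \<partial>?M)"
    by (intro mult_right_mono sq_integral_nonneg)
  also have "\<dots> \<le> field_form ?S A g g" unfolding m_def by (rule min[OF u(1,2) pu])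
  finally show ?thesis .
qed


subsection \<open>The approximation theorem\<close>

lemma H_AI:
  assumes s: "0 < s" and A: "coeff_matrix (cube c s) A \<alpha> \<beta>"
    and u: "sq_integrable (lebesgue_on (cube c s)) u" "weak_grad (cube c s) u g"
    and z: "\<And>\<phi>. test_fun (cube c s) \<phi> \<Longrightarrow> field_form (cube c s) A g (cgrad \<phi>) = 0"
  shows "H_A (cube c s) A u"
  unfolding H_A_def
proof (intro conjI allI impI)
  show "H1 (cube c s) u" using u by (auto simp: H1_iff)
  fix \<phi> :: "real^'a \<Rightarrow> real" assume \<phi>: "test_fun (cube c s) \<phi>"
  have "field_form (cube c s) A (wgrad (cube c s) u) (cgrad \<phi>) = field_form (cube c s) A g (cgrad \<phi>)"
    by (rule field_form_cong_AE[OF A weak_grad_l2_field[OF weak_grad_wgrad[OF u(2)]] weak_grad_l2_field[OF u(2)]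
        l2_field_cgrad[OF \<phi>] l2_field_cgrad[OF \<phi>] weak_grad_unique[OF s weak_grad_wgrad[OF u(2)] u(2)]]) simp
  then show "(\<integral>x. (A x *v wgrad (cube c s) u x) \<bullet> cgrad \<phi> x \<partial>lebesgue_on (cube c s)) = 0"
    using z[OF \<phi>] by (simp add: field_form_def)
qed

lemma H_AE:
  assumes "H_A S A u"
  obtains g where "sq_integrable (lebesgue_on S) u" "weak_grad S u g"
  using assms by (auto simp: H_A_def H1_iff)

lemma H_A_subset:
  assumes t: "0 < t" "t \<le> s" and A: "coeff_matrix (cube c s) A \<alpha> \<beta>" and u: "H_A (cube c s) A u"
  shows "H_A (cube c t) A u"
proof -
  have sub: "cube c t \<subseteq> cube c s" using t(2) by (rule cube_mono)
  obtain g where g: "sq_integrable (lebesgue_on (cube c s)) u" "weak_grad (cube c s) u g" using u by (rule H_AE)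
  show ?thesis
  proof (rule H_AI[OF t(1) coeff_matrix_subset[OF A sub] sq_integrable_subset[OF g(1) sub] weak_grad_subset[OF g(2) sub]])
    fix \<phi> :: "real^'a \<Rightarrow> real" assume \<phi>: "test_fun (cube c t) \<phi>"
    have "field_form (cube c t) A g (cgrad \<phi>) = field_form (cube c s) A g (cgrad \<phi>)"
      unfolding field_form_def
    proof (rule integral_lebesgue_on_subset[OF sub])
      fix x assume "x \<notin> cube c t"
      then have "cgrad \<phi> x = 0" using test_fun_props(5)[OF \<phi>] by (simp add: cgrad_def vec_eq_iff)
      then show "(A x *v g x) \<bullet> cgrad \<phi> x = 0" by simp
    qed auto
    also have "\<dots> = 0" using t by (intro H_A_field_form[OF _ A u g(2) test_fun_subset[OF \<phi> sub]]) simp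
    finally show "field_form (cube c t) A g (cgrad \<phi>) = 0" .
  qed auto
qed

lemma zero_mean_weak_grad:
  assumes "sq_integrable (lebesgue_on (cube c s)) h" "weak_grad (cube c s) h g"
  shows "sq_integrable (lebesgue_on (cube c s)) (zero_mean (cube c s) h)" "weak_grad (cube c s) (zero_mean (cube c s) h) g"
proof -
  let ?a = "(\<integral>x. h x \<partial>lebesgue_on (cube c s)) / measure lebesgue (cube c s)"
  have e: "zero_mean (cube c s) h = (\<lambda>x. h x - ?a)" by (simp add: zero_mean_def fun_eq_iff)
  have o: "sq_integrable (lebesgue_on (cube c s)) (\<lambda>x. ?a)"
    by (rule finite_measure.sq_integrable_bounded[OF finite_measure_cube, of _ _ _ "\<bar>?a\<bar>"]) auto
  show "sq_integrable (lebesgue_on (cube c s)) (zero_mean (cube c s) h)"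
    unfolding e by (rule sq_integrable_diff[OF assms(1) o])
  show "weak_grad (cube c s) (zero_mean (cube c s) h) g"
    unfolding e using weak_grad_diff[OF assms o weak_grad_const] by simp
qed

lemma integral_zero_mean:
  assumes s: "0 < s" and h: "sq_integrable (lebesgue_on (cube c s)) h"
  shows "(\<integral>x. zero_mean (cube c s) h x \<partial>lebesgue_on (cube c s)) = 0"
proof -
  interpret finite_measure "lebesgue_on (cube c s)" by (rule finite_measure_cube)
  have m: "measure (lebesgue_on (cube c s)) (cube c s) = measure lebesgue (cube c s)"
    by (intro measure_restrict_space) auto
  have "0 < measure lebesgue (cube c s)" using measure_cube_pos[OF s, of c] unfolding m .
  then show ?thesis using sq_integrable_integrable[OF h] m by (simp add: zero_mean_def)
qed

text \<open>The factors of the rate have separate origins: \<open>16 / 5 / (s - t)\<close> and the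
  root of the dimension from the product cutoff in Caccioppoli, \<open>s / (pi * real K)\<close>
  from the spectral bound, and \<open>sqrt (\<beta> / \<alpha>)\<close> from using the upper bound
  of \<open>A\<close> in the former and the lower one in the latter. Harmonicity of the remainder is
  part of the conclusion so that the step can be repeated.\<close>

lemma approximation_step:
  fixes c :: "real^'d::finite"
  assumes t: "0 < t" "t < s" and A: "coeff_matrix (cube c s) A \<alpha> \<beta>"
    and eig: "first_neumann_eigs (cube c s) A n v lam" and n: "1 \<le> n" and K: "1 \<le> K" "K ^ CARD('d) \<le> n"
    and harm: "\<And>i. i < n \<Longrightarrow> harmonic_ext (cube c s) A (v i) (h i)" and u: "H_A (cube c s) A u"
  shows "\<exists>b. H_A (cube c t) A (\<lambda>x. u x - (\<Sum>i<n. b i * zero_mean (cube c s) (h i) x)) \<and>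
    energy_norm (cube c t) A (\<lambda>x. u x - (\<Sum>i<n. b i * zero_mean (cube c s) (h i) x))
      \<le> sqrt (\<beta> / \<alpha>) * sqrt (real CARD('d)) * (16 / 5 / (s - t)) * (s / (pi * real K)) * energy_norm (cube c s) A u"
proof -
  let ?M = "lebesgue_on (cube c s)" and ?S = "cube c s"
  have s: "0 < s" using t by simp
  have sub: "cube c t \<subseteq> ?S" using t by (intro cube_mono) simp
  note \<alpha> = coeff_matrix_props(1)[OF A] and \<beta> = coeff_matrix_props(2)[OF A]
  obtain g where g: "sq_integrable ?M u" "weak_grad ?S u g" using u by (rule H_AE)
  have E: "0 < lam i" "neumann_eig ?S A (lam i) (v i)" if "i < n" for i
    using eig that by (auto simp: first_neumann_eigs_def)
  have vs: "sq_integrable ?M (v i)" and "\<exists>g. weak_grad ?S (v i) g" if "i < n" for i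
    using E(2)[OF that] by (auto simp: neumann_eig_def H1_iff)
  then obtain gv where gv: "\<And>i. i < n \<Longrightarrow> weak_grad ?S (v i) (gv i)" by metis
  have hA: "H_A ?S A (h i)" and h0: "H1_0 ?S (\<lambda>x. h i x - v i x)" if "i < n" for i
    using harm[OF that] by (auto simp: harmonic_ext_def)
  have hs: "sq_integrable ?M (h i)" and "\<exists>g. weak_grad ?S (h i) g" if "i < n" for i
    using hA[OF that] by (auto simp: H_A_def H1_iff)
  then obtain gh where gh: "\<And>i. i < n \<Longrightarrow> weak_grad ?S (h i) (gh i)" by metis
  let ?w = "\<lambda>i. zero_mean ?S (h i)"
  note ws = zero_mean_weak_grad[OF hs gh]
  have gl: "l2_field ?S g" by (rule weak_grad_l2_field[OF g(2)])
  have ghl: "l2_field ?S (gh i)" if "i < n" for i by (rule weak_grad_l2_field[OF gh[OF that]])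
  \<comment> \<open>Subtracting means leaves gradients unchanged, so the projection onto the span of
    the centred functions is found from the gradients of the \<open>h i\<close>.\<close>
  obtain b where b: "\<And>k. k < n \<Longrightarrow> field_form ?S A (\<lambda>x. g x - (\<Sum>i<n. b i *\<^sub>R gh i x)) (gh k) = 0"
    using field_form_projection[where n=n and W=gh, OF A gl ghl] by blast
  define y where "y x = u x - (\<Sum>i<n. b i * ?w i x)" for x
  define z where "z x = (\<Sum>i<n. b i *\<^sub>R gh i x)" for x
  define q where "q x = g x - z x" for x
  have ys: "sq_integrable ?M y"
    unfolding y_def[abs_def] using ws(1) by (intro sq_integrable_diff sq_integrable_sum sq_integrable_cmult g(1)) simp
  have yq: "weak_grad ?S y q"
    unfolding y_def[abs_def] q_def[abs_def] z_def[abs_def] using ws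
    by (intro weak_grad_diff g weak_grad_sum weak_grad_cmult sq_integrable_sum sq_integrable_cmult) auto
  have zl: "l2_field ?S z" unfolding z_def[abs_def] using ghl by (intro l2_field_sum l2_field_scale) simp
  have ql: "l2_field ?S q" by (rule weak_grad_l2_field[OF yq])
  have qh: "field_form ?S A q (gh k) = 0" if "k < n" for k using b[OF that] by (simp add: q_def[abs_def] z_def)
  have harmq: "field_form ?S A q (cgrad \<phi>) = 0" if \<phi>: "test_fun ?S \<phi>" for \<phi>
  proof -
    have cg: "l2_field ?S (cgrad \<phi>)" by (rule l2_field_cgrad[OF \<phi>])
    have "field_form ?S A z (cgrad \<phi>) = (\<Sum>i<n. field_form ?S A (cgrad \<phi>) (\<lambda>x. b i *\<^sub>R gh i x))"
      unfolding z_def[abs_def] field_form_sym[OF A, of _ "cgrad \<phi>"]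
      using ghl by (intro field_form_sum_right[OF A cg] l2_field_scale) simp
    also have "\<dots> = 0"
      using H_A_field_form[OF s A hA gh \<phi>] field_form_sym[OF A, of "cgrad \<phi>"] by (simp add: field_form_scale_right)
    finally show ?thesis
      unfolding q_def[abs_def] field_form_diff_left[OF A cg gl zl] using H_A_field_form[OF s A u g(2) \<phi>] by simp
  qed
  have yA: "H_A ?S A y" by (rule H_AI[OF s A ys yq harmq])
  \<comment> \<open>Recentring keeps the gradient \<open>q\<close>, hence harmonicity and energy,
    and supplies the zero mean that the spectral bound asks for.\<close>
  define y' where "y' = zero_mean ?S y"
  have y's: "sq_integrable ?M y'" and y'q: "weak_grad ?S y' q"
    unfolding y'_def using zero_mean_weak_grad[OF ys yq] by auto
  have y'v: "(\<integral>x. v i x * y' x \<partial>?M) = 0" if i: "i < n" for i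
  proof -
    \<comment> \<open>Orthogonality of \<open>q\<close> to the gradient of \<open>h i\<close> passes
      to that of \<open>v i\<close>, because the difference lies in \<open>H1_0\<close> and the
      remainder is harmonic. The eigenvalue equation and \<open>lam i > 0\<close> then turn it into
      mean-square orthogonality.\<close>
    have "field_form ?S A q (\<lambda>x. gh i x - gv i x) = 0"
      by (rule H_A_orthogonal_H1_0[OF s A yA yq h0[OF i] weak_grad_diff[OF hs[OF i] gh[OF i] vs[OF i] gv[OF i]]])
    then have "field_form ?S A q (gv i) = 0"
      using qh[OF i] field_form_diff_right[OF A ql ghl[OF i] weak_grad_l2_field[OF gv[OF i]]] by simp
    then have "lam i * (\<integral>x. v i x * y' x \<partial>?M) = 0"
      using neumann_eig_field_form[OF s A E(2)[OF i] gv[OF i] y's y'q] field_form_sym[OF A, of q] by simp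
    then show ?thesis using E(1)[OF i] by simp
  qed
  have "\<alpha> * (pi * real K / s)\<^sup>2 * (\<integral>x. (y' x)\<^sup>2 \<partial>?M) \<le> field_form ?S A q q"
    by (rule orthogonal_complement_bound[OF s A eig n K(2) y's y'q _ y'v])
      (auto simp: y'_def integral_zero_mean[OF s ys])
  moreover have "field_form ?S A q q \<le> field_form ?S A g g"
  proof -
    have qz: "field_form ?S A q z = 0"
      unfolding z_def[abs_def] using ghl qh
      by (subst field_form_sum_right[OF A ql]) (auto intro: l2_field_scale simp: field_form_scale_right)
    have "g = (\<lambda>x. q x + z x)" by (simp add: q_def fun_eq_iff)
    then have "field_form ?S A g g = field_form ?S A (\<lambda>x. q x + z x) (\<lambda>x. q x + z x)" by simp
    also have "\<dots> = field_form ?S A q q + field_form ?S A z z"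
      using ql zl qz by (simp add: field_form_add_right[OF A] field_form_add_left[OF A] l2_field_add field_form_sym[OF A, of z q])
    finally show ?thesis using field_form_nonneg[OF A, of z] by simp
  qed
  ultimately have L2: "(\<integral>x. (y' x)\<^sup>2 \<partial>?M) \<le> field_form ?S A g g / (\<alpha> * (pi * real K / s)\<^sup>2)"
    using \<alpha> s K(1) by (subst pos_le_divide_eq) (auto simp: mult.commute)
  define L where "L = 16 / 5 / (s - t)"
  have "field_form (cube c t) A q q \<le> \<beta> * real CARD('d) * L\<^sup>2 * (\<integral>x. (y' x)\<^sup>2 \<partial>?M)"
    unfolding L_def by (rule caccioppoli[OF t A y's y'q harmq])
  also have "\<dots> \<le> \<beta> * real CARD('d) * L\<^sup>2 * (field_form ?S A g g / (\<alpha> * (pi * real K / s)\<^sup>2))"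
    using L2 \<beta> by (intro mult_left_mono) auto
  also have "\<dots> = (\<beta> / \<alpha> * real CARD('d)) * (L * (s / (pi * real K)))\<^sup>2 * field_form ?S A g g"
    using \<alpha> s K(1) by (simp add: field_simps power2_eq_square)
  finally have "sqrt (field_form (cube c t) A q q) \<le> sqrt ((\<beta> / \<alpha> * real CARD('d)) * (L * (s / (pi * real K)))\<^sup>2 * field_form ?S A g g)"
    by (rule real_sqrt_le_mono)
  also have "\<dots> = sqrt (\<beta> / \<alpha>) * sqrt (real CARD('d)) * L * (s / (pi * real K)) * sqrt (field_form ?S A g g)"
  proof -
    have "0 \<le> L * (s / (pi * real K))" using t by (simp add: L_def)
    then show ?thesis by (simp only: real_sqrt_mult real_sqrt_abs abs_of_nonneg mult.assoc)
  qed
  finally have "energy_norm (cube c t) A y \<le> sqrt (\<beta> / \<alpha>) * sqrt (real CARD('d)) * L * (s / (pi * real K)) * energy_norm ?S A u"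
    unfolding energy_norm_def
    using energy_form_eq[OF t(1) coeff_matrix_subset[OF A sub] weak_grad_subset[OF yq sub] weak_grad_subset[OF yq sub]]
      energy_form_eq[OF s A g(2) g(2)] by simp
  moreover have "H_A (cube c t) A y" using t by (intro H_A_subset[OF _ _ A yA]) auto
  ultimately show ?thesis unfolding y_def[abs_def] L_def by blast
qed

text \<open>What remains of the rate comparison after cancelling common factors; 8/5 is half of the
  16/5 of the cutoff. The case d = 3 is the tight one, about 2.77 against 2.86, and is settled by
  sixth powers, which clear the square and cube roots together.\<close>

lemma unit_ball_constant:
  assumes "CARD('d::finite) = 2 \<or> CARD('d) = 3"
  shows "8 / 5 * sqrt (real CARD('d)) \<le> sqrt pi * measure lebesgue (ball (0 :: real^'d) 1) powr (1 / real CARD('d))"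
  using assms
proof
  assume d: "CARD('d) = 2"
  have "measure lebesgue (ball (0 :: real^'d) 1) = pi" using content_ball[of 1 "0 :: real^'d"] d by (simp add: unit_ball_vol_2)
  moreover have "8 / 5 * sqrt 2 \<le> pi"
  proof -
    have "sqrt 2 \<le> 3 / 2" by (rule real_le_lsqrt) (auto simp: power2_eq_square)
    then show ?thesis using pi_gt3 by simp
  qed
  ultimately show ?thesis using d by (simp add: powr_half_sqrt)
next
  assume d: "CARD('d) = 3"
  have V: "measure lebesgue (ball (0 :: real^'d) 1) = 4 / 3 * pi"
    using content_ball[of 1 "0 :: real^'d"] d by (simp add: unit_ball_vol_3)
  define X where "X = (4 / 3 * pi) powr (1 / 3)"
  have X3: "X ^ 3 = 4 / 3 * pi" unfolding X_def by (simp add: powr_power)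
  \<comment> \<open>The bound pi > 3 would not do: 16/9 * 3^5 = 432, while the left-hand side is
    about 453.\<close>
  have p: "31 / 10 \<le> pi" using pi_approx(1) by simp
  have s6: "sqrt 3 ^ 6 = 27" "sqrt pi ^ 6 = pi ^ 3" "X ^ 6 = (4 / 3 * pi)\<^sup>2"
    using power_mult[of "sqrt 3" 2 3] power_mult[of "sqrt pi" 2 3] power_mult[of X 3 2] by (simp_all add: X3)
  have "(8 / 5 * sqrt 3) ^ 6 = (8 / 5) ^ 6 * sqrt 3 ^ 6" by (rule power_mult_distrib)
  also have "\<dots> \<le> (16 / 9) * (31 / 10) ^ 5" unfolding s6 by (simp add: eval_nat_numeral)
  also have "\<dots> \<le> (16 / 9) * pi ^ 5" using p by (intro mult_left_mono power_mono) auto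
  also have "\<dots> = sqrt pi ^ 6 * X ^ 6" unfolding s6 by (simp add: eval_nat_numeral)
  also have "\<dots> = (sqrt pi * X) ^ 6" by (rule power_mult_distrib[symmetric])
  finally have "8 / 5 * sqrt 3 \<le> sqrt pi * X"
    using power_le_imp_le_base[of "8 / 5 * sqrt 3" 5 "sqrt pi * X"] by (simp add: X_def)
  then show ?thesis unfolding V d by (simp add: X_def)
qed

section \<open>The sequence C_n and the assembly over the nested cubes\<close>

definition root_floor :: "nat \<Rightarrow> nat \<Rightarrow> nat" where
  "root_floor d n = nat \<lfloor>real n powr (1 / real d)\<rfloor>"

lemma root_floor_ge_1: "1 \<le> n \<Longrightarrow> 1 \<le> root_floor d n"
  unfolding root_floor_def by (simp add: le_nat_iff le_floor_iff ge_one_powr_ge_zero)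

lemma root_floor_power_le:
  assumes "0 < d" "1 \<le> n"
  shows "root_floor d n ^ d \<le> n"
proof -
  have "real (root_floor d n) \<le> real n powr (1 / real d)"
    unfolding root_floor_def by (simp add: of_nat_nat)
  then have "real (root_floor d n) ^ d \<le> (real n powr (1 / real d)) ^ d" by (rule power_mono) simp
  also have "\<dots> = real n" using assms by (simp add: powr_power)
  finally show ?thesis by (simp flip: of_nat_power)
qed

text \<open>The floor lies between X - 1 and X, with X the d-th root of n, so the ratio is squeezed
  between 1 and X / (X - 1) as soon as X is at least 2.\<close>

lemma root_floor_asymp:
  assumes "0 < d"
  shows "(\<lambda>n. 1 / real (root_floor d n)) \<sim>[at_top] (\<lambda>n. real n powr (- 1 / real d))"
proof (rule asymp_equivI')
  define X where "X n = real n powr (1 / real d)" for n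
  have Xlim: "filterlim X at_top at_top"
  proof (rule filterlim_at_top_mono)
    show "filterlim (\<lambda>n. exp (1 / real d * ln (real n))) at_top sequentially"
      by (intro filterlim_compose[OF exp_at_top] filterlim_tendsto_pos_mult_at_top[OF tendsto_const]
          filterlim_compose[OF ln_at_top filterlim_real_sequentially]) (use assms in simp)
    show "\<forall>\<^sub>F n in sequentially. exp (1 / real d * ln (real n)) \<le> X n"
      by (rule eventually_sequentiallyI[of 1]) (simp add: X_def powr_def)
  qed
  have up: "(\<lambda>n. X n / (X n - 1)) \<longlonglongrightarrow> 1"
  proof -
    have "((\<lambda>x::real. x / (x - 1)) \<longlongrightarrow> 1) at_top"
    proof -
      have "((\<lambda>x::real. 1 + inverse (x - 1)) \<longlongrightarrow> 1 + 0) at_top"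
        by (intro tendsto_intros filterlim_compose[OF tendsto_inverse_0_at_top]
            filterlim_tendsto_add_at_top[of "\<lambda>_. - 1" "- 1" _ "\<lambda>x. x", simplified])
          (auto intro: filterlim_ident)
      then have "((\<lambda>x::real. 1 + inverse (x - 1)) \<longlongrightarrow> 1) at_top" by simp
      then show ?thesis
        by (rule Lim_transform_eventually) (auto intro!: eventually_at_top_linorderI[of 2] simp: field_simps)
    qed
    from filterlim_compose[OF this Xlim] show ?thesis .
  qed
  have ev: "\<forall>\<^sub>F n in sequentially. 2 \<le> X n" using Xlim by (simp add: filterlim_at_top)
  have fl: "X n - 1 \<le> real (root_floor d n)" "real (root_floor d n) \<le> X n" for n
  proof -
    have "real (root_floor d n) = of_int \<lfloor>X n\<rfloor>" by (simp add: root_floor_def X_def of_nat_nat)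
    then show "X n - 1 \<le> real (root_floor d n)" "real (root_floor d n) \<le> X n" by linarith+
  qed
  have eq: "1 / real (root_floor d n) / real n powr (- 1 / real d) = X n / real (root_floor d n)" for n
    by (simp add: X_def powr_minus_divide)
  show "(\<lambda>n. 1 / real (root_floor d n) / real n powr (- 1 / real d)) \<longlonglongrightarrow> 1"
    unfolding eq
  proof (rule tendsto_sandwich[OF _ _ tendsto_const up])
    show "\<forall>\<^sub>F n in sequentially. 1 \<le> X n / real (root_floor d n)"
      using ev
    proof eventually_elim
      fix n assume "2 \<le> X n"
      then show "1 \<le> X n / real (root_floor d n)" using fl[of n] by (simp add: pos_le_divide_eq)
    qed
    show "\<forall>\<^sub>F n in sequentially. X n / real (root_floor d n) \<le> X n / (X n - 1)"
      using ev
    proof eventually_elim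
      fix n assume "2 \<le> X n"
      then show "X n / real (root_floor d n) \<le> X n / (X n - 1)" using fl[of n] by (intro divide_left_mono) auto
    qed
  qed
qed

text \<open>Step \<open>j\<close>, counted from 0, passes from cube \<open>Suc j\<close> to the
  next. All gaps are equal and every side is at most that of the outer cube, so one rate serves all
  steps.\<close>

lemma side_length_bounds:
  fixes \<sigma> \<rho> :: real
  assumes "0 < \<sigma>" "0 < \<rho>" "j < N"
  defines "S \<equiv> \<lambda>j. \<sigma> * (1 + \<rho> * real (N + 1 - j) / real N)"
  shows "0 < S (Suc (Suc j))" "S (Suc j) - S (Suc (Suc j)) = \<sigma> * \<rho> / real N" "S (Suc j) \<le> \<sigma> * (1 + \<rho>)"
proof -
  show "0 < S (Suc (Suc j))" using assms by (auto simp: S_def intro!: mult_pos_pos add_pos_nonneg)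
  define r where "r = real (N + 1 - Suc (Suc j))"
  have r: "real (N + 1 - Suc j) = r + 1" using assms(3) by (simp add: r_def of_nat_diff)
  show "S (Suc j) - S (Suc (Suc j)) = \<sigma> * \<rho> / real N"
    unfolding S_def r r_def[symmetric] by (simp add: algebra_simps add_divide_distrib)
  have "real (N + 1 - Suc j) / real N \<le> 1" using assms(3) by simp
  then have "\<rho> * (real (N + 1 - Suc j) / real N) \<le> \<rho> * 1" using assms(2) by (intro mult_left_mono) auto
  then show "S (Suc j) \<le> \<sigma> * (1 + \<rho>)" using assms(1) by (simp add: S_def)
qed

text \<open>\<open>C\<close> is bound before the cube, the matrix and \<open>N\<close>, which
  expresses that it depends on \<open>n\<close> and the dimension alone. The eigenfunctions and
  extensions are universally quantified, so the bound holds for every choice of them, for instance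
  within a multiple eigenvalue.\<close>

theorem theorem3p5:
  assumes "CARD('d::finite) = 2 \<or> CARD('d) = 3"
  shows "\<exists>C :: nat \<Rightarrow> real.
    C \<sim>[at_top] (\<lambda>n. real n powr (- 1 / real CARD('d))) \<and>
    (\<forall>(c :: real^'d) (\<sigma>::real) (\<rho>::real) (A :: real^'d \<Rightarrow> real^'d^'d) (\<alpha>::real) (\<beta>::real)
       (N::nat) (n::nat) (v :: nat \<Rightarrow> nat \<Rightarrow> real^'d \<Rightarrow> real) (lam :: nat \<Rightarrow> nat \<Rightarrow> real)
       (h :: nat \<Rightarrow> nat \<Rightarrow> real^'d \<Rightarrow> real) (u :: real^'d \<Rightarrow> real).
       0 < \<sigma> \<longrightarrow> 0 < \<rho> \<longrightarrow> 1 \<le> N \<longrightarrow> 1 \<le> n \<longrightarrow>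
       coeff_matrix (cube c ((1 + \<rho>) * \<sigma>)) A \<alpha> \<beta> \<longrightarrow>
       (\<forall>j\<in>{1..N}. first_neumann_eigs (sub_cube c \<sigma> \<rho> N j) A n (v j) (lam j) \<and>
          (\<forall>i<n. harmonic_ext (sub_cube c \<sigma> \<rho> N j) A (v j i) (h j i))) \<longrightarrow>
       H_A0 (cube c ((1 + \<rho>) * \<sigma>)) A u \<longrightarrow>
       (\<exists>coef :: nat \<Rightarrow> nat \<Rightarrow> real.
          energy_norm (cube c \<sigma>) A
            (\<lambda>x. u x - (\<Sum>j\<in>{1..N}. \<Sum>i<n. coef j i * zero_mean (sub_cube c \<sigma> \<rho> N j) (h j i) x))
          \<le> (2 * measure lebesgue (ball (0 :: real^'d) 1) powr (1 / real CARD('d)) / sqrt pi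
               * ((1 + \<rho>) / \<rho>) * real N * sqrt (\<beta> / \<alpha>) * C n) ^ N
            * energy_norm (cube c ((1 + \<rho>) * \<sigma>)) A u))"
proof -
  let ?d = "CARD('d)"
  define C where "C n = 1 / real (root_floor ?d n)" for n
  have d0: "0 < ?d" by simp
  show ?thesis
  proof (intro exI[of _ C] conjI allI impI)
    show "C \<sim>[at_top] (\<lambda>n. real n powr (- 1 / real ?d))"
      unfolding C_def[abs_def] by (rule root_floor_asymp[OF d0])
  next
    fix c :: "real^'d" and \<sigma> \<rho> \<alpha> \<beta> :: real and A :: "real^'d \<Rightarrow> real^'d^'d" and N n :: nat
      and v h :: "nat \<Rightarrow> nat \<Rightarrow> real^'d \<Rightarrow> real" and lam :: "nat \<Rightarrow> nat \<Rightarrow> real" and u :: "real^'d \<Rightarrow> real"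
    assume pos: "0 < \<sigma>" "0 < \<rho>" "1 \<le> N" "1 \<le> n"
      and A: "coeff_matrix (cube c ((1 + \<rho>) * \<sigma>)) A \<alpha> \<beta>"
      and eig: "\<forall>j\<in>{1..N}. first_neumann_eigs (sub_cube c \<sigma> \<rho> N j) A n (v j) (lam j) \<and>
          (\<forall>i<n. harmonic_ext (sub_cube c \<sigma> \<rho> N j) A (v j i) (h j i))"
      and u: "H_A0 (cube c ((1 + \<rho>) * \<sigma>)) A u"
    define S where "S j = \<sigma> * (1 + \<rho> * real (N + 1 - j) / real N)" for j
    define K where "K = root_floor ?d n"
    have K: "1 \<le> K" "K ^ ?d \<le> n" using root_floor_ge_1 root_floor_power_le d0 pos(4) by (auto simp: K_def)
    let ?\<gamma> = "measure lebesgue (ball (0 :: real^'d) 1) powr (1 / real ?d)"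
    define \<kappa> where "\<kappa> = 2 * ?\<gamma> / sqrt pi * ((1 + \<rho>) / \<rho>) * real N * sqrt (\<beta> / \<alpha>) * C n"
    have \<alpha>\<beta>: "0 < \<alpha>" "0 < \<beta>" using coeff_matrix_props(1,2)[OF A] by auto
    have \<kappa>0: "0 \<le> \<kappa>" using pos \<alpha>\<beta> by (simp add: \<kappa>_def C_def)
    have sc: "sub_cube c \<sigma> \<rho> N j = cube c (S j)" for j by (simp add: sub_cube_def S_def)
    \<comment> \<open>The N gaps run exactly from the outer cube, index 1, to the inner one, index N
      + 1.\<close>
    have S1: "S 1 = (1 + \<rho>) * \<sigma>" and SN: "S (Suc N) = \<sigma>" using pos by (simp_all add: S_def)
    note Sb = side_length_bounds[OF pos(1,2), of _ N, folded S_def]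
    \<comment> \<open>The side is replaced by its maximum and the gap by its common value; what is
      left is the comparison with the volume of the unit ball.\<close>
    have rate: "sqrt (\<beta> / \<alpha>) * sqrt (real ?d) * (16 / 5 / (S (Suc j) - S (Suc (Suc j)))) * (S (Suc j) / (pi * real K)) \<le> \<kappa>"
      if j: "j < N" for j
    proof -
      have N0: "0 < real N" and K0: "0 < real K" using pos(3) K(1) by simp_all
      let ?R = "16 / 5 / (\<sigma> * \<rho> / real N) * (\<sigma> * (1 + \<rho>) / (pi * real K))"
      have "sqrt (\<beta> / \<alpha>) * sqrt (real ?d) * (16 / 5 / (S (Suc j) - S (Suc (Suc j)))) * (S (Suc j) / (pi * real K))
        \<le> sqrt (\<beta> / \<alpha>) * sqrt (real ?d) * (16 / 5 / (\<sigma> * \<rho> / real N)) * (\<sigma> * (1 + \<rho>) / (pi * real K))"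
        unfolding Sb(2)[OF j] using Sb(3)[OF j] pos \<alpha>\<beta> K0 N0
        by (intro mult_left_mono divide_right_mono) auto
      also have "\<dots> = (2 * (8 / 5 * sqrt (real ?d)) / pi) * (((1 + \<rho>) / \<rho>) * real N * sqrt (\<beta> / \<alpha>) / real K)"
        using pos(1,2) N0 K0 by (simp add: field_simps)
      also have "\<dots> \<le> (2 * (sqrt pi * ?\<gamma>) / pi) * (((1 + \<rho>) / \<rho>) * real N * sqrt (\<beta> / \<alpha>) / real K)"
        using unit_ball_constant[OF assms] pos \<alpha>\<beta>
        by (intro mult_right_mono divide_right_mono mult_left_mono) auto
      also have "2 * (sqrt pi * ?\<gamma>) / pi = 2 * ?\<gamma> / sqrt pi"
        using real_div_sqrt[of pi] by (simp add: field_simps)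
      also have "2 * ?\<gamma> / sqrt pi * (((1 + \<rho>) / \<rho>) * real N * sqrt (\<beta> / \<alpha>) / real K) = \<kappa>"
        by (simp add: \<kappa>_def C_def K_def)
      finally show ?thesis .
    qed
    \<comment> \<open>The invariant keeps the remainder harmonic on the next cube, so each step
      treats the previous remainder as its new function and only adds coefficients for its own
      cube.\<close>
    have "\<exists>coef. H_A (cube c (S (Suc j))) A (\<lambda>x. u x - (\<Sum>k\<in>{1..j}. \<Sum>i<n. coef k i * zero_mean (cube c (S k)) (h k i) x)) \<and>
       energy_norm (cube c (S (Suc j))) A (\<lambda>x. u x - (\<Sum>k\<in>{1..j}. \<Sum>i<n. coef k i * zero_mean (cube c (S k)) (h k i) x))
         \<le> \<kappa> ^ j * energy_norm (cube c (S 1)) A u" if "j \<le> N" for j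
      using that
    proof (induction j)
      case 0
      then show ?case using u by (simp add: H_A0_def S1[simplified])
    next
      case (Suc j)
      then have j: "j < N" by simp
      from Suc obtain coef where coef: "H_A (cube c (S (Suc j))) A (\<lambda>x. u x - (\<Sum>k\<in>{1..j}. \<Sum>i<n. coef k i * zero_mean (cube c (S k)) (h k i) x))"
        "energy_norm (cube c (S (Suc j))) A (\<lambda>x. u x - (\<Sum>k\<in>{1..j}. \<Sum>i<n. coef k i * zero_mean (cube c (S k)) (h k i) x))
         \<le> \<kappa> ^ j * energy_norm (cube c (S 1)) A u" by auto
      define y where "y x = u x - (\<Sum>k\<in>{1..j}. \<Sum>i<n. coef k i * zero_mean (cube c (S k)) (h k i) x)" for x
      have lt: "S (Suc (Suc j)) < S (Suc j)"
      proof -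
        have "0 < \<sigma> * \<rho> / real N" using pos by simp
        then show ?thesis using Sb(2)[OF j] by linarith
      qed
      have Aj: "coeff_matrix (cube c (S (Suc j))) A \<alpha> \<beta>"
        by (rule coeff_matrix_subset[OF A cube_mono]) (use Sb(3)[OF j] in \<open>simp add: mult.commute\<close>)
      have mem: "Suc j \<in> {1..N}" using j by simp
      obtain b where b: "H_A (cube c (S (Suc (Suc j)))) A (\<lambda>x. y x - (\<Sum>i<n. b i * zero_mean (cube c (S (Suc j))) (h (Suc j) i) x))"
        "energy_norm (cube c (S (Suc (Suc j)))) A (\<lambda>x. y x - (\<Sum>i<n. b i * zero_mean (cube c (S (Suc j))) (h (Suc j) i) x))
          \<le> sqrt (\<beta> / \<alpha>) * sqrt (real ?d) * (16 / 5 / (S (Suc j) - S (Suc (Suc j)))) * (S (Suc j) / (pi * real K))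
            * energy_norm (cube c (S (Suc j))) A y"
        using approximation_step[OF Sb(1)[OF j] lt Aj _ pos(4) K, of "v (Suc j)" "lam (Suc j)" "h (Suc j)" y]
          eig[rule_format, OF mem] coef(1) unfolding sc y_def[abs_def] by blast
      define coef' where "coef' = coef(Suc j := b)"
      have e: "u x - (\<Sum>k\<in>{1..Suc j}. \<Sum>i<n. coef' k i * zero_mean (cube c (S k)) (h k i) x)
          = y x - (\<Sum>i<n. b i * zero_mean (cube c (S (Suc j))) (h (Suc j) i) x)" for x
      proof -
        have "(\<Sum>k\<in>{1..j}. \<Sum>i<n. coef' k i * zero_mean (cube c (S k)) (h k i) x)
            = (\<Sum>k\<in>{1..j}. \<Sum>i<n. coef k i * zero_mean (cube c (S k)) (h k i) x)"
          by (intro sum.cong refl) (auto simp: coef'_def)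
        then show ?thesis by (simp add: y_def coef'_def)
      qed
      have en: "0 \<le> energy_norm (cube c (S (Suc j))) A y"
      proof -
        obtain g where "weak_grad (cube c (S (Suc j))) y g" using coef(1)[folded y_def] by (rule H_AE)
        then show ?thesis using Sb(1)[OF j] lt
          by (simp add: energy_norm_def energy_form_eq[OF _ Aj] field_form_nonneg[OF Aj])
      qed
      have "energy_norm (cube c (S (Suc (Suc j)))) A (\<lambda>x. y x - (\<Sum>i<n. b i * zero_mean (cube c (S (Suc j))) (h (Suc j) i) x))
          \<le> \<kappa> * energy_norm (cube c (S (Suc j))) A y"
        using b(2) mult_right_mono[OF rate[OF j] en] by (rule order_trans)
      also have "\<dots> \<le> \<kappa> * (\<kappa> ^ j * energy_norm (cube c (S 1)) A u)"
        using coef(2) \<kappa>0 unfolding y_def[abs_def] by (rule mult_left_mono)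
      finally show ?case using b(1) unfolding e[symmetric] by (intro exI[of _ coef']) (simp add: mult.assoc)
    qed
    from this[of N]
    show "\<exists>coef. energy_norm (cube c \<sigma>) A
            (\<lambda>x. u x - (\<Sum>j\<in>{1..N}. \<Sum>i<n. coef j i * zero_mean (sub_cube c \<sigma> \<rho> N j) (h j i) x))
          \<le> (2 * ?\<gamma> / sqrt pi * ((1 + \<rho>) / \<rho>) * real N * sqrt (\<beta> / \<alpha>) * C n) ^ N
            * energy_norm (cube c ((1 + \<rho>) * \<sigma>)) A u"
      unfolding sc \<kappa>_def[symmetric] S1[symmetric] SN by blast
  qed
qed

end
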